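(* Let $\pi$ be a bivector field on a smooth manifold $P$ whose characteristic distribution $\pi^\sharp(T^*P)\subseteq TP$ is regular and integrable. Then there exists an exact 3-form $\phi$ on $P$ with respect to which $\pi$ is $\phi$-twisted Poisson.
   Context: $\pi^\sharp:T^*P\to TP$ is defined by $\beta(\pi^\sharp(\alpha))=\pi(\alpha,\beta)$. A distribution is regular if it has constant rank. For a closed 3-form $\phi$, the $\phi$-twisted Courant bracket on $\Gamma(TP\oplus T^*P)$ is $[\![(X,\alpha),(Y,\beta)]\!]_\phi=([X,Y],\mathcal{L}_X\beta-\mathbf{i}_Yd\alpha+\mathbf{i}_{X\wedge Y}\phi)$, where $\mathbf{i}_{X\wedge Y}\phi=\phi(X,Y,\cdot)$. The bivector field $\pi$ is $\phi$-twisted Poisson if $L_\pi=\{(\pi^\sharp(\alpha),\alpha)\}\subset TP\oplus T^*P$ satisfies $[\![\Gamma(L_\pi),\Gamma(L_\pi)]\!]_\phi\subseteq\Gamma(L_\pi)$. *)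

theory Defs
  imports "HOL-Analysis.Analysis" "HOL-Library.Function_Algebras"
begin

section \<open>Smooth maps between open subsets of normed spaces\<close>

fun Ck_on :: "nat \<Rightarrow> 'a::real_normed_vector set \<Rightarrow> ('a \<Rightarrow> 'b::real_normed_vector) \<Rightarrow> bool" where
  "Ck_on 0 S f \<longleftrightarrow> continuous_on S f"
| "Ck_on (Suc k) S f \<longleftrightarrow>
     (\<forall>x\<in>S. f differentiable (at x)) \<and> (\<forall>v. Ck_on k S (\<lambda>x. frechet_derivative f (at x) v))"

definition smooth_on :: "'a::real_normed_vector set \<Rightarrow> ('a \<Rightarrow> 'b::real_normed_vector) \<Rightarrow> bool" where
  "smooth_on S f \<longleftrightarrow> (\<forall>k. Ck_on k S f)"


section \<open>Smooth manifolds\<close>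

text \<open>A chart is a pair of its domain and its coordinate map; the values of the coordinate map
  outside the domain are irrelevant.  A smooth manifold is a Hausdorff, second countable type
  \<open>'p\<close> together with a smooth atlas; the atlas need not be maximal.\<close>

type_synonym ('p, 'e) chart = "'p set \<times> ('p \<Rightarrow> 'e)"

abbreviation dom_of :: "('p, 'e) chart \<Rightarrow> 'p set" where "dom_of c \<equiv> fst c"
abbreviation coord :: "('p, 'e) chart \<Rightarrow> 'p \<Rightarrow> 'e" where "coord c \<equiv> snd c"
abbreviation im_of :: "('p, 'e) chart \<Rightarrow> 'e set" where "im_of c \<equiv> snd c ` fst c"
abbreviation param :: "('p, 'e) chart \<Rightarrow> 'e \<Rightarrow> 'p" where "param c \<equiv> inv_into (fst c) (snd c)"

definition smooth_atlas ::
  "('p::{t2_space,second_countable_topology}, 'e::euclidean_space) chart set \<Rightarrow> bool" where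
  "smooth_atlas A \<longleftrightarrow>
     (\<Union>c\<in>A. dom_of c) = UNIV \<and>
     (\<forall>c\<in>A. open (dom_of c) \<and> open (im_of c) \<and> inj_on (coord c) (dom_of c) \<and>
            homeomorphism (dom_of c) (im_of c) (coord c) (param c)) \<and>
     (\<forall>c\<in>A. \<forall>d\<in>A. smooth_on (coord c ` (dom_of c \<inter> dom_of d)) (coord d \<circ> param c))"

definition charts_at :: "('p, 'e) chart set \<Rightarrow> 'p \<Rightarrow> ('p, 'e) chart set" where
  "charts_at A p = {c \<in> A. p \<in> dom_of c}"

definition chart_at :: "('p, 'e) chart set \<Rightarrow> 'p \<Rightarrow> ('p, 'e) chart" where
  "chart_at A p = (SOME c. c \<in> charts_at A p)"

definition smooth_map_into ::
  "('p::{t2_space,second_countable_topology}, 'e::euclidean_space) chart set \<Rightarrow>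
   'a::real_normed_vector set \<Rightarrow> ('a \<Rightarrow> 'p) \<Rightarrow> bool" where
  "smooth_map_into A W f \<longleftrightarrow> continuous_on W f \<and>
     (\<forall>c\<in>A. smooth_on {x \<in> W. f x \<in> dom_of c} (coord c \<circ> f))"


section \<open>Tangent vectors\<close>

text \<open>Pointwise scaling on function types, complementing the pointwise addition of
  Function-Algebras.\<close>

instantiation "fun" :: (type, scaleR) scaleR
begin
definition scaleR_fun :: "real \<Rightarrow> ('a \<Rightarrow> 'b) \<Rightarrow> 'a \<Rightarrow> 'b" where
  "scaleR_fun a f = (\<lambda>x. a *\<^sub>R f x)"
instance ..
end

instance "fun" :: (type, real_vector) real_vector
  by standard (simp_all add: scaleR_fun_def fun_eq_iff scaleR_add_right scaleR_add_left)

text \<open>A tangent vector at \<open>p\<close> is given by its coordinate vectors in all the charts around \<open>p\<close>, related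
  by the differentials of the transition maps.  In other words, it is an equivalence class of pairs
  (chart around \<open>p\<close>, coordinate vector), regarded as a function of the chart.  Values at charts not
  around \<open>p\<close> are set to zero, so that the tangent space is a linear subspace of a function space.\<close>

type_synonym ('p, 'e) tvec = "('p, 'e) chart \<Rightarrow> 'e"

definition trans_deriv ::
  "('p, 'e::euclidean_space) chart \<Rightarrow> ('p, 'e) chart \<Rightarrow> 'p \<Rightarrow> 'e \<Rightarrow> 'e" where
  "trans_deriv c d p = frechet_derivative (coord d \<circ> param c) (at (coord c p))"

definition tangent_space ::
  "('p, 'e::euclidean_space) chart set \<Rightarrow> 'p \<Rightarrow> ('p, 'e) tvec set" where
  "tangent_space A p =
     {v. (\<forall>c\<in>charts_at A p. \<forall>d\<in>charts_at A p. v d = trans_deriv c d p (v c)) \<and>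
         (\<forall>c. c \<notin> charts_at A p \<longrightarrow> v c = 0)}"

text \<open>The tangent vector at \<open>p\<close> whose coordinate vector in the chart \<open>c\<close> around \<open>p\<close> is \<open>u\<close>.\<close>

definition tvec_of ::
  "('p, 'e::euclidean_space) chart set \<Rightarrow> ('p, 'e) chart \<Rightarrow> 'p \<Rightarrow> 'e \<Rightarrow> ('p, 'e) tvec" where
  "tvec_of A c p u = (\<lambda>d. if d \<in> charts_at A p then trans_deriv c d p u else 0)"

text \<open>The differential at \<open>x\<close> of a map from a normed space into the manifold.\<close>

definition differential ::
  "('p, 'e::euclidean_space) chart set \<Rightarrow> ('a::real_normed_vector \<Rightarrow> 'p) \<Rightarrow> 'a \<Rightarrow> 'a \<Rightarrow> ('p, 'e) tvec" where
  "differential A f x u =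
     (\<lambda>d. if d \<in> charts_at A (f x) then frechet_derivative (coord d \<circ> f) (at x) u else 0)"


section \<open>Alternating forms and tensor fields\<close>

text \<open>Alternating \<open>k\<close>-linear forms on a linear subspace \<open>V\<close>: functions on lists of length \<open>k\<close> over
  \<open>V\<close>, extended by zero to all other lists.\<close>

definition alternating_forms :: "nat \<Rightarrow> 'v::real_vector set \<Rightarrow> ('v list \<Rightarrow> real) set" where
  "alternating_forms k V =
     {\<omega>. (\<forall>vs i x y a b. length vs = k \<and> set vs \<subseteq> V \<and> i < k \<and> x \<in> V \<and> y \<in> V \<longrightarrow>
            \<omega> (vs[i := a *\<^sub>R x + b *\<^sub>R y]) = a * \<omega> (vs[i := x]) + b * \<omega> (vs[i := y])) \<and>
         (\<forall>vs i j. length vs = k \<and> set vs \<subseteq> V \<and> i < j \<and> j < k \<and> vs ! i = vs ! j \<longrightarrow> \<omega> vs = 0) \<and>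
         (\<forall>vs. \<not> (length vs = k \<and> set vs \<subseteq> V) \<longrightarrow> \<omega> vs = 0)}"

type_synonym ('p, 'e) cotensor = "('p, 'e) tvec list \<Rightarrow> real"
type_synonym ('p, 'e) vfield = "'p \<Rightarrow> ('p, 'e) tvec"
type_synonym ('p, 'e) form = "'p \<Rightarrow> ('p, 'e) cotensor"
type_synonym ('p, 'e) bivector = "'p \<Rightarrow> ('p, 'e) cotensor list \<Rightarrow> real"

definition cotangent_space ::
  "('p, 'e::euclidean_space) chart set \<Rightarrow> 'p \<Rightarrow> ('p, 'e) cotensor set" where
  "cotangent_space A p = alternating_forms 1 (tangent_space A p)"

text \<open>The covector at \<open>p\<close> that maps a tangent vector to the inner product of \<open>u\<close> with its coordinate
  vector in the chart \<open>c\<close>; for basis vectors \<open>u\<close> these are the coordinate differentials.\<close>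

definition covec_of ::
  "('p, 'e::euclidean_space) chart set \<Rightarrow> ('p, 'e) chart \<Rightarrow> 'p \<Rightarrow> 'e \<Rightarrow> ('p, 'e) cotensor" where
  "covec_of A c p u =
     (\<lambda>vs. if length vs = 1 \<and> set vs \<subseteq> tangent_space A p then hd vs c \<bullet> u else 0)"

definition vector_field ::
  "('p, 'e::euclidean_space) chart set \<Rightarrow> ('p, 'e) vfield \<Rightarrow> bool" where
  "vector_field A X \<longleftrightarrow> (\<forall>p. X p \<in> tangent_space A p) \<and>
     (\<forall>c\<in>A. smooth_on (im_of c) (\<lambda>x. X (param c x) c))"

definition diff_form ::
  "('p, 'e::euclidean_space) chart set \<Rightarrow> nat \<Rightarrow> ('p, 'e) form \<Rightarrow> bool" where
  "diff_form A k \<omega> \<longleftrightarrow> (\<forall>p. \<omega> p \<in> alternating_forms k (tangent_space A p)) \<and>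
     (\<forall>c\<in>A. \<forall>us. length us = k \<longrightarrow>
        smooth_on (im_of c) (\<lambda>x. \<omega> (param c x) (map (tvec_of A c (param c x)) us)))"

text \<open>At each point, a bivector is an element of the second exterior power of the tangent space,
  regarded as an alternating bilinear form on the cotangent space.\<close>

definition bivector_field ::
  "('p, 'e::euclidean_space) chart set \<Rightarrow> ('p, 'e) bivector \<Rightarrow> bool" where
  "bivector_field A \<pi> \<longleftrightarrow> (\<forall>p. \<pi> p \<in> alternating_forms 2 (cotangent_space A p)) \<and>
     (\<forall>c\<in>A. \<forall>u w. smooth_on (im_of c)
        (\<lambda>x. \<pi> (param c x) [covec_of A c (param c x) u, covec_of A c (param c x) w]))"


section \<open>Cartan calculus\<close>

text \<open>The usual coordinate formulas.  Those for the exterior and the Lie derivative are evaluated at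
  \<open>p\<close> in some chart around \<open>p\<close>; the values do not depend on this chart.\<close>

definition lie_bracket ::
  "('p, 'e::euclidean_space) chart set \<Rightarrow> ('p, 'e) vfield \<Rightarrow> ('p, 'e) vfield \<Rightarrow> ('p, 'e) vfield" where
  "lie_bracket A X Y p =
     (\<lambda>c. if c \<in> charts_at A p then
            frechet_derivative (\<lambda>x. Y (param c x) c) (at (coord c p)) (X p c) -
            frechet_derivative (\<lambda>x. X (param c x) c) (at (coord c p)) (Y p c)
          else 0)"

definition interior_prod :: "('p, 'e) vfield \<Rightarrow> ('p, 'e) form \<Rightarrow> ('p, 'e) form" where
  "interior_prod X \<omega> p vs = \<omega> p (X p # vs)"

text \<open>In a chart, \<open>d\<omega>(v\<^sub>0, \<dots>, v\<^sub>k) = \<Sum>\<^sub>i (-1)\<^sup>i (D\<omega> \<cdot> v\<^sub>i)(v\<^sub>0, \<dots>, v\<^sub>k\<close> without \<open>v\<^sub>i)\<close>,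
  with the \<open>v\<^sub>j\<close> extended to constant coordinate vector fields.\<close>

definition ext_deriv ::
  "('p, 'e::euclidean_space) chart set \<Rightarrow> ('p, 'e) form \<Rightarrow> ('p, 'e) form" where
  "ext_deriv A \<omega> p vs =
     (if set vs \<subseteq> tangent_space A p then
        (let c = chart_at A p in
         \<Sum>i<length vs. (-1) ^ i *
           frechet_derivative
             (\<lambda>x. \<omega> (param c x)
                (map (\<lambda>v. tvec_of A c (param c x) (v c)) (take i vs @ drop (Suc i) vs)))
             (at (coord c p)) ((vs ! i) c))
      else 0)"

text \<open>In a chart,
  \<open>(L\<^sub>X \<omega>)(v\<^sub>1, \<dots>, v\<^sub>k) = (D\<omega> \<cdot> X)(v\<^sub>1, \<dots>, v\<^sub>k) + \<Sum>\<^sub>i \<omega>(v\<^sub>1, \<dots>, DX \<cdot> v\<^sub>i, \<dots>, v\<^sub>k)\<close>.\<close>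

definition lie_deriv ::
  "('p, 'e::euclidean_space) chart set \<Rightarrow> ('p, 'e) vfield \<Rightarrow> ('p, 'e) form \<Rightarrow> ('p, 'e) form" where
  "lie_deriv A X \<omega> p vs =
     (if set vs \<subseteq> tangent_space A p then
        (let c = chart_at A p in
         frechet_derivative
           (\<lambda>x. \<omega> (param c x) (map (\<lambda>v. tvec_of A c (param c x) (v c)) vs))
           (at (coord c p)) (X p c) +
         (\<Sum>i<length vs. \<omega> p (vs[i := tvec_of A c p
           (frechet_derivative (\<lambda>x. X (param c x) c) (at (coord c p)) ((vs ! i) c))])))
      else 0)"

definition closed_form ::
  "('p, 'e::euclidean_space) chart set \<Rightarrow> nat \<Rightarrow> ('p, 'e) form \<Rightarrow> bool" where
  "closed_form A k \<phi> \<longleftrightarrow> diff_form A k \<phi> \<and> ext_deriv A \<phi> = 0"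

definition exact_form ::
  "('p, 'e::euclidean_space) chart set \<Rightarrow> nat \<Rightarrow> ('p, 'e) form \<Rightarrow> bool" where
  "exact_form A k \<phi> \<longleftrightarrow> diff_form A k \<phi> \<and>
     (\<exists>j \<omega>. k = Suc j \<and> diff_form A j \<omega> \<and> \<phi> = ext_deriv A \<omega>)"


section \<open>Distributions\<close>

definition sharp ::
  "('p, 'e::euclidean_space) chart set \<Rightarrow> ('p, 'e) bivector \<Rightarrow> 'p \<Rightarrow> ('p, 'e) cotensor \<Rightarrow> ('p, 'e) tvec" where
  "sharp A \<pi> p \<alpha> =
     (THE v. v \<in> tangent_space A p \<and> (\<forall>\<beta>\<in>cotangent_space A p. \<beta> [v] = \<pi> p [\<alpha>, \<beta>]))"

definition characteristic_distribution ::
  "('p, 'e::euclidean_space) chart set \<Rightarrow> ('p, 'e) bivector \<Rightarrow> 'p \<Rightarrow> ('p, 'e) tvec set" where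
  "characteristic_distribution A \<pi> p = sharp A \<pi> p ` cotangent_space A p"

definition regular_distribution :: "('p \<Rightarrow> ('p, 'e::euclidean_space) tvec set) \<Rightarrow> bool" where
  "regular_distribution D \<longleftrightarrow> (\<exists>r. \<forall>p. dim (D p) = r)"

text \<open>A distribution is integrable if there is an integral manifold through every point, that is, an
  immersed submanifold whose tangent space at each of its points is the distribution there.
  Since only its germ matters, the integral manifold is given by a single parametrization: an
  injective immersion \<open>f\<close> of a relatively open subset \<open>W \<inter> S\<close> of a linear subspace \<open>S\<close> of the model
  space (which makes any dimension up to that of the manifold available).  A smooth map on
  \<open>W \<inter> S\<close> is the restriction of a smooth map on an open set, which can be taken to be \<open>W\<close>.\<close>

definition integral_manifold_param ::
  "('p::{t2_space,second_countable_topology}, 'e::euclidean_space) chart set \<Rightarrow>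
   ('p \<Rightarrow> ('p, 'e) tvec set) \<Rightarrow> 'e set \<Rightarrow> 'e set \<Rightarrow> ('e \<Rightarrow> 'p) \<Rightarrow> bool" where
  "integral_manifold_param A D S W f \<longleftrightarrow>
     subspace S \<and> open W \<and> smooth_map_into A W f \<and> inj_on f (W \<inter> S) \<and>
     (\<forall>x \<in> W \<inter> S. inj_on (differential A f x) S \<and> differential A f x ` S = D (f x))"

definition integrable_distribution ::
  "('p::{t2_space,second_countable_topology}, 'e::euclidean_space) chart set \<Rightarrow>
   ('p \<Rightarrow> ('p, 'e) tvec set) \<Rightarrow> bool" where
  "integrable_distribution A D \<longleftrightarrow>
     (\<forall>p. \<exists>S W f. integral_manifold_param A D S W f \<and> p \<in> f ` (W \<inter> S))"


section \<open>Twisted Poisson structures\<close>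

text \<open>Sections of \<open>TP \<oplus> T\<^sup>*P\<close> are pairs of a vector field and a 1-form.\<close>

definition courant_bracket ::
  "('p, 'e::euclidean_space) chart set \<Rightarrow> ('p, 'e) form \<Rightarrow>
   ('p, 'e) vfield \<times> ('p, 'e) form \<Rightarrow> ('p, 'e) vfield \<times> ('p, 'e) form \<Rightarrow>
   ('p, 'e) vfield \<times> ('p, 'e) form" where
  "courant_bracket A \<phi> s t = (case (s, t) of ((X, \<alpha>), (Y, \<beta>)) \<Rightarrow>
     (lie_bracket A X Y,
      lie_deriv A X \<beta> - interior_prod Y (ext_deriv A \<alpha>) + interior_prod Y (interior_prod X \<phi>)))"

definition graph_sections ::
  "('p, 'e::euclidean_space) chart set \<Rightarrow> ('p, 'e) bivector \<Rightarrow>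
   (('p, 'e) vfield \<times> ('p, 'e) form) set" where
  "graph_sections A \<pi> =
     {(X, \<alpha>). vector_field A X \<and> diff_form A 1 \<alpha> \<and> (\<forall>p. X p = sharp A \<pi> p (\<alpha> p))}"

definition twisted_poisson ::
  "('p, 'e::euclidean_space) chart set \<Rightarrow> ('p, 'e) form \<Rightarrow> ('p, 'e) bivector \<Rightarrow> bool" where
  "twisted_poisson A \<phi> \<pi> \<longleftrightarrow> bivector_field A \<pi> \<and> closed_form A 3 \<phi> \<and>
     (\<forall>s\<in>graph_sections A \<pi>. \<forall>t\<in>graph_sections A \<pi>.
        courant_bracket A \<phi> s t \<in> graph_sections A \<pi>)"

end

theory Submission
  imports Defs "HOL-Real_Asymp.Real_Asymp"
begin

text \<open>
  Let \<open>D\<close> be the characteristic distribution.  On the leaves \<open>\<pi>\<close> is nondegenerate, so it has an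
  inverse there; suppose that \<open>\<omega>\<close> is a 2-form on the whole manifold that extends it, that is,
  \<open>\<omega>(\<pi>\<^sup>\<sharp>\<alpha>, \<pi>\<^sup>\<sharp>\<beta>) = \<pi>(\<alpha>, \<beta>)\<close>.  If \<open>X = \<pi>\<^sup>\<sharp>\<alpha>\<close> and \<open>Y = \<pi>\<^sup>\<sharp>\<beta>\<close>, then
  \<open>i\<^sub>X\<omega> + \<alpha>\<close> and \<open>i\<^sub>Y\<omega> + \<beta>\<close> annihilate \<open>D\<close>.  Differentiating this along \<open>D\<close> and using that \<open>D\<close> is
  involutive, one finds that the covector part of the \<open>d\<omega>\<close>-twisted bracket of \<open>(X, \<alpha>)\<close> and
  \<open>(Y, \<beta>)\<close> equals \<open>- \<omega>([X, Y], \<cdot>)\<close> on \<open>D\<close>, hence is mapped to \<open>[X, Y]\<close> by \<open>\<pi>\<^sup>\<sharp>\<close>.  So \<open>\<phi> = d\<omega>\<close> works.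

  The equations for \<open>\<omega>\<close> are affine, so that local solutions can be glued by a partition of unity.
  Near a point \<open>x\<^sub>0\<close> of a chart, let \<open>Q\<close> be the orthogonal projection onto the image of
  \<open>P = \<pi>\<^sup>\<sharp>\<close> at \<open>x\<^sub>0\<close>.  As \<open>P\<close> is skew and of constant rank, \<open>L = Q P Q + (1 - Q)\<close> is
  invertible near \<open>x\<^sub>0\<close>, and \<open>\<omega>(u, v) = - (L\<^sup>-\<^sup>1 Q u) \<bullet> (Q v)\<close> is a local solution.
\<close>


text \<open>The sign of the correction comes from \<open>\<omega>(X, \<pi>\<^sup>\<sharp>\<beta>) =
  \<pi>(\<alpha>, \<beta>) = - \<alpha>(\<pi>\<^sup>\<sharp>\<beta>)\<close>: on the distribution
  \<alpha> is minus the contraction of \<omega> with X. Differentiating this leaves derivatives of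
  X, Y and of a test field V, and \<omega> may be traded for covectors only on vectors tangent to
  the distribution. Single derivatives need not be tangent; the brackets of X, Y, V are, and this is
  where integrability enters. No Frobenius chart is available: integral manifolds are given through
  each point separately, with no smoothness from leaf to leaf. Involutivity is therefore derived
  pointwise from the single leaf through the point, by the symmetry of the second derivatives of its
  parametrization. A further obstacle is that the exterior and Lie derivatives are evaluated in a
  chart chosen anew at each point. Smoothness can be read only in a fixed chart, so chart
  independence has to be settled first; it rests on the same symmetry, applied to the transition
  maps.\<close>

section \<open>Calculus of smooth maps\<close>

lemma Ck_on_cong:
  assumes "open S" "\<And>x. x \<in> S \<Longrightarrow> f x = g x" "Ck_on k S f"
  shows "Ck_on k S g"
  using assms(2,3)
proof (induction k arbitrary: f g)
  case 0
  then show ?case by (auto cong: continuous_on_cong)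
next
  case (Suc k)
  have der: "(g has_derivative frechet_derivative f (at x)) (at x)" if "x \<in> S" for x
    using Suc.prems that assms(1)
    by (intro has_derivative_transform_within_open[of f _ x UNIV S g])
       (auto simp: frechet_derivative_works)
  have "Ck_on k S (\<lambda>x. frechet_derivative g (at x) v)" for v
    by (rule Suc.IH[of "\<lambda>x. frechet_derivative f (at x) v"])
       (use Suc.prems der frechet_derivative_at in \<open>force+\<close>)
  then show ?case using der by (auto simp: differentiable_def)
qed

lemma Ck_on_SucI:
  assumes "open S" "\<And>x. x \<in> S \<Longrightarrow> (f has_derivative f' x) (at x)" "\<And>v. Ck_on k S (\<lambda>x. f' x v)"
  shows "Ck_on (Suc k) S f"
proof -
  have "Ck_on k S (\<lambda>x. frechet_derivative f (at x) v)" for v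
    by (rule Ck_on_cong[OF assms(1) _ assms(3)[of v]]) (metis assms(2) frechet_derivative_at)
  then show ?thesis using assms(2) by (auto simp: differentiable_def)
qed

lemma Ck_on_has_derivative:
  assumes "Ck_on (Suc k) S f" "x \<in> S"
  shows "(f has_derivative frechet_derivative f (at x)) (at x)"
  using assms by (auto simp: frechet_derivative_works)

lemma Ck_on_subset: "Ck_on k S f \<Longrightarrow> T \<subseteq> S \<Longrightarrow> Ck_on k T f"
  by (induction k arbitrary: f) (auto intro: continuous_on_subset)

lemma Ck_on_pred: "Ck_on (Suc k) S f \<Longrightarrow> Ck_on k S f"
  by (induction k arbitrary: f)
     (auto intro!: continuous_at_imp_continuous_on differentiable_imp_continuous_within)

lemma Ck_on_continuous_on: "Ck_on k S f \<Longrightarrow> continuous_on S f"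
  by (induction k) (use Ck_on_pred in auto)

lemma Ck_on_local:
  "(\<And>x. x \<in> S \<Longrightarrow> \<exists>U. open U \<and> x \<in> U \<and> Ck_on k U f) \<Longrightarrow> Ck_on k S f"
proof (induction k arbitrary: f)
  case 0
  show ?case
    unfolding Ck_on.simps
    by (rule continuous_at_imp_continuous_on)
       (metis 0 Ck_on_continuous_on continuous_on_eq_continuous_at)
next
  case (Suc k)
  show ?case unfolding Ck_on.simps
  proof (intro conjI ballI allI)
    show "f differentiable at x" if "x \<in> S" for x using Suc.prems[OF that] by auto
    show "Ck_on k S (\<lambda>x. frechet_derivative f (at x) v)" for v
      by (rule Suc.IH) (use Suc.prems in force)
  qed
qed

lemma Ck_on_const: "Ck_on k S (\<lambda>x. c)"
  by (induction k arbitrary: c) auto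

lemma Ck_on_bounded_linear:
  assumes "bounded_linear L" shows "Ck_on k S L"
proof (cases k)
  case 0 then show ?thesis using assms by (simp add: linear_continuous_on)
next
  case (Suc j)
  have "(L has_derivative L) (at x)" for x
    using assms by (rule bounded_linear_imp_has_derivative)
  then have "frechet_derivative L (at x) = L" for x
    by (metis frechet_derivative_at)
  then show ?thesis using Suc \<open>\<And>x. (L has_derivative L) (at x)\<close>
    by (auto simp: Ck_on_const differentiable_def)
qed

lemma Ck_on_add:
  assumes "open S" "Ck_on k S f" "Ck_on k S g"
  shows "Ck_on k S (\<lambda>x. f x + g x)"
  using assms(2,3)
proof (induction k arbitrary: f g)
  case 0 then show ?case by (auto intro: continuous_intros)
next
  case (Suc k)
  show ?case
    by (rule Ck_on_SucI[OF assms(1) has_derivative_add])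
       (use Suc assms(1) in \<open>auto simp: frechet_derivative_works\<close>)
qed

lemma Ck_on_linear_compose:
  assumes "open S" "bounded_linear L" "Ck_on k S f"
  shows "Ck_on k S (\<lambda>x. L (f x))"
  using assms(3)
proof (induction k arbitrary: f)
  case 0 then show ?case using assms by (auto intro: bounded_linear.continuous_on)
next
  case (Suc k)
  show ?case
    by (rule Ck_on_SucI[OF assms(1) bounded_linear.has_derivative[OF assms(2)]])
       (use Suc assms(1) in \<open>auto simp: frechet_derivative_works\<close>)
qed

lemma Ck_on_bilinear:
  assumes "open S" "bounded_bilinear pr" "Ck_on k S f" "Ck_on k S g"
  shows "Ck_on k S (\<lambda>x. pr (f x) (g x))"
  using assms(3,4)
proof (induction k arbitrary: f g)
  case 0 then show ?case using assms by (auto intro: bounded_bilinear.continuous_on)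
next
  case (Suc k)
  show ?case
  proof (rule Ck_on_SucI[OF assms(1)])
    show "((\<lambda>x. pr (f x) (g x)) has_derivative
      (\<lambda>v. pr (f x) (frechet_derivative g (at x) v) + pr (frechet_derivative f (at x) v) (g x))) (at x)"
      if "x \<in> S" for x
      using Suc.prems that by (intro bounded_bilinear.FDERIV[OF assms(2)] Ck_on_has_derivative)
    show "Ck_on k S (\<lambda>x. pr (f x) (frechet_derivative g (at x) v) + pr (frechet_derivative f (at x) v) (g x))" for v
      using Suc.prems Ck_on_pred[OF Suc.prems(1)] Ck_on_pred[OF Suc.prems(2)]
      by (intro Ck_on_add Suc.IH assms(1)) auto
  qed
qed

lemma Ck_on_sum:
  assumes "open S" "\<And>i. i \<in> I \<Longrightarrow> Ck_on k S (f i)"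
  shows "Ck_on k S (\<lambda>x. \<Sum>i\<in>I. f i x)"
  using assms(2)
  by (induction I rule: infinite_finite_induct) (auto intro!: Ck_on_const Ck_on_add assms(1))

text \<open>\<open>Ck_on\<close> differentiates in a fixed direction, whereas the chain rule applies
  the derivative of \<open>g\<close> in the moving direction given by the derivative of
  \<open>f\<close>. Expanding that direction in the finite basis leaves sums of products of
  functions of order \<open>k\<close>, to which the induction hypothesis applies.\<close>

lemma Ck_on_compose:
  fixes f :: "'a::real_normed_vector \<Rightarrow> 'b::euclidean_space" and g :: "'b \<Rightarrow> 'c::real_normed_vector"
  assumes "open S" "open T" "f ` S \<subseteq> T" "Ck_on k S f" "Ck_on k T g"
  shows "Ck_on k S (\<lambda>x. g (f x))"
  using assms(4,5)
proof (induction k arbitrary: g)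
  case 0
  then show ?case using assms(3) by (auto intro: continuous_on_compose2)
next
  case (Suc k)
  have eq: "frechet_derivative g (at (f x)) (frechet_derivative f (at x) v) =
      (\<Sum>b\<in>Basis. (frechet_derivative f (at x) v \<bullet> b) *\<^sub>R frechet_derivative g (at (f x)) b)"
    if "x \<in> S" for x v
  proof -
    have "linear (frechet_derivative g (at (f x)))"
      using Suc.prems(2) that assms(3) by (intro linear_frechet_derivative) auto
    then show ?thesis
      by (subst (1) euclidean_representation[symmetric]) (simp only: linear_sum linear_cmul)
  qed
  show ?case
  proof (rule Ck_on_SucI[OF assms(1)])
    fix x assume x: "x \<in> S"
    have "((g \<circ> f) has_derivative
      (frechet_derivative g (at (f x)) \<circ> frechet_derivative f (at x))) (at x)"
      using Suc.prems x assms(3) by (intro diff_chain_at) (auto simp: frechet_derivative_works)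
    then show "((\<lambda>x. g (f x)) has_derivative
      (\<lambda>v. \<Sum>b\<in>Basis. (frechet_derivative f (at x) v \<bullet> b) *\<^sub>R frechet_derivative g (at (f x)) b)) (at x)"
      using eq[OF x] by (simp add: o_def)
  next
    fix v
    show "Ck_on k S (\<lambda>x. \<Sum>b\<in>Basis. (frechet_derivative f (at x) v \<bullet> b) *\<^sub>R frechet_derivative g (at (f x)) b)"
      using Suc.prems Suc.IH[OF Ck_on_pred[OF Suc.prems(1)], of "\<lambda>x. frechet_derivative g (at x) b" for b] assms(1)
      by (intro Ck_on_sum Ck_on_bilinear[OF _ bounded_bilinear_scaleR]
            Ck_on_linear_compose[OF _ bounded_linear_inner_left]) auto
  qed
qed

lemma smooth_onD: "smooth_on S f \<Longrightarrow> Ck_on k S f"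
  by (simp add: smooth_on_def)

lemma smooth_onI: "(\<And>k. Ck_on k S f) \<Longrightarrow> smooth_on S f"
  by (simp add: smooth_on_def)

lemma smooth_on_cong:
  assumes "open S" "\<And>x. x \<in> S \<Longrightarrow> f x = g x" "smooth_on S f"
  shows "smooth_on S g"
  by (rule smooth_onI[OF Ck_on_cong[OF assms(1,2) smooth_onD[OF assms(3)]]])

lemma smooth_on_subset: "smooth_on S f \<Longrightarrow> T \<subseteq> S \<Longrightarrow> smooth_on T f"
  by (rule smooth_onI[OF Ck_on_subset[OF smooth_onD]])

lemma smooth_on_continuous_on: "smooth_on S f \<Longrightarrow> continuous_on S f"
  by (rule Ck_on_continuous_on[OF smooth_onD])

lemma smooth_on_local:
  assumes "\<And>x. x \<in> S \<Longrightarrow> \<exists>U. open U \<and> x \<in> U \<and> smooth_on U f"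
  shows "smooth_on S f"
proof (rule smooth_onI)
  fix k show "Ck_on k S f"
    by (rule Ck_on_local) (metis assms smooth_onD)
qed

lemma smooth_on_const: "smooth_on S (\<lambda>x. c)"
  by (rule smooth_onI[OF Ck_on_const])

lemma smooth_on_bounded_linear: "bounded_linear L \<Longrightarrow> smooth_on S L"
  by (rule smooth_onI[OF Ck_on_bounded_linear])

lemma smooth_on_add:
  "open S \<Longrightarrow> smooth_on S f \<Longrightarrow> smooth_on S g \<Longrightarrow> smooth_on S (\<lambda>x. f x + g x)"
  by (rule smooth_onI[OF Ck_on_add[OF _ smooth_onD smooth_onD]])

lemma smooth_on_linear_compose:
  "open S \<Longrightarrow> bounded_linear L \<Longrightarrow> smooth_on S f \<Longrightarrow> smooth_on S (\<lambda>x. L (f x))"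
  by (rule smooth_onI[OF Ck_on_linear_compose[OF _ _ smooth_onD]])

lemma smooth_on_bilinear:
  "open S \<Longrightarrow> bounded_bilinear pr \<Longrightarrow> smooth_on S f \<Longrightarrow> smooth_on S g \<Longrightarrow> smooth_on S (\<lambda>x. pr (f x) (g x))"
  by (rule smooth_onI[OF Ck_on_bilinear[OF _ _ smooth_onD smooth_onD]])

lemma smooth_on_sum:
  "open S \<Longrightarrow> (\<And>i. i \<in> I \<Longrightarrow> smooth_on S (f i)) \<Longrightarrow> smooth_on S (\<lambda>x. \<Sum>i\<in>I. f i x)"
  by (rule smooth_onI[OF Ck_on_sum[OF _ smooth_onD]])

lemma smooth_on_compose:
  fixes f :: "'a::real_normed_vector \<Rightarrow> 'b::euclidean_space" and g :: "'b \<Rightarrow> 'c::real_normed_vector"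
  shows "open S \<Longrightarrow> open T \<Longrightarrow> f ` S \<subseteq> T \<Longrightarrow> smooth_on S f \<Longrightarrow> smooth_on T g \<Longrightarrow> smooth_on S (\<lambda>x. g (f x))"
  by (rule smooth_onI[OF Ck_on_compose[OF _ _ _ smooth_onD smooth_onD]])

lemmas smooth_on_inner = smooth_on_bilinear[OF _ bounded_bilinear_inner]
lemmas smooth_on_scaleR = smooth_on_bilinear[OF _ bounded_bilinear_scaleR]
lemmas smooth_on_mult = smooth_on_bilinear[OF _ bounded_bilinear_mult]
lemmas smooth_on_minus = smooth_on_linear_compose[OF _ bounded_linear_minus[OF bounded_linear_ident]]

lemma smooth_on_diff:
  "open S \<Longrightarrow> smooth_on S f \<Longrightarrow> smooth_on S g \<Longrightarrow> smooth_on S (\<lambda>x. f x - g x)"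
  using smooth_on_add[of S f "\<lambda>x. - g x"] smooth_on_minus[of S g] by simp

lemma smooth_on_prod:
  fixes f :: "'i \<Rightarrow> 'a::real_normed_vector \<Rightarrow> real"
  shows "open S \<Longrightarrow> (\<And>i. i \<in> I \<Longrightarrow> smooth_on S (f i)) \<Longrightarrow> smooth_on S (\<lambda>x. \<Prod>i\<in>I. f i x)"
  by (induction I rule: infinite_finite_induct) (auto intro!: smooth_on_const smooth_on_mult)

lemma smooth_on_has_derivative:
  "smooth_on S f \<Longrightarrow> x \<in> S \<Longrightarrow> (f has_derivative frechet_derivative f (at x)) (at x)"
  by (rule Ck_on_has_derivative[OF smooth_onD])

lemma smooth_on_frechet_derivative:
  assumes "smooth_on S f" shows "smooth_on S (\<lambda>x. frechet_derivative f (at x) v)"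
  using assms Ck_on.simps(2)[of _ S f] by (intro smooth_onI) (blast dest: smooth_onD)

section \<open>Linear maps depending smoothly on a parameter\<close>

lemma linear_expand_Basis:
  fixes L :: "'a::euclidean_space \<Rightarrow> 'b::real_vector"
  assumes "linear L" shows "L u = (\<Sum>b\<in>Basis. (u \<bullet> b) *\<^sub>R L b)"
  using assms by (subst (1) euclidean_representation[symmetric]) (simp only: linear_sum linear_cmul)

text \<open>A smooth matrix-valued function is encoded by smoothness of \<open>C x u\<close> for
  each fixed \<open>u\<close>. The basis expansion makes this usable when the argument moves
  together with \<open>x\<close>.\<close>

lemma smooth_on_family_apply:
  fixes C :: "'x::real_normed_vector \<Rightarrow> 'a::euclidean_space \<Rightarrow> 'b::real_normed_vector"
  assumes "open S" "\<And>x. x \<in> S \<Longrightarrow> linear (C x)" "\<And>u. smooth_on S (\<lambda>x. C x u)" "smooth_on S g"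
  shows "smooth_on S (\<lambda>x. C x (g x))"
proof (rule smooth_on_cong[OF assms(1)])
  show "(\<Sum>b\<in>Basis. (g x \<bullet> b) *\<^sub>R C x b) = C x (g x)" if "x \<in> S" for x
    by (rule linear_expand_Basis[OF assms(2)[OF that], symmetric])
  show "smooth_on S (\<lambda>x. \<Sum>b\<in>Basis. (g x \<bullet> b) *\<^sub>R C x b)"
    using assms by (intro smooth_on_sum smooth_on_scaleR smooth_on_inner smooth_on_const)
qed

lemma Ck_on_family_apply:
  fixes C :: "'x::real_normed_vector \<Rightarrow> 'a::euclidean_space \<Rightarrow> 'b::real_normed_vector"
  assumes "open S" "\<And>x. x \<in> S \<Longrightarrow> linear (C x)" "\<And>u. Ck_on k S (\<lambda>x. C x u)" "Ck_on k S g"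
  shows "Ck_on k S (\<lambda>x. C x (g x))"
proof (rule Ck_on_cong[OF assms(1)])
  show "(\<Sum>b\<in>Basis. (g x \<bullet> b) *\<^sub>R C x b) = C x (g x)" if "x \<in> S" for x
    by (rule linear_expand_Basis[OF assms(2)[OF that], symmetric])
  show "Ck_on k S (\<lambda>x. \<Sum>b\<in>Basis. (g x \<bullet> b) *\<^sub>R C x b)"
    using assms by (intro Ck_on_sum Ck_on_bilinear[OF _ bounded_bilinear_scaleR]
            Ck_on_linear_compose[OF _ bounded_linear_inner_left]) 
qed

lemma has_derivative_family_apply:
  fixes C :: "'x::real_normed_vector \<Rightarrow> 'a::euclidean_space \<Rightarrow> 'b::real_normed_vector"
  assumes "open S" "x0 \<in> S" and lin: "\<And>x. x \<in> S \<Longrightarrow> linear (C x)"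
    and C': "\<And>u. ((\<lambda>x. C x u) has_derivative C' u) (at x0)"
    and g: "(g has_derivative g') (at x0)"
  shows "((\<lambda>x. C x (g x)) has_derivative (\<lambda>h. C' (g x0) h + C x0 (g' h))) (at x0)"
proof -
  have *: "((\<lambda>x. \<Sum>b\<in>Basis. (g x \<bullet> b) *\<^sub>R C x b) has_derivative
     (\<lambda>h. \<Sum>b\<in>Basis. (g x0 \<bullet> b) *\<^sub>R C' b h + (g' h \<bullet> b) *\<^sub>R C x0 b)) (at x0)"
    by (intro has_derivative_sum has_derivative_scaleR has_derivative_inner_left C' g)
  \<comment> \<open>The derivatives \<open>C' u\<close> are given for each \<open>u\<close>
    separately; their linearity in \<open>u\<close> follows from uniqueness of the
    derivative.\<close>
  have "((\<lambda>x. \<Sum>b\<in>Basis. (u \<bullet> b) *\<^sub>R C x b) has_derivative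
     (\<lambda>h. \<Sum>b\<in>Basis. (u \<bullet> b) *\<^sub>R C' b h)) (at x0)" for u
    by (intro has_derivative_sum has_derivative_scaleR_right C')
  then have "((\<lambda>x. C x u) has_derivative (\<lambda>h. \<Sum>b\<in>Basis. (u \<bullet> b) *\<^sub>R C' b h)) (at x0)" for u
    by (rule has_derivative_transform_within_open[OF _ assms(1,2)]) (simp add: linear_expand_Basis[OF lin, symmetric])
  then have C'eq: "C' u = (\<lambda>h. \<Sum>b\<in>Basis. (u \<bullet> b) *\<^sub>R C' b h)" for u
    using C' has_derivative_unique by blast
  have "((\<lambda>x. C x (g x)) has_derivative
     (\<lambda>h. \<Sum>b\<in>Basis. (g x0 \<bullet> b) *\<^sub>R C' b h + (g' h \<bullet> b) *\<^sub>R C x0 b)) (at x0)"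
    by (rule has_derivative_transform_within_open[OF * assms(1,2)]) (simp add: linear_expand_Basis[OF lin, symmetric])
  then show ?thesis
    by (subst C'eq, subst linear_expand_Basis[OF lin[OF assms(2)], of "g' _"]) (simp add: sum.distrib)
qed

subsection \<open>Symmetry of second derivatives\<close>

text \<open>The mean value theorem is applied first in the direction \<open>u\<close>, to the
  difference of two opposite sides of the parallelogram, and then in the direction \<open>v\<close>
  to the resulting \<open>u\<close>-derivative. As the left-hand side is symmetric in
  \<open>u\<close> and \<open>v\<close>, the other order expresses it by the other mixed
  derivative.\<close>

lemma second_difference_mvt:
  fixes f :: "'a::real_normed_vector \<Rightarrow> real"
  assumes C2: "Ck_on 2 S f" and h: "0 < h"
    and S: "\<And>s t. 0 \<le> s \<Longrightarrow> s \<le> h \<Longrightarrow> 0 \<le> t \<Longrightarrow> t \<le> h \<Longrightarrow> x + s *\<^sub>R u + t *\<^sub>R v \<in> S"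
  obtains s t where "0 < s" "s < h" "0 < t" "t < h"
    "f (x + h *\<^sub>R u + h *\<^sub>R v) - f (x + h *\<^sub>R u) - f (x + h *\<^sub>R v) + f x =
    h * (h * frechet_derivative (\<lambda>y. frechet_derivative f (at y) u) (at (x + s *\<^sub>R u + t *\<^sub>R v)) v)"
proof -
  have C1: "Ck_on (Suc 0) S f" using C2 Ck_on_pred[of "Suc 0" S f] by (simp add: numeral_2_eq_2)
  have C1': "Ck_on (Suc 0) S (\<lambda>y. frechet_derivative f (at y) u)" using C2 by (simp add: numeral_2_eq_2)
  let ?D = "\<lambda>y. frechet_derivative f (at y)"
  let ?E = "\<lambda>y. frechet_derivative (\<lambda>y. frechet_derivative f (at y) u) (at y)"
  have der: "((\<lambda>s. f (x + s *\<^sub>R u + t *\<^sub>R v)) has_real_derivative ?D (x + s *\<^sub>R u + t *\<^sub>R v) u) (at s)"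
    if "0 \<le> s" "s \<le> h" "0 \<le> t" "t \<le> h" for s t
  proof -
    note d = Ck_on_has_derivative[OF C1 S[OF that]]
    have "((\<lambda>s. x + s *\<^sub>R u + t *\<^sub>R v) has_derivative (\<lambda>r. r *\<^sub>R u)) (at s)"
      by (rule derivative_eq_intros refl)+ simp
    from diff_chain_at[OF this d, unfolded o_def]
    show ?thesis
      by (rule has_derivative_imp_has_field_derivative)
         (simp add: linear_cmul[OF has_derivative_linear[OF d]])
  qed
  have der2: "((\<lambda>t. ?D (x + s *\<^sub>R u + t *\<^sub>R v) u) has_real_derivative ?E (x + s *\<^sub>R u + t *\<^sub>R v) v) (at t)"
    if "0 \<le> s" "s \<le> h" "0 \<le> t" "t \<le> h" for s t
  proof -
    note d = Ck_on_has_derivative[OF C1' S[OF that]]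
    have "((\<lambda>t. x + s *\<^sub>R u + t *\<^sub>R v) has_derivative (\<lambda>r. r *\<^sub>R v)) (at t)"
      by (rule derivative_eq_intros refl)+ simp
    from diff_chain_at[OF this d, unfolded o_def]
    show ?thesis
      by (rule has_derivative_imp_has_field_derivative)
         (simp add: linear_cmul[OF has_derivative_linear[OF d]])
  qed
  have "\<exists>s>0. s < h \<and>
     (f (x + h *\<^sub>R u + h *\<^sub>R v) - f (x + h *\<^sub>R u + 0 *\<^sub>R v)) - (f (x + 0 *\<^sub>R u + h *\<^sub>R v) - f (x + 0 *\<^sub>R u + 0 *\<^sub>R v)) =
     (h - 0) * (?D (x + s *\<^sub>R u + h *\<^sub>R v) u - ?D (x + s *\<^sub>R u + 0 *\<^sub>R v) u)"
    by (rule MVT2[where f="\<lambda>s. f (x + s *\<^sub>R u + h *\<^sub>R v) - f (x + s *\<^sub>R u + 0 *\<^sub>R v)"])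
       (use h in \<open>auto intro!: DERIV_diff der der[where t=0, simplified]\<close>)
  then obtain s where s: "0 < s" "s < h" and e1:
    "(f (x + h *\<^sub>R u + h *\<^sub>R v) - f (x + h *\<^sub>R u + 0 *\<^sub>R v)) - (f (x + 0 *\<^sub>R u + h *\<^sub>R v) - f (x + 0 *\<^sub>R u + 0 *\<^sub>R v)) =
     (h - 0) * (?D (x + s *\<^sub>R u + h *\<^sub>R v) u - ?D (x + s *\<^sub>R u + 0 *\<^sub>R v) u)" by blast
  have "\<exists>t>0. t < h \<and> ?D (x + s *\<^sub>R u + h *\<^sub>R v) u - ?D (x + s *\<^sub>R u + 0 *\<^sub>R v) u =
     (h - 0) * ?E (x + s *\<^sub>R u + t *\<^sub>R v) v"
    by (rule MVT2[where f="\<lambda>t. ?D (x + s *\<^sub>R u + t *\<^sub>R v) u"]) (use h s in \<open>auto intro!: der2\<close>)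
  then obtain t where t: "0 < t" "t < h" and e2:
    "?D (x + s *\<^sub>R u + h *\<^sub>R v) u - ?D (x + s *\<^sub>R u + 0 *\<^sub>R v) u = (h - 0) * ?E (x + s *\<^sub>R u + t *\<^sub>R v) v"
    by blast
  show ?thesis
    by (rule that[OF s t]) (use e1[unfolded e2] in simp)
qed

text \<open>By the two orders of the second difference, the mixed derivatives agree at two possibly
  different points of an arbitrarily small parallelogram. If they differed at \<open>x\<close>,
  continuity with tolerance half of the gap would contradict this.\<close>

lemma second_derivative_symmetric_real:
  fixes f :: "'a::real_normed_vector \<Rightarrow> real"
  assumes "open S" "x \<in> S" "Ck_on 2 S f"
  shows "frechet_derivative (\<lambda>y. frechet_derivative f (at y) u) (at x) v =
         frechet_derivative (\<lambda>y. frechet_derivative f (at y) v) (at x) u" (is "?E u v x = ?E v u x")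
proof (rule ccontr)
  assume ne: "?E u v x \<noteq> ?E v u x"
  define e where "e = \<bar>?E u v x - ?E v u x\<bar> / 2"
  have "e > 0" using ne by (simp add: e_def)
  have "Ck_on 0 S (?E u v)" for u v
    using assms(3) unfolding numeral_2_eq_2 Ck_on.simps(2) by blast
  then have cont: "isCont (?E u v) x" for u v
    using assms(1,2) continuous_on_eq_continuous_at unfolding Ck_on.simps(1) by blast
  have "\<exists>d>0. \<forall>y. dist y x < d \<longrightarrow> dist (?E u v y) (?E u v x) < e" for u v
    using cont[of u v] \<open>e > 0\<close> unfolding continuous_at_eps_delta by metis
  from this[of u v] this[of v u]
  obtain d1 d2 where d: "d1 > 0" "\<And>y. dist y x < d1 \<Longrightarrow> dist (?E u v y) (?E u v x) < e"
     "d2 > 0" "\<And>y. dist y x < d2 \<Longrightarrow> dist (?E v u y) (?E v u x) < e" by blast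
  obtain d3 where d3: "d3 > 0" "ball x d3 \<subseteq> S" using assms openE by blast
  define d where "d = min d1 (min d2 d3)"
  have "d > 0" using d d3 by (simp add: d_def)
  \<comment> \<open>This makes the whole parallelogram lie within distance \<open>d\<close> of
    \<open>x\<close>; adding 1 keeps the divisor positive when \<open>u\<close> and \<open>v\<close>
    are both zero.\<close>
  define h where "h = d / (norm u + norm v + 1)"
  have h: "h > 0" using \<open>d > 0\<close> by (simp add: h_def add_nonneg_pos)
  have hd: "h * (norm u + norm v) < d"
  proof -
    have "h * (norm u + norm v + 1) = d"
      unfolding h_def using add_nonneg_pos[of "norm u + norm v" 1] by simp
    then have "h * (norm u + norm v) + h = d" unfolding distrib_left by simp
    then show ?thesis using h by linarith
  qed
  have near: "dist (x + s *\<^sub>R u + t *\<^sub>R v) x < d"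
    if "0 \<le> s" "s \<le> h" "0 \<le> t" "t \<le> h" for s t
  proof -
    have "norm (s *\<^sub>R u + t *\<^sub>R v) \<le> \<bar>s\<bar> * norm u + \<bar>t\<bar> * norm v"
      by (metis norm_scaleR norm_triangle_ineq)
    also have "\<dots> \<le> h * norm u + h * norm v"
      using that by (intro add_mono mult_right_mono) auto
    also have "\<dots> < d" using hd by (simp add: algebra_simps)
    finally show ?thesis by (simp add: dist_norm add.assoc)
  qed
  have inS: "x + s *\<^sub>R u + t *\<^sub>R v \<in> S" if "0 \<le> s" "s \<le> h" "0 \<le> t" "t \<le> h" for s t
  proof -
    have "x + s *\<^sub>R u + t *\<^sub>R v \<in> ball x d3" using near[OF that] by (simp add: d_def dist_commute)
    then show ?thesis using d3(2) by blast
  qed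
  have inS': "x + s *\<^sub>R v + t *\<^sub>R u \<in> S" if "0 \<le> s" "s \<le> h" "0 \<le> t" "t \<le> h" for s t
    using inS[OF that(3,4,1,2)] by (simp only: add.assoc add.commute[of "s *\<^sub>R v"])
  obtain s t where st: "0 < s" "s < h" "0 < t" "t < h" and e1:
    "f (x + h *\<^sub>R u + h *\<^sub>R v) - f (x + h *\<^sub>R u) - f (x + h *\<^sub>R v) + f x =
    h * (h * ?E u v (x + s *\<^sub>R u + t *\<^sub>R v))"
    by (rule second_difference_mvt[OF assms(3) h inS])
  obtain s' t' where st': "0 < s'" "s' < h" "0 < t'" "t' < h" and e2:
    "f (x + h *\<^sub>R v + h *\<^sub>R u) - f (x + h *\<^sub>R v) - f (x + h *\<^sub>R u) + f x =
    h * (h * ?E v u (x + s' *\<^sub>R v + t' *\<^sub>R u))"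
    by (rule second_difference_mvt[OF assms(3) h inS'])
  have swap: "x + h *\<^sub>R v + h *\<^sub>R u = x + h *\<^sub>R u + h *\<^sub>R v" "x + s' *\<^sub>R v + t' *\<^sub>R u = x + t' *\<^sub>R u + s' *\<^sub>R v"
    by (simp_all only: add_ac)
  have "h * (h * ?E u v (x + s *\<^sub>R u + t *\<^sub>R v)) = h * (h * ?E v u (x + t' *\<^sub>R u + s' *\<^sub>R v))"
    unfolding e1[symmetric] e2[unfolded swap, symmetric] by simp
  then have "?E u v (x + s *\<^sub>R u + t *\<^sub>R v) = ?E v u (x + t' *\<^sub>R u + s' *\<^sub>R v)" using h by simp
  moreover have "dist (?E u v (x + s *\<^sub>R u + t *\<^sub>R v)) (?E u v x) < e"
    using d(2) near[of s t] st by (simp add: d_def)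
  moreover have "dist (?E v u (x + t' *\<^sub>R u + s' *\<^sub>R v)) (?E v u x) < e"
    using d(4) near[of t' s'] st' by (simp add: d_def)
  ultimately have "\<bar>?E u v x - ?E v u x\<bar> < 2 * e" unfolding dist_real_def by linarith
  then show False by (simp add: e_def)
qed

lemma second_derivative_symmetric:
  fixes f :: "'a::real_normed_vector \<Rightarrow> 'b::euclidean_space"
  assumes "open S" "x \<in> S" "smooth_on S f"
  shows "frechet_derivative (\<lambda>y. frechet_derivative f (at y) u) (at x) v =
         frechet_derivative (\<lambda>y. frechet_derivative f (at y) v) (at x) u"
proof (rule euclidean_eqI)
  fix b :: 'b assume "b \<in> Basis"
  have 1: "frechet_derivative (\<lambda>y. f y \<bullet> b) (at y) w = frechet_derivative f (at y) w \<bullet> b" if "y \<in> S" for y w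
    using smooth_on_has_derivative[OF assms(3) that]
    by (subst frechet_derivative_at[symmetric, OF has_derivative_inner_left]) auto
  have 2: "frechet_derivative (\<lambda>y. frechet_derivative (\<lambda>y. f y \<bullet> b) (at y) w) (at x) z =
      frechet_derivative (\<lambda>y. frechet_derivative f (at y) w) (at x) z \<bullet> b" for w z
  proof -
    have "((\<lambda>y. frechet_derivative f (at y) w \<bullet> b) has_derivative
       (\<lambda>z. frechet_derivative (\<lambda>y. frechet_derivative f (at y) w) (at x) z \<bullet> b)) (at x)"
      using smooth_on_has_derivative[OF smooth_on_frechet_derivative[OF assms(3)] assms(2)]
      by (rule has_derivative_inner_left)
    then have "((\<lambda>y. frechet_derivative (\<lambda>y. f y \<bullet> b) (at y) w) has_derivative
       (\<lambda>z. frechet_derivative (\<lambda>y. frechet_derivative f (at y) w) (at x) z \<bullet> b)) (at x)"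
      by (rule has_derivative_transform_within_open[OF _ assms(1,2)]) (simp add: 1)
    from frechet_derivative_at[OF this] show ?thesis by metis
  qed
  have "Ck_on 2 S (\<lambda>y. f y \<bullet> b)"
    by (intro smooth_onD smooth_on_inner assms smooth_on_const)
  from second_derivative_symmetric_real[OF assms(1,2) this]
  show "frechet_derivative (\<lambda>y. frechet_derivative f (at y) u) (at x) v \<bullet> b =
    frechet_derivative (\<lambda>y. frechet_derivative f (at y) v) (at x) u \<bullet> b"
    unfolding 2 .
qed

section \<open>Differentiation at a zero, lower bounds and linearity of derivatives\<close>

text \<open>At a zero of \<open>f\<close> the term of the product rule that contains the derivative
  of \<open>g\<close> drops out, so continuity of \<open>g\<close> is enough. The remainder splits
  into the error quotient of \<open>f\<close> times \<open>g\<close> and a bounded quotient times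
  \<open>g y - g x\<close>.\<close>

lemma has_derivative_scaleR_vanishing:
  fixes f :: "'a::real_normed_vector \<Rightarrow> real" and g :: "'a \<Rightarrow> 'b::real_normed_vector"
  assumes f: "(f has_derivative f') (at x)" and f0: "f x = 0" and g: "isCont g x"
  shows "((\<lambda>y. f y *\<^sub>R g y) has_derivative (\<lambda>h. f' h *\<^sub>R g x)) (at x)"
proof -
  obtain K where K: "\<And>h. norm (f' h) \<le> norm h * K"
    using bounded_linear.bounded[OF has_derivative_bounded_linear[OF f]] by blast
  define r where "r y = (f y - f' (y - x)) /\<^sub>R norm (y - x)" for y
  have r: "(r \<longlongrightarrow> 0) (at x)"
    using f f0 unfolding r_def has_derivative_at_within by simp
  have g': "(g \<longlongrightarrow> g x) (at x)" using g by (simp add: isCont_def)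
  have 1: "((\<lambda>y. r y *\<^sub>R g y) \<longlongrightarrow> 0 *\<^sub>R g x) (at x)"
    by (intro tendsto_scaleR r g')
  have 2: "((\<lambda>y. (f' (y - x) / norm (y - x)) *\<^sub>R (g y - g x)) \<longlongrightarrow> 0) (at x)"
  proof (rule Lim_null_comparison)
    show "\<forall>\<^sub>F y in at x. norm ((f' (y - x) / norm (y - x)) *\<^sub>R (g y - g x)) \<le> \<bar>K\<bar> * norm (g y - g x)"
    proof (intro always_eventually allI)
      fix y
      have "norm (f' (y - x) / norm (y - x)) \<le> \<bar>K\<bar>"
      proof (cases "y = x")
        case False
        have "norm (f' (y - x)) \<le> norm (y - x) * \<bar>K\<bar>"
          by (rule order.trans[OF K]) (intro mult_left_mono, auto)
        then show ?thesis using False by (simp add: divide_le_eq mult.commute)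
      qed auto
      then show "norm ((f' (y - x) / norm (y - x)) *\<^sub>R (g y - g x)) \<le> \<bar>K\<bar> * norm (g y - g x)"
        unfolding norm_scaleR by (intro mult_right_mono) auto
    qed
    have "((\<lambda>y. \<bar>K\<bar> * norm (g y - g x)) \<longlongrightarrow> \<bar>K\<bar> * norm (g x - g x)) (at x)"
      by (intro tendsto_intros g')
    then show "((\<lambda>y. \<bar>K\<bar> * norm (g y - g x)) \<longlongrightarrow> 0) (at x)" by simp
  qed
  have "((\<lambda>y. r y *\<^sub>R g y + (f' (y - x) / norm (y - x)) *\<^sub>R (g y - g x)) \<longlongrightarrow> 0) (at x)"
    using tendsto_add[OF 1 2] by simp
  moreover have "r y *\<^sub>R g y + (f' (y - x) / norm (y - x)) *\<^sub>R (g y - g x) =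
     (f y *\<^sub>R g y - f x *\<^sub>R g x - f' (y - x) *\<^sub>R g x) /\<^sub>R norm (y - x)" for y
    by (simp add: r_def f0 algebra_simps divide_inverse)
  ultimately show ?thesis
    unfolding has_derivative_at_within
    by (simp add: bounded_linear.bounded_linear bounded_linear_scaleR_const has_derivative_bounded_linear[OF f])
qed

text \<open>This serves for families that are known to be continuous before they are known to be
  differentiable, such as the inverses below.\<close>

lemma has_derivative_family_apply_vanishing:
  fixes C :: "'x::real_normed_vector \<Rightarrow> 'a::euclidean_space \<Rightarrow> 'b::real_normed_vector"
  assumes "open S" "x0 \<in> S" and lin: "\<And>x. x \<in> S \<Longrightarrow> linear (C x)"
    and cont: "\<And>u. isCont (\<lambda>x. C x u) x0"
    and g: "(g has_derivative g') (at x0)" and g0: "g x0 = 0"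
  shows "((\<lambda>x. C x (g x)) has_derivative (\<lambda>h. C x0 (g' h))) (at x0)"
proof -
  have "((\<lambda>x. \<Sum>b\<in>Basis. (g x \<bullet> b) *\<^sub>R C x b) has_derivative
     (\<lambda>h. \<Sum>b\<in>Basis. (g' h \<bullet> b) *\<^sub>R C x0 b)) (at x0)"
    by (intro has_derivative_sum has_derivative_scaleR_vanishing cont has_derivative_inner_left g)
       (simp add: g0)
  then have *: "((\<lambda>x. \<Sum>b\<in>Basis. (g x \<bullet> b) *\<^sub>R C x b) has_derivative (\<lambda>h. C x0 (g' h))) (at x0)"
    by (simp add: linear_expand_Basis[OF lin[OF assms(2)], symmetric])
  show ?thesis
    by (rule has_derivative_transform_within_open[OF * assms(1,2)])
       (simp add: linear_expand_Basis[OF lin, symmetric])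
qed

text \<open>In finite dimension the operator norm is at most the sum of the norms of the images of
  the basis vectors, so convergence on the basis is already uniform on bounded sets.\<close>

lemma linear_family_tendsto_uniform:
  fixes A :: "'x::topological_space \<Rightarrow> 'a::euclidean_space \<Rightarrow> 'b::real_normed_vector"
  assumes lin: "\<forall>\<^sub>F x in F. linear (A x)" "linear A0"
    and lim: "\<And>b. ((\<lambda>x. A x b) \<longlongrightarrow> A0 b) F" and "e > 0"
  shows "\<forall>\<^sub>F x in F. \<forall>z. norm (A x z - A0 z) \<le> e * norm z"
proof -
  have "((\<lambda>x. \<Sum>b\<in>Basis. norm (A x b - A0 b)) \<longlongrightarrow> (\<Sum>b\<in>(Basis::'a set). norm (A0 b - A0 b))) F"
    by (intro tendsto_intros lim)
  then have "\<forall>\<^sub>F x in F. (\<Sum>b\<in>Basis. norm (A x b - A0 b)) < e"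
    using \<open>e > 0\<close> by (intro order_tendstoD) auto
  then show ?thesis using lin(1)
  proof eventually_elim
    case (elim x)
    show ?case
    proof
      fix z
      have "A x z - A0 z = (\<Sum>b\<in>Basis. (z \<bullet> b) *\<^sub>R (A x b - A0 b))"
        unfolding linear_expand_Basis[OF elim(2), of z] linear_expand_Basis[OF lin(2), of z]
        by (simp add: sum_subtractf scaleR_diff_right)
      also have "norm \<dots> \<le> (\<Sum>b\<in>Basis. norm z * norm (A x b - A0 b))"
        by (rule sum_norm_le) (auto intro!: mult_right_mono Basis_le_norm)
      also have "\<dots> = (\<Sum>b\<in>Basis. norm (A x b - A0 b)) * norm z"
        by (simp add: sum_distrib_left mult.commute)
      also have "\<dots> \<le> e * norm z" using elim by (intro mult_right_mono) auto
      finally show "norm (A x z - A0 z) \<le> e * norm z" .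
    qed
  qed
qed

text \<open>An injective linear map on a finite-dimensional space is bounded below, and a
  perturbation smaller than half of the bound preserves the other half.\<close>

lemma linear_family_bounded_below:
  fixes A :: "'x::topological_space \<Rightarrow> 'a::euclidean_space \<Rightarrow> 'b::euclidean_space"
  assumes lin: "\<forall>\<^sub>F x in F. linear (A x)" "linear A0"
    and lim: "\<And>b. ((\<lambda>x. A x b) \<longlongrightarrow> A0 b) F"
    and V: "subspace V" and inj: "\<And>z. z \<in> V \<Longrightarrow> A0 z = 0 \<Longrightarrow> z = 0"
  obtains m where "m > 0" "\<forall>\<^sub>F x in F. \<forall>z\<in>V. m * norm z \<le> norm (A x z)"
proof -
  obtain e where e: "e > 0" "\<And>z. z \<in> V \<Longrightarrow> norm (A0 z) \<ge> e * norm z"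
    using injective_imp_isometric[OF closed_subspace[OF V] V linear_conv_bounded_linear[THEN iffD1, OF lin(2)]] inj
    by blast
  have "\<forall>\<^sub>F x in F. \<forall>z. norm (A x z - A0 z) \<le> (e / 2) * norm z"
    using e by (intro linear_family_tendsto_uniform lin lim) auto
  then have "\<forall>\<^sub>F x in F. \<forall>z\<in>V. (e / 2) * norm z \<le> norm (A x z)"
  proof eventually_elim
    case (elim x)
    show ?case
    proof
      fix z assume "z \<in> V"
      have "norm (A0 z) \<le> norm (A x z) + norm (A x z - A0 z)" by norm
      moreover have "norm (A x z - A0 z) \<le> (e / 2) * norm z" using elim by blast
      ultimately show "(e / 2) * norm z \<le> norm (A x z)"
        using e(2)[OF \<open>z \<in> V\<close>] by simp
    qed
  qed
  then show ?thesis using e that[of "e/2"] by simp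
qed

text \<open>Additivity and homogeneity in \<open>w\<close> hold for every \<open>B x\<close> near
  the point and pass to the derivative because derivatives are unique.\<close>

lemma linear_derivative_of_family:
  fixes B :: "'x::real_normed_vector \<Rightarrow> 'a::real_vector \<Rightarrow> 'b::real_normed_vector"
  assumes S: "open S" "x \<in> S" and lin: "\<And>x. x \<in> S \<Longrightarrow> linear (B x)"
    and B': "\<And>w. ((\<lambda>x. B x w) has_derivative B' w) (at x)"
  shows "linear (\<lambda>w. B' w v)"
proof (rule linearI)
  fix w z :: 'a and r :: real
  have "((\<lambda>x. B x (w + z)) has_derivative (\<lambda>v. B' w v + B' z v)) (at x)"
    by (rule has_derivative_transform_within_open[OF has_derivative_add[OF B' B'] S])
       (simp add: linear_add[OF lin])
  from has_derivative_unique[OF B' this] show "B' (w + z) v = B' w v + B' z v" by metis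
  have "((\<lambda>x. B x (r *\<^sub>R w)) has_derivative (\<lambda>v. r *\<^sub>R B' w v)) (at x)"
    by (rule has_derivative_transform_within_open[OF has_derivative_scaleR_right[OF B'] S])
       (simp add: linear_cmul[OF lin])
  from has_derivative_unique[OF B' this] show "B' (r *\<^sub>R w) v = r *\<^sub>R B' w v" by metis
qed

subsection \<open>Inverses of smooth families\<close>

text \<open>Continuity of the inverse \<open>C\<close> comes from a lower bound for \<open>B\<close>
  that is uniform near each point. With \<open>w = C x0 u\<close> fixed,
  \<open>C x u = C x (u - B x w) + w\<close>, where the argument of \<open>C x\<close> vanishes at
  \<open>x0\<close>; hence continuity of \<open>C\<close> already gives differentiability. The
  derivative is again composed of \<open>C\<close> and derivatives of \<open>B\<close>, so each step
  of the induction gains one order.\<close>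

lemma smooth_family_inverse:
  fixes B :: "'x::real_normed_vector \<Rightarrow> 'a::euclidean_space \<Rightarrow> 'a"
  assumes S: "open S" and lin: "\<And>x. x \<in> S \<Longrightarrow> linear (B x)"
    and inj: "\<And>x. x \<in> S \<Longrightarrow> inj (B x)" and sm: "\<And>u. smooth_on S (\<lambda>x. B x u)"
  shows "smooth_on S (\<lambda>x. inv (B x) u)"
proof -
  define C where "C x = inv (B x)" for x
  have bij: "bij (B x)" if "x \<in> S" for x
    using lin[OF that] inj[OF that] linear_injective_imp_surjective by (auto simp: bij_def)
  have BC: "B x (C x u) = u" and CB: "C x (B x u) = u" if "x \<in> S" for x u
    using bij[OF that] by (simp_all add: C_def bij_is_surj surj_f_inv_f inv_f_f bij_is_inj)
  have linC: "linear (C x)" if "x \<in> S" for x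
    unfolding C_def by (rule inj_linear_imp_inv_linear[OF lin[OF that] inj[OF that]])
  have contB: "isCont (\<lambda>x. B x u) x" if "x \<in> S" for x u
    using smooth_on_continuous_on[OF sm] S that continuous_on_eq_continuous_at by blast
  have contC: "isCont (\<lambda>x. C x u) x0" if x0: "x0 \<in> S" for x0 u
  proof -
    have evS: "\<forall>\<^sub>F x in at x0. x \<in> S" using S x0 by (rule eventually_at_in_open')
    obtain m where m: "m > 0" "\<forall>\<^sub>F x in at x0. \<forall>z\<in>UNIV. m * norm z \<le> norm (B x z)"
    proof (rule linear_family_bounded_below[of B "at x0" "B x0" UNIV])
      show "\<forall>\<^sub>F x in at x0. linear (B x)" using evS lin by (rule eventually_mono)
      show "((\<lambda>x. B x b) \<longlongrightarrow> B x0 b) (at x0)" for b using contB[OF x0] by (simp add: isCont_def)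
      show "z = 0" if "B x0 z = 0" for z
        using CB[OF x0, of z] that linear_0[OF linC[OF x0]] by simp
    qed (use lin x0 in auto)
    have "((\<lambda>x. C x u - C x0 u) \<longlongrightarrow> 0) (at x0)"
    proof (rule Lim_null_comparison)
      show "\<forall>\<^sub>F x in at x0. norm (C x u - C x0 u) \<le> (1/m) * norm (B x0 (C x0 u) - B x (C x0 u))"
        using m(2) evS
      proof eventually_elim
        case (elim x)
        have "m * norm (C x u - C x0 u) \<le> norm (B x (C x u - C x0 u))" using elim by blast
        also have "B x (C x u - C x0 u) = B x0 (C x0 u) - B x (C x0 u)"
          by (simp add: linear_diff[OF lin[OF elim(2)]] BC elim x0)
        finally show ?case using m(1) by (simp add: field_simps)
      qed
      have "((\<lambda>x. (1/m) * norm (B x0 (C x0 u) - B x (C x0 u))) \<longlongrightarrow> (1/m) * norm (B x0 (C x0 u) - B x0 (C x0 u))) (at x0)"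
        by (intro tendsto_intros) (use contB[OF x0] in \<open>simp add: isCont_def\<close>)
      then show "((\<lambda>x. (1/m) * norm (B x0 (C x0 u) - B x (C x0 u))) \<longlongrightarrow> 0) (at x0)" by simp
    qed
    then show ?thesis using Lim_null isCont_def by blast
  qed
  have derC: "((\<lambda>x. C x u) has_derivative
      (\<lambda>h. - C x0 (frechet_derivative (\<lambda>x. B x (C x0 u)) (at x0) h))) (at x0)" if x0: "x0 \<in> S" for x0 u
  proof -
    let ?w = "C x0 u"
    have g: "((\<lambda>x. u - B x ?w) has_derivative (\<lambda>h. - frechet_derivative (\<lambda>x. B x ?w) (at x0) h)) (at x0)"
      using has_derivative_diff[OF has_derivative_const[of u] smooth_on_has_derivative[OF sm x0]] by simp
    have "((\<lambda>x. C x (u - B x ?w)) has_derivative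
        (\<lambda>h. C x0 (- frechet_derivative (\<lambda>x. B x ?w) (at x0) h))) (at x0)"
      by (rule has_derivative_family_apply_vanishing[OF S x0 linC contC[OF x0] g])
         (simp_all add: BC x0)
    then have "((\<lambda>x. C x (u - B x ?w) + ?w) has_derivative
        (\<lambda>h. C x0 (- frechet_derivative (\<lambda>x. B x ?w) (at x0) h) + 0)) (at x0)"
      by (intro has_derivative_add has_derivative_const)
    then have "((\<lambda>x. C x (u - B x ?w) + ?w) has_derivative
        (\<lambda>h. - C x0 (frechet_derivative (\<lambda>x. B x ?w) (at x0) h))) (at x0)"
      by (simp add: linear_neg[OF linC[OF x0]])
    then show ?thesis
      by (rule has_derivative_transform_within_open[OF _ S x0])
         (simp add: linear_diff[OF linC] CB)
  qed
  have "Ck_on k S (\<lambda>x. C x u)" for k u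
  proof (induction k arbitrary: u)
    case 0 then show ?case
      using contC by (simp add: continuous_at_imp_continuous_on)
  next
    case (Suc k)
    show ?case
    proof (rule Ck_on_SucI[OF S derC])
      fix v
      have Bv: "linear (\<lambda>w. frechet_derivative (\<lambda>x. B x w) (at x) v)" if x: "x \<in> S" for x
        by (rule linear_derivative_of_family[OF S x lin smooth_on_has_derivative[OF sm x]])
      show "Ck_on k S (\<lambda>x. - C x (frechet_derivative (\<lambda>y. B y (C x u)) (at x) v))"
        by (intro Ck_on_linear_compose[OF S bounded_linear_minus[OF bounded_linear_ident]]
              Ck_on_family_apply[OF S linC Suc.IH]
              Ck_on_family_apply[OF S Bv smooth_onD[OF smooth_on_frechet_derivative[OF sm]] Suc.IH])
    qed
  qed
  then show ?thesis unfolding C_def by (intro smooth_onI)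
qed

text \<open>The same bootstrap: the derivative is a product of two copies of the inverse and a
  derivative of \<open>f\<close>, up to sign.\<close>

lemma smooth_on_inverse_real:
  fixes f :: "'a::real_normed_vector \<Rightarrow> real"
  assumes S: "open S" and f: "smooth_on S f" and nz: "\<And>x. x \<in> S \<Longrightarrow> f x \<noteq> 0"
  shows "smooth_on S (\<lambda>x. inverse (f x))"
proof (rule smooth_onI)
  fix k show "Ck_on k S (\<lambda>x. inverse (f x))"
  proof (induction k)
    case 0 then show ?case using smooth_on_continuous_on[OF f] nz by (auto intro: continuous_on_inverse)
  next
    case (Suc k)
    show ?case
    proof (rule Ck_on_SucI[OF S Deriv.has_derivative_inverse])
      show "Ck_on k S (\<lambda>x. - (inverse (f x) * frechet_derivative f (at x) v * inverse (f x)))" for v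
        by (intro Ck_on_linear_compose[OF S bounded_linear_minus[OF bounded_linear_ident]]
           Ck_on_bilinear[OF S bounded_bilinear_mult] Suc smooth_onD[OF smooth_on_frechet_derivative[OF f]])
    qed (use nz smooth_on_has_derivative[OF f] in auto)
  qed
qed

subsection \<open>Bump functions\<close>

text \<open>The powers of \<open>1/t\<close> make this family closed under differentiation.\<close>

definition exp_flat :: "nat \<Rightarrow> real \<Rightarrow> real" where
  "exp_flat n t = (if t \<le> 0 then 0 else inverse t ^ n * exp (- inverse t))"

lemma exp_flat_tendsto: "(exp_flat n \<longlongrightarrow> 0) (at 0)"
proof -
  have "((\<lambda>t::real. inverse t ^ n * exp (- inverse t)) \<longlongrightarrow> 0) (at_right 0)"
    by real_asymp
  then have "(exp_flat n \<longlongrightarrow> 0) (at_right 0)"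
    by (rule Lim_transform_eventually) (auto simp: exp_flat_def eventually_at_filter)
  moreover have "(exp_flat n \<longlongrightarrow> 0) (at_left 0)"
    by (rule Lim_transform_eventually[OF tendsto_const]) (auto simp: exp_flat_def eventually_at_filter)
  ultimately show ?thesis by (simp add: filterlim_split_at)
qed

lemma exp_flat_has_derivative:
  "(exp_flat n has_real_derivative (exp_flat (n + 2) t - real n * exp_flat (n + 1) t)) (at t)"
proof (cases t "0::real" rule: linorder_cases)
  case less
  have "((\<lambda>t. 0) has_real_derivative (exp_flat (n + 2) t - real n * exp_flat (n + 1) t)) (at t)"
    using less by (simp add: exp_flat_def)
  then show ?thesis
    by (rule has_field_derivative_transform_within_open[of _ _ _ "{..<0}"]) (use less in \<open>auto simp: exp_flat_def\<close>)
next
  case equal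
  \<comment> \<open>Dividing by \<open>h\<close> only raises the power of \<open>1/h\<close> by one,
    so the difference quotient at 0 is the next function of the family, which tends to 0.\<close>
  have "((\<lambda>h. (exp_flat n (0 + h) - exp_flat n 0) / h) \<longlongrightarrow> 0) (at 0)"
    by (rule Lim_transform_eventually[OF exp_flat_tendsto[of "Suc n"]])
       (auto simp: exp_flat_def field_simps intro!: always_eventually)
  then show ?thesis using equal by (simp add: DERIV_def exp_flat_def)
next
  case greater
  have "((\<lambda>t. inverse t ^ n * exp (- inverse t)) has_real_derivative
    (exp_flat (n + 2) t - real n * exp_flat (n + 1) t)) (at t)"
  proof -
    define i where "i = inverse t"
    have inv: "(inverse has_real_derivative - (i * i)) (at t)"
      using DERIV_inverse[of t UNIV] greater by (simp add: i_def numeral_2_eq_2)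
    have "((\<lambda>t. inverse t ^ n) has_real_derivative (real n * i ^ (n - 1) * (- (i * i)))) (at t)"
      using DERIV_power[OF inv, of n] by (simp add: i_def mult_ac)
    moreover have "((\<lambda>t. exp (- inverse t)) has_real_derivative (exp (- i) * (- (- (i * i))))) (at t)"
      unfolding i_def by (rule DERIV_chain'[OF DERIV_minus[OF inv[unfolded i_def]] DERIV_exp])
    ultimately have "((\<lambda>t. inverse t ^ n * exp (- inverse t)) has_real_derivative
       (real n * i ^ (n - 1) * (- (i * i))) * exp (- i) + (exp (- i) * (- (- (i * i)))) * i ^ n) (at t)"
      unfolding i_def by (rule DERIV_mult)
    also have "(real n * i ^ (n - 1) * (- (i * i))) * exp (- i) + (exp (- i) * (- (- (i * i)))) * i ^ n =
       i ^ (n + 2) * exp (- i) - real n * (i ^ (n + 1) * exp (- i))"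
      by (cases n) (simp_all add: algebra_simps)
    also have "\<dots> = exp_flat (n + 2) t - real n * exp_flat (n + 1) t"
      using greater by (simp add: exp_flat_def i_def)
    finally show ?thesis .
  qed
  then show ?thesis
    by (rule has_field_derivative_transform_within_open[of _ _ _ "{0<..}"]) (use greater in \<open>auto simp: exp_flat_def\<close>)
qed

lemma smooth_on_exp_flat: "smooth_on UNIV (exp_flat n)"
proof (rule smooth_onI)
  fix k show "Ck_on k UNIV (exp_flat n)"
  proof (induction k arbitrary: n)
    case 0
    show ?case
      unfolding Ck_on.simps
      by (intro continuous_at_imp_continuous_on ballI DERIV_isCont[OF exp_flat_has_derivative])
  next
    case (Suc k)
    show ?case
    proof (rule Ck_on_SucI)
      show "(exp_flat n has_derivative (\<lambda>h. (exp_flat (n + 2) t + (- real n) * exp_flat (n + 1) t) * h)) (at t)" for t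
        using exp_flat_has_derivative[of n t] by (simp add: has_field_derivative_def)
      show "Ck_on k UNIV (\<lambda>t. (exp_flat (n + 2) t + (- real n) * exp_flat (n + 1) t) * v)" for v
        by (intro Ck_on_bilinear[OF _ bounded_bilinear_mult] Ck_on_add Ck_on_const Suc open_UNIV)
    qed simp
  qed
qed

text \<open>The quotient \<open>a / (a + b)\<close> works: \<open>a\<close> is positive exactly
  inside the radius \<open>2 * r\<close> and \<open>b\<close> exactly outside the radius
  \<open>r\<close>, so the denominator never vanishes. Both are written in the squared distance,
  which unlike the distance is smooth at the centre.\<close>

lemma smooth_bump:
  fixes x0 :: "'a::euclidean_space"
  assumes "r > 0"
  obtains \<rho> :: "'a \<Rightarrow> real" where "smooth_on UNIV \<rho>" "\<And>x. dist x0 x < r \<Longrightarrow> \<rho> x = 1"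
    "\<And>x. 2 * r < dist x0 x \<Longrightarrow> \<rho> x = 0"
proof -
  define q where "q x = (x - x0) \<bullet> (x - x0)" for x
  have q: "q x = (dist x0 x)^2" for x by (simp add: q_def dist_norm norm_minus_commute[of x0] power2_norm_eq_inner)
  have "smooth_on UNIV (\<lambda>x. x - x0)"
    by (intro smooth_on_diff smooth_on_bounded_linear smooth_on_const bounded_linear_ident open_UNIV)
  then have sq: "smooth_on UNIV q" unfolding q_def by (intro smooth_on_inner open_UNIV)
  define a where "a x = exp_flat 0 (4 * r^2 - q x)" for x
  define b where "b x = exp_flat 0 (q x - r^2)" for x
  have sa: "smooth_on UNIV a" and sb: "smooth_on UNIV b" unfolding a_def b_def
    by (rule smooth_on_compose[OF _ _ _ _ smooth_on_exp_flat]; intro smooth_on_diff smooth_on_const sq open_UNIV subset_UNIV)+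
  have ab: "a x + b x \<noteq> 0" for x
  proof (cases "q x < 4 * r^2")
    case True
    then have "a x > 0" "b x \<ge> 0" by (auto simp: a_def b_def exp_flat_def)
    then show ?thesis by simp
  next
    case False
    then have "q x > r^2" using assms zero_less_power[of r 2] by linarith
    then have "b x > 0" "a x \<ge> 0" by (auto simp: a_def b_def exp_flat_def)
    then show ?thesis by simp
  qed
  show ?thesis
  proof (rule that[of "\<lambda>x. a x * inverse (a x + b x)"])
    show "smooth_on UNIV (\<lambda>x. a x * inverse (a x + b x))"
      by (intro smooth_on_mult smooth_on_inverse_real smooth_on_add sa sb ab open_UNIV)
    show "a x * inverse (a x + b x) = 1" if "dist x0 x < r" for x
    proof -
      have "q x < r^2" unfolding q using that by (intro power_strict_mono) auto
      then have "b x = 0" by (simp add: b_def exp_flat_def)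
      then show ?thesis using ab[of x] by simp
    qed
    show "a x * inverse (a x + b x) = 0" if "2 * r < dist x0 x" for x
    proof -
      have "(2 * r)^2 < q x" unfolding q using that assms by (intro power_strict_mono) auto
      then show ?thesis by (simp add: a_def exp_flat_def power_mult_distrib)
    qed
  qed
qed

lemma has_derivative_bilinear_family:
  fixes W :: "'x::real_normed_vector \<Rightarrow> 'a::euclidean_space \<Rightarrow> 'b::euclidean_space \<Rightarrow> 'c::real_normed_vector"
  assumes S: "open S" "x0 \<in> S"
    and lin1: "\<And>x v. x \<in> S \<Longrightarrow> linear (\<lambda>u. W x u v)" and lin2: "\<And>x u. x \<in> S \<Longrightarrow> linear (W x u)"
    and W': "\<And>u v. ((\<lambda>x. W x u v) has_derivative W' u v) (at x0)"
    and G: "(G has_derivative G') (at x0)" and H: "(H has_derivative H') (at x0)"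
  shows "((\<lambda>x. W x (G x) (H x)) has_derivative
    (\<lambda>h. W' (G x0) (H x0) h + W x0 (G x0) (H' h) + W x0 (G' h) (H x0))) (at x0)"
  by (rule has_derivative_family_apply[OF S, of "\<lambda>x u. W x u (H x)" "\<lambda>u h. W' u (H x0) h + W x0 u (H' h)"])
     (auto intro: lin1 G has_derivative_family_apply[OF S lin2 W' H])

subsection \<open>Involutivity of integrable distributions\<close>

text \<open>Along the integral manifold \<open>X = DF \<cdot> z\<close>, and \<open>l\<close> annihilates \<open>DF\<close> at \<open>s0\<close>.  So the factor
  \<open>l \<bullet> DF\<close> vanishes there, and its product with \<open>z\<close> can be differentiated although \<open>z\<close> is
  only known to be continuous.\<close>

lemma integral_manifold_annihilator:
  fixes F :: "'e::euclidean_space \<Rightarrow> 'e"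
  assumes W: "open W" "s0 \<in> W" "s0 \<in> S" and F: "smooth_on W F" and S: "subspace S"
    and inj: "\<And>z. z \<in> S \<Longrightarrow> frechet_derivative F (at s0) z = 0 \<Longrightarrow> z = 0"
    and X: "\<And>s. s \<in> W \<Longrightarrow> s \<in> S \<Longrightarrow> X (F s) \<in> frechet_derivative F (at s) ` S"
    and X': "(X has_derivative X') (at (F s0))"
    and l: "\<And>z. z \<in> S \<Longrightarrow> l \<bullet> frechet_derivative F (at s0) z = 0"
    and \<xi>: "\<xi> \<in> S" "X (F s0) = frechet_derivative F (at s0) \<xi>" and \<eta>: "\<eta> \<in> S"
  shows "l \<bullet> X' (frechet_derivative F (at s0) \<eta>) =
    l \<bullet> frechet_derivative (\<lambda>s. frechet_derivative F (at s) \<xi>) (at s0) \<eta>"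
proof -
  define D where "D s = frechet_derivative F (at s)" for s
  define c where "c t = s0 + t *\<^sub>R \<eta>" for t :: real
  have c0: "c 0 = s0" by (simp add: c_def)
  have cS: "c t \<in> S" for t using S W(3) \<eta> by (simp add: c_def subspace_add subspace_scale)
  have c': "(c has_derivative (\<lambda>r. r *\<^sub>R \<eta>)) (at 0)"
    unfolding c_def by (rule derivative_eq_intros refl)+ simp
  have "isCont c t" for t unfolding c_def by (intro continuous_intros)
  then have cc: "continuous_on UNIV c" by (intro continuous_at_imp_continuous_on) auto
  define T where "T = c -` W"
  have T: "open T" "0 \<in> T" unfolding T_def using open_vimage[OF W(1) cc] W(2) c0 by auto
  have linD: "linear (D s)" if "s \<in> W" for s
    unfolding D_def using smooth_on_has_derivative[OF F that] has_derivative_linear by blast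
  have D': "((\<lambda>s. D s b) has_derivative frechet_derivative (\<lambda>s. D s b) (at s0)) (at s0)" for b
    unfolding D_def by (rule smooth_on_has_derivative[OF smooth_on_frechet_derivative[OF F] W(2)])
  have Dc': "((\<lambda>t. D (c t) b) has_derivative (\<lambda>r. frechet_derivative (\<lambda>s. D s b) (at s0) (r *\<^sub>R \<eta>))) (at 0)" for b
    using diff_chain_at[OF c', unfolded c0, OF D'] by (simp add: o_def)
  have "\<exists>z. z \<in> S \<and> X (F (c t)) = D (c t) z" if "t \<in> T" for t
    using X[of "c t"] cS that by (auto simp: T_def D_def)
  then obtain z where z: "\<And>t. t \<in> T \<Longrightarrow> z t \<in> S" "\<And>t. t \<in> T \<Longrightarrow> X (F (c t)) = D (c t) (z t)"
    by metis
  have z0: "z 0 = \<xi>"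
  proof -
    have "D s0 (z 0 - \<xi>) = D s0 (z 0) - D s0 \<xi>" by (rule linear_diff[OF linD[OF W(2)]])
    also have "\<dots> = 0" using z(2)[OF T(2)] \<xi>(2) by (simp add: c0 D_def)
    finally have "D s0 (z 0 - \<xi>) = 0" .
    then have "z 0 - \<xi> = 0"
      using inj z(1)[OF T(2)] \<xi>(1) S unfolding D_def by (blast intro: subspace_diff)
    then show ?thesis by simp
  qed
  have evT: "\<forall>\<^sub>F t in at 0. t \<in> T" using T by (rule eventually_at_in_open')
  have limD: "((\<lambda>t. D (c t) b) \<longlongrightarrow> D s0 b) (at 0)" for b
    using has_derivative_continuous[OF Dc'[of b]] by (simp add: continuous_at_imp_continuous_at_within continuous_within c0)
  have XF': "((\<lambda>t. X (F (c t))) has_derivative (\<lambda>r. X' (D s0 (r *\<^sub>R \<eta>)))) (at 0)"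
  proof -
    have "((\<lambda>t. F (c t)) has_derivative (\<lambda>r. D s0 (r *\<^sub>R \<eta>))) (at 0)"
      using diff_chain_at[OF c', unfolded c0, OF smooth_on_has_derivative[OF F W(2)]] by (simp add: o_def D_def)
    from diff_chain_at[OF this, unfolded c0, OF X'] show ?thesis by (simp add: o_def)
  qed
  \<comment> \<open>\<open>z\<close> was chosen separately for each \<open>t\<close>. On
    \<open>S\<close> the maps \<open>D (c t)\<close> are bounded below uniformly in small
    \<open>t\<close>, and \<open>D (c t) (z t - \<xi>)\<close> tends to
    \<open>X (F s0) - D s0 \<xi> = 0\<close>, which forces \<open>z t\<close> to tend to
    \<xi>.\<close>
  have contz: "isCont z 0"
  proof -
    obtain m where m: "m > 0" "\<forall>\<^sub>F t in at 0. \<forall>w\<in>S. m * norm w \<le> norm (D (c t) w)"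
    proof (rule linear_family_bounded_below[of "\<lambda>t. D (c t)" "at 0" "D s0" S])
      show "\<forall>\<^sub>F t in at 0. linear (D (c t))"
        using evT by (rule eventually_mono) (auto simp: T_def intro: linD)
    qed (use limD linD W S inj in \<open>auto simp: D_def\<close>)
    have "((\<lambda>t. z t - z 0) \<longlongrightarrow> 0) (at 0)"
    proof (rule Lim_null_comparison)
      show "\<forall>\<^sub>F t in at 0. norm (z t - z 0) \<le> (1/m) * norm (X (F (c t)) - D (c t) \<xi>)"
        using m(2) evT
      proof eventually_elim
        case (elim t)
        have "m * norm (z t - \<xi>) \<le> norm (D (c t) (z t - \<xi>))"
          using elim z(1)[OF elim(2)] \<xi>(1) S by (blast intro: subspace_diff)
        also have "D (c t) (z t - \<xi>) = X (F (c t)) - D (c t) \<xi>"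
          using elim(2) by (subst linear_diff[OF linD]) (auto simp: T_def z)
        finally show ?case using m(1) by (simp add: z0 field_simps)
      qed
      have "((\<lambda>t. X (F (c t))) \<longlongrightarrow> X (F s0)) (at 0)"
        using has_derivative_continuous[OF XF'] by (simp add: continuous_within c0)
      then have "((\<lambda>t. (1/m) * norm (X (F (c t)) - D (c t) \<xi>)) \<longlongrightarrow> (1/m) * norm (X (F s0) - D s0 \<xi>)) (at 0)"
        by (intro tendsto_intros limD)
      then show "((\<lambda>t. (1/m) * norm (X (F (c t)) - D (c t) \<xi>)) \<longlongrightarrow> 0) (at 0)"
        by (simp add: \<xi>(2) D_def)
    qed
    then show ?thesis using Lim_null isCont_def by blast
  qed
  \<comment> \<open>A basis vector \<open>b\<close> need not lie in \<open>S\<close>, so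
    \<open>l \<bullet> D s0 b\<close> may be nonzero. Subtracting it makes each coefficient vanish
    at 0, and leaves the sum unchanged because \<open>z t\<close> does lie in
    \<open>S\<close>.\<close>
  let ?k = "\<lambda>b t. l \<bullet> (D (c t) b - D s0 b)"
  have k': "(?k b has_derivative (\<lambda>r. l \<bullet> (frechet_derivative (\<lambda>s. D s b) (at s0) (r *\<^sub>R \<eta>) - 0))) (at 0)" for b
    by (intro has_derivative_inner_right has_derivative_diff Dc' has_derivative_const)
  have "((\<lambda>t. \<Sum>b\<in>Basis. ?k b t *\<^sub>R (z t \<bullet> b)) has_derivative
     (\<lambda>r. \<Sum>b\<in>Basis. (l \<bullet> (frechet_derivative (\<lambda>s. D s b) (at s0) (r *\<^sub>R \<eta>) - 0)) *\<^sub>R (z 0 \<bullet> b))) (at 0)"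
    by (intro has_derivative_sum has_derivative_scaleR_vanishing k')
       (auto simp: c0 intro!: continuous_intros contz)
  then have 1: "((\<lambda>t. l \<bullet> X (F (c t))) has_derivative
     (\<lambda>r. \<Sum>b\<in>Basis. (l \<bullet> (frechet_derivative (\<lambda>s. D s b) (at s0) (r *\<^sub>R \<eta>) - 0)) *\<^sub>R (z 0 \<bullet> b))) (at 0)"
  proof (rule has_derivative_transform_within_open[OF _ T])
    fix t assume t: "t \<in> T"
    have cW: "c t \<in> W" using t by (simp add: T_def)
    have "(\<Sum>b\<in>Basis. ?k b t *\<^sub>R (z t \<bullet> b)) = l \<bullet> (\<Sum>b\<in>Basis. (z t \<bullet> b) *\<^sub>R D (c t) b) - l \<bullet> (\<Sum>b\<in>Basis. (z t \<bullet> b) *\<^sub>R D s0 b)"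
      by (simp add: inner_sum_right inner_diff_right sum_subtractf algebra_simps)
    also have "\<dots> = l \<bullet> D (c t) (z t) - l \<bullet> D s0 (z t)"
      by (simp only: linear_expand_Basis[OF linD[OF cW], symmetric] linear_expand_Basis[OF linD[OF W(2)], symmetric])
    also have "\<dots> = l \<bullet> X (F (c t))"
      using l[OF z(1)[OF t]] z(2)[OF t] by (simp add: D_def)
    finally show "(\<Sum>b\<in>Basis. ?k b t *\<^sub>R (z t \<bullet> b)) = l \<bullet> X (F (c t))" .
  qed
  have 2: "((\<lambda>t. l \<bullet> X (F (c t))) has_derivative (\<lambda>r. l \<bullet> X' (D s0 (r *\<^sub>R \<eta>)))) (at 0)"
    by (intro has_derivative_inner_right XF')
  have "l \<bullet> X' (D s0 \<eta>) = (\<Sum>b\<in>Basis. (l \<bullet> frechet_derivative (\<lambda>s. D s b) (at s0) \<eta>) *\<^sub>R (z 0 \<bullet> b))"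
    using fun_cong[OF has_derivative_unique[OF 2 1], of 1] by simp
  also have "\<dots> = l \<bullet> (\<Sum>b\<in>Basis. (\<xi> \<bullet> b) *\<^sub>R frechet_derivative (\<lambda>s. D s b) (at s0) \<eta>)"
    by (simp add: inner_sum_right z0 mult.commute)
  also have "\<dots> = l \<bullet> frechet_derivative (\<lambda>s. D s \<xi>) (at s0) \<eta>"
    by (simp only: linear_expand_Basis[OF linear_derivative_of_family[OF W(1,2) linD D'], symmetric])
  finally show ?thesis by (simp add: D_def)
qed

text \<open>Let \<open>z\<close> be the component of the bracket normal to the leaf. Paired with
  \<open>z\<close>, each half of the bracket becomes a second derivative of \<open>F\<close> in the
  directions \<xi> and \<eta>, taken in one order or the other. By symmetry the halves cancel, so
  \<open>z\<close> is orthogonal to the bracket and hence zero.\<close>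

lemma integral_manifold_involutive:
  fixes F :: "'e::euclidean_space \<Rightarrow> 'e"
  assumes W: "open W" "s0 \<in> W" "s0 \<in> S" and F: "smooth_on W F" and S: "subspace S"
    and inj: "\<And>z. z \<in> S \<Longrightarrow> frechet_derivative F (at s0) z = 0 \<Longrightarrow> z = 0"
    and X: "\<And>s. s \<in> W \<Longrightarrow> s \<in> S \<Longrightarrow> X (F s) \<in> frechet_derivative F (at s) ` S"
    and Y: "\<And>s. s \<in> W \<Longrightarrow> s \<in> S \<Longrightarrow> Y (F s) \<in> frechet_derivative F (at s) ` S"
    and X': "(X has_derivative X') (at (F s0))" and Y': "(Y has_derivative Y') (at (F s0))"
  shows "Y' (X (F s0)) - X' (Y (F s0)) \<in> frechet_derivative F (at s0) ` S"
proof -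
  let ?D = "frechet_derivative F (at s0)"
  have linD: "linear ?D" using smooth_on_has_derivative[OF F W(2)] has_derivative_linear by blast
  have sub: "subspace (?D ` S)" by (rule linear_subspace_image[OF linD S])
  obtain \<xi> \<eta> where \<xi>: "\<xi> \<in> S" "X (F s0) = ?D \<xi>" and \<eta>: "\<eta> \<in> S" "Y (F s0) = ?D \<eta>"
    using X[OF W(2,3)] Y[OF W(2,3)] by blast
  obtain y z where yz: "y \<in> span (?D ` S)" "\<And>w. w \<in> span (?D ` S) \<Longrightarrow> orthogonal z w"
    "Y' (X (F s0)) - X' (Y (F s0)) = y + z"
    using orthogonal_subspace_decomp_exists[of "?D ` S" "Y' (X (F s0)) - X' (Y (F s0))"] by blast
  have l: "z \<bullet> ?D w = 0" if "w \<in> S" for w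
    using yz(2)[OF span_base, of "?D w"] that by (auto simp: orthogonal_def)
  have "z \<bullet> X' (?D \<eta>) = z \<bullet> frechet_derivative (\<lambda>s. frechet_derivative F (at s) \<xi>) (at s0) \<eta>"
    by (rule integral_manifold_annihilator[OF W F S inj X X' l \<xi> \<eta>(1)])
  also have "\<dots> = z \<bullet> frechet_derivative (\<lambda>s. frechet_derivative F (at s) \<eta>) (at s0) \<xi>"
    by (subst second_derivative_symmetric[OF W(1,2) F]) simp
  also have "\<dots> = z \<bullet> Y' (?D \<xi>)"
    by (rule integral_manifold_annihilator[OF W F S inj Y Y' l \<eta> \<xi>(1), symmetric])
  finally have "z \<bullet> (y + z) = 0"
    unfolding yz(3)[symmetric] by (simp add: \<xi> \<eta> inner_diff_right)
  moreover have "z \<bullet> y = 0" using yz(2)[OF yz(1)] by (simp add: orthogonal_def)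
  ultimately have "z = 0" by (simp add: inner_add_right)
  then show ?thesis using yz(1,3) sub by (simp add: span_eq_iff[THEN iffD2])
qed

subsection \<open>The twisted Jacobi identity in coordinates\<close>

text \<open>As \<open>P x \<gamma> \<bullet> w = - (\<gamma> \<bullet> P x w)\<close>, only the
  values of the covector \<gamma> on the test field \<open>V = P w\<close> matter. There the terms
  from \<open>W'\<close> are the exterior derivative of \<open>W\<close> on \<open>X\<close>,
  \<open>Y\<close>, \<open>V\<close>, and differentiating the pairing identities reduces everything
  to \<open>W\<close> of the bracket of \<open>X\<close> and \<open>Y\<close>. The assumptions
  \<open>invX\<close> and \<open>invY\<close> say that the brackets of \<open>X\<close> and
  \<open>Y\<close> with \<open>V\<close> stay in the range.\<close>

lemma twisted_jacobi_coordinates: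
  fixes P :: "'e::euclidean_space \<Rightarrow> 'e \<Rightarrow> 'e" and W :: "'e \<Rightarrow> 'e \<Rightarrow> 'e \<Rightarrow> real"
  assumes U: "open U" "x \<in> U"
    and skewP: "\<And>y u v. y \<in> U \<Longrightarrow> P y u \<bullet> v = - (u \<bullet> P y v)"
    and P': "\<And>w. ((\<lambda>y. P y w) has_derivative P' w) (at x)"
    and lin1: "\<And>y v. y \<in> U \<Longrightarrow> linear (\<lambda>u. W y u v)" and lin2: "\<And>y u. y \<in> U \<Longrightarrow> linear (W y u)"
    and altW: "\<And>y u v. y \<in> U \<Longrightarrow> W y u v = - W y v u"
    and W': "\<And>u v. ((\<lambda>y. W y u v) has_derivative W' u v) (at x)"
    and WP: "\<And>y a b. y \<in> U \<Longrightarrow> W y (P y a) (P y b) = P y a \<bullet> b"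
    and X: "\<And>y. y \<in> U \<Longrightarrow> X y = P y (\<alpha> y)" and Y: "\<And>y. y \<in> U \<Longrightarrow> Y y = P y (\<beta> y)"
    and X': "(X has_derivative X') (at x)" and Y': "(Y has_derivative Y') (at x)"
    and \<alpha>': "(\<alpha> has_derivative \<alpha>') (at x)" and \<beta>': "(\<beta> has_derivative \<beta>') (at x)"
    and invXY: "Y' (X x) - X' (Y x) \<in> range (P x)"
    and invX: "\<And>w. P' w (X x) - X' (P x w) \<in> range (P x)"
    and invY: "\<And>w. P' w (Y x) - Y' (P x w) \<in> range (P x)"
    and \<gamma>: "\<And>v. \<gamma> \<bullet> v = \<beta>' (X x) \<bullet> v + \<beta> x \<bullet> X' v - (\<alpha>' (Y x) \<bullet> v - \<alpha>' v \<bullet> Y x)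
       + (W' (Y x) v (X x) - W' (X x) v (Y x) + W' (X x) (Y x) v)"
  shows "P x \<gamma> = Y' (X x) - X' (Y x)"
proof (rule euclidean_eqI)
  fix w :: 'e
  define V where "V y = P y w" for y
  have V': "(V has_derivative P' w) (at x)" unfolding V_def by (rule P')
  have WX: "W y (X y) (P y b) = - (\<alpha> y \<bullet> P y b)" and WY: "W y (Y y) (P y b) = - (\<beta> y \<bullet> P y b)"
    if "y \<in> U" for y b
    using that by (simp_all add: X Y WP skewP)
  \<comment> \<open>The Leibniz rule for a pairing identity that holds on all of \<open>U\<close>;
    everything known about \<open>W'\<close> enters through it.\<close>
  have pair: "W' (G x) (H x) h + W x (G x) (H' h) + W x (G' h) (H x) = - (a x \<bullet> H' h + a' h \<bullet> H x)"
    if "\<And>y. y \<in> U \<Longrightarrow> W y (G y) (H y) = - (a y \<bullet> H y)" "(G has_derivative G') (at x)"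
      "(H has_derivative H') (at x)" "(a has_derivative a') (at x)" for G H G' H' a a' h
  proof -
    have "((\<lambda>y. - (a y \<bullet> H y)) has_derivative (\<lambda>h. - (a x \<bullet> H' h + a' h \<bullet> H x))) (at x)"
      by (intro has_derivative_minus has_derivative_inner that)
    then have "((\<lambda>y. W y (G y) (H y)) has_derivative (\<lambda>h. - (a x \<bullet> H' h + a' h \<bullet> H x))) (at x)"
      by (rule has_derivative_transform_within_open[OF _ U]) (simp add: that(1))
    from has_derivative_unique[OF has_derivative_bilinear_family[OF U lin1 lin2 W' that(2,3)] this] show ?thesis by metis
  qed
  have XV: "W' (X x) (V x) h + W x (X x) (P' w h) + W x (X' h) (V x) = - (\<alpha> x \<bullet> P' w h + \<alpha>' h \<bullet> V x)" for h
    by (rule pair[OF _ X' V' \<alpha>']) (simp add: WX V_def)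
  have YV: "W' (Y x) (V x) h + W x (Y x) (P' w h) + W x (Y' h) (V x) = - (\<beta> x \<bullet> P' w h + \<beta>' h \<bullet> V x)" for h
    by (rule pair[OF _ Y' V' \<beta>']) (simp add: WY V_def)
  have XY: "W' (X x) (Y x) h + W x (X x) (Y' h) + W x (X' h) (Y x) = - (\<alpha> x \<bullet> Y' h + \<alpha>' h \<bullet> Y x)" for h
    by (rule pair[OF _ X' Y' \<alpha>']) (simp add: WX Y)
  \<comment> \<open>These trades are valid on the range only. Neither \<open>P' w (X x)\<close> nor
    \<open>X' (V x)\<close> need lie there, but their difference, a bracket, does.\<close>
  have bX: "W x (X x) z = - (\<alpha> x \<bullet> z)" and bY: "W x (Y x) z = - (\<beta> x \<bullet> z)" if "z \<in> range (P x)" for z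
    using that WX[OF U(2)] WY[OF U(2)] by auto
  have brY: "W x (Y x) (P' w (X x)) - W x (Y x) (X' (V x)) = - (\<beta> x \<bullet> P' w (X x)) + \<beta> x \<bullet> X' (V x)"
    using bY[OF invX[of w]] by (simp add: linear_diff[OF lin2[OF U(2)]] inner_diff_right V_def)
  have brX: "W x (X x) (P' w (Y x)) - W x (X x) (Y' (V x)) = - (\<alpha> x \<bullet> P' w (Y x)) + \<alpha> x \<bullet> Y' (V x)"
    using bX[OF invY[of w]] by (simp add: linear_diff[OF lin2[OF U(2)]] inner_diff_right V_def)
  have sw: "W x (X' (V x)) (Y x) = - W x (Y x) (X' (V x))" by (rule altW[OF U(2)])
  have Z: "W x (Y' (X x) - X' (Y x)) (V x) = W x (Y' (X x)) (V x) - W x (X' (Y x)) (V x)"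
    by (rule linear_diff[OF lin1[OF U(2)]])
  \<comment> \<open>The three evaluations of the Leibniz rule supply the three terms in
    \<open>W'\<close>. The derivatives of \<alpha> and \<beta> then cancel, \<open>brX\<close> and
    \<open>brY\<close> remove the derivatives of \<open>V\<close>, and the bracket of
    \<open>X\<close> and \<open>Y\<close> remains.\<close>
  have *: "\<gamma> \<bullet> V x = - W x (Y' (X x) - X' (Y x)) (V x)"
    unfolding \<gamma> Z using XV[of "Y x"] YV[of "X x"] XY[of "V x"] brX brY sw by linarith
  obtain \<zeta> where \<zeta>: "Y' (X x) - X' (Y x) = P x \<zeta>" using invXY by blast
  have "P x \<gamma> \<bullet> w = - (\<gamma> \<bullet> V x)" unfolding V_def by (rule skewP[OF U(2)])
  also have "\<dots> = W x (P x \<zeta>) (P x w)" using * by (simp add: \<zeta> V_def)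
  also have "\<dots> = P x \<zeta> \<bullet> w" by (rule WP[OF U(2)])
  finally show "P x \<gamma> \<bullet> w = (Y' (X x) - X' (Y x)) \<bullet> w" by (simp add: \<zeta>)
qed

subsection \<open>Inverting a regular bivector on a complement of its kernel\<close>

text \<open>Skewness gives invertibility of \<open>L\<close> at \<open>x0\<close>, since a vector of
  the range killed by \<open>P x0\<close> is orthogonal to itself. Constant rank is what makes the
  inverse cover the range of \<open>P y\<close> at neighbouring points as well: on \<open>?R\<close>
  the map \<open>L y\<close> is \<open>Q\<close> after \<open>P y\<close>, so \<open>C y\<close>
  after \<open>Q\<close> recovers a preimage in \<open>?R\<close>, and the minus sign of
  \<open>W\<close> compensates the skewness of \<open>P y\<close>.\<close>

lemma regular_bivector_local_inverse:
  fixes P :: "'e::euclidean_space \<Rightarrow> 'e \<Rightarrow> 'e"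
  assumes U: "open U" "x0 \<in> U"
    and lin: "\<And>y. y \<in> U \<Longrightarrow> linear (P y)" and skew: "\<And>y u v. y \<in> U \<Longrightarrow> P y u \<bullet> v = - (u \<bullet> P y v)"
    and sm: "\<And>w. smooth_on U (\<lambda>y. P y w)" and rank: "\<And>y. y \<in> U \<Longrightarrow> dim (range (P y)) = r"
  obtains N W where "open N" "x0 \<in> N" "N \<subseteq> U"
    "\<And>y v. y \<in> N \<Longrightarrow> linear (\<lambda>u. W y u v :: real)" "\<And>y u. y \<in> N \<Longrightarrow> linear (W y u)"
    "\<And>y u. y \<in> N \<Longrightarrow> W y u u = 0" "\<And>u v. smooth_on N (\<lambda>y. W y u v)"
    "\<And>y a b. y \<in> N \<Longrightarrow> W y (P y a) (P y b) = P y a \<bullet> b"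
proof -
  let ?R = "range (P x0)"
  have subR: "subspace (range (P y))" if "y \<in> U" for y
    by (rule linear_subspace_image[OF lin[OF that] subspace_UNIV])
  obtain B where B: "B \<subseteq> ?R" "pairwise orthogonal B" "\<And>b. b \<in> B \<Longrightarrow> norm b = 1" "independent B"
    "card B = dim ?R" "span B = ?R"
    by (rule orthonormal_basis_subspace[OF subR[OF U(2)]]) blast
  have finB: "finite B" using B(4) independent_imp_finite by blast
  define Q where "Q u = (\<Sum>b\<in>B. (u \<bullet> b) *\<^sub>R b)" for u
  have linQ: "linear Q"
    unfolding Q_def by (rule linearI) (simp_all add: inner_add_left scaleR_add_left sum.distrib scaleR_sum_right)
  have QR: "Q u \<in> ?R" for u
    unfolding Q_def B(6)[symmetric] by (intro span_sum span_scale span_base)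
  have Qb: "Q b = b" if "b \<in> B" for b
  proof -
    have "Q b = (\<Sum>b'\<in>B. if b' = b then b else 0)"
      unfolding Q_def
    proof (rule sum.cong[OF refl])
      fix b' assume "b' \<in> B"
      then show "(b \<bullet> b') *\<^sub>R b' = (if b' = b then b else 0)"
        using B(2,3) that by (auto simp: pairwise_def orthogonal_def norm_eq_1)
    qed
    then show ?thesis using that finB by simp
  qed
  have Qid: "Q u = u" if "u \<in> ?R" for u
  proof -
    have "u \<in> span B" using that B(6) by simp
    then show ?thesis
      by (induction rule: span_induct_alt) (simp_all add: linear_0[OF linQ] linear_add[OF linQ] linear_cmul[OF linQ] Qb)
  qed
  have Qsym: "Q u \<bullet> v = u \<bullet> Q v" for u v
    unfolding Q_def by (simp add: inner_sum_left inner_sum_right mult.commute inner_commute[of v])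
  define L where "L y u = Q (P y (Q u)) + (u - Q u)" for y u
  have linL: "linear (L y)" if "y \<in> U" for y
    unfolding L_def using linQ lin[OF that]
    by (intro linear_compose_add linear_compose_sub linear_compose[of Q Q, unfolded o_def]
        linear_compose[OF linear_compose[OF linQ lin[OF that]] linQ, unfolded o_def] linear_ident)
  have bl: "bounded_linear f" if "linear f" for f :: "'e \<Rightarrow> 'e" using that linear_conv_bounded_linear by blast
  have smL: "smooth_on U (\<lambda>y. L y u)" for u
    unfolding L_def by (intro smooth_on_add smooth_on_const smooth_on_linear_compose[OF _ bl[OF linQ]] sm U)
  \<comment> \<open>\<open>Q\<close> annihilates \<open>u - Q u\<close> and fixes the other summand
    of \<open>L y u\<close>, so the two summands vanish separately.\<close>
  have Lsplit: "Q u = u \<and> Q (P y u) = 0" if "y \<in> U" "L y u = 0" for y u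
  proof -
    have "Q (L y u) = Q (P y (Q u))"
      unfolding L_def by (simp add: linear_add[OF linQ] linear_diff[OF linQ] Qid[OF QR])
    then have 1: "Q (P y (Q u)) = 0" using that(2) linear_0[OF linQ] by simp
    then have "u = Q u" using that(2) by (simp add: L_def)
    then show ?thesis using 1 by simp
  qed
  have inj0: "u = 0" if "L x0 u = 0" for u
  proof -
    have u: "Q u = u" "Q (P x0 u) = 0" using Lsplit[OF U(2) that] by auto
    then have Pu: "P x0 u = 0" using Qid[of "P x0 u"] by simp
    obtain z where "u = P x0 z" using u(1) QR[of u] by auto
    then have "u \<bullet> u = - (z \<bullet> P x0 u)" using skew[OF U(2), of z u] by simp
    then show ?thesis using Pu by simp
  qed
  have evU: "\<forall>\<^sub>F y in nhds x0. y \<in> U" using U by (rule eventually_nhds_in_open)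
  obtain m where m: "m > 0" "\<forall>\<^sub>F y in nhds x0. \<forall>z\<in>UNIV. m * norm z \<le> norm (L y z)"
  proof (rule linear_family_bounded_below[of L "nhds x0" "L x0" UNIV])
    show "\<forall>\<^sub>F y in nhds x0. linear (L y)" using evU linL by (rule eventually_mono)
    show "((\<lambda>y. L y b) \<longlongrightarrow> L x0 b) (nhds x0)" for b
      using smooth_on_continuous_on[OF smL] U continuous_on_eq_continuous_at[OF U(1)]
      by (metis isCont_def tendsto_at_iff_tendsto_nhds)
  qed (use linL U inj0 in auto)
  then obtain N0 where N0: "open N0" "x0 \<in> N0" "\<And>y z. y \<in> N0 \<Longrightarrow> m * norm z \<le> norm (L y z)"
    unfolding eventually_nhds by auto
  define N where "N = N0 \<inter> U"
  have N: "open N" "x0 \<in> N" "N \<subseteq> U" using N0 U by (auto simp: N_def)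
  have injL: "inj (L y)" if "y \<in> N" for y
  proof -
    have "z = 0" if "L y z = 0" for z
      using N0(3)[of y z] that \<open>y \<in> N\<close> m(1) by (simp add: N_def mult_le_0_iff)
    moreover have "linear (L y)" using that N linL by auto
    ultimately show ?thesis by (simp add: linear_injective_0)
  qed
  define C where "C y = inv (L y)" for y
  have linC: "linear (C y)" if "y \<in> N" for y
    unfolding C_def using injL[OF that] linL that N by (intro inj_linear_imp_inv_linear) auto
  have LC: "L y (C y u) = u" and CL: "C y (L y u) = u" if "y \<in> N" for y u
  proof -
    have "linear (L y)" using that N linL by auto
    then have "surj (L y)" using injL[OF that] linear_injective_imp_surjective by blast
    then show "L y (C y u) = u" by (simp add: C_def surj_f_inv_f)
    show "C y (L y u) = u" using injL[OF that] by (simp add: C_def)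
  qed
  have smC: "smooth_on N (\<lambda>y. C y u)" for u
    unfolding C_def using N linL injL smooth_on_subset[OF smL]
    by (intro smooth_family_inverse) auto
  define W where "W y u v = - (C y (Q u) \<bullet> Q v)" for y u v
  \<comment> \<open>\<open>P y\<close> is injective on \<open>?R\<close> because \<open>L y\<close>
    is, so the image of \<open>?R\<close> has the dimension of \<open>?R\<close>. By constant rank
    it is the whole range of \<open>P y\<close>, whence every value of \<open>P y\<close> has a
    preimage in \<open>?R\<close>.\<close>
  have rng: "\<exists>a'. Q a' = a' \<and> P y a' = P y a" if y: "y \<in> N" for y a
  proof -
    have yU: "y \<in> U" using y N by auto
    have "inj_on (P y) ?R"
    proof -
      have "u = 0" if "u \<in> ?R" "P y u = 0" for u
      proof -
        have "L y u = 0" using that by (simp add: L_def Qid linear_0[OF linQ])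
        then show ?thesis using injL[OF y] linear_0[OF linL[OF yU]] by (metis injD)
      qed
      then show ?thesis
        using linear_inj_on_iff_eq_0[OF lin[OF yU] subR[OF U(2)]] by blast
    qed
    then have "dim (P y ` ?R) = dim ?R"
      using lin[OF yU] subR[OF U(2)] by (intro dim_image_eq) (auto simp: span_eq_iff[THEN iffD2])
    then have "P y ` ?R = range (P y)"
      using rank[OF yU] rank[OF U(2)] subR[OF U(2)] subR[OF yU] lin[OF yU]
      by (intro subspace_dim_equal) (auto intro: linear_subspace_image)
    then obtain a' where "a' \<in> ?R" "P y a' = P y a" by (metis imageE rangeI)
    then show ?thesis using Qid by blast
  qed
  show ?thesis
  proof (rule that[OF N])
    fix y assume y: "y \<in> N"
    then have yU: "y \<in> U" using N by auto
    show "linear (\<lambda>u. W y u v)" for v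
      unfolding W_def by (rule linearI)
        (simp_all add: linear_add[OF linQ] linear_cmul[OF linQ] linear_add[OF linC[OF y]] linear_cmul[OF linC[OF y]] inner_add_left)
    show "linear (W y u)" for u
      unfolding W_def by (rule linearI) (simp_all add: linear_add[OF linQ] linear_cmul[OF linQ] inner_add_right)
    \<comment> \<open>The solution \<open>z\<close> of \<open>L y z = Q u\<close> has no component
      orthogonal to \<open>?R\<close>, so that \<open>z \<bullet> Q u = z \<bullet> P y z\<close>,
      which is zero by skewness.\<close>
    show "W y u u = 0" for u
    proof -
      define z where "z = C y (Q u)"
      have Lz: "L y z = Q u" using LC[OF y] by (simp add: z_def)
      have "Q (L y z) = Q (P y (Q z))"
        unfolding L_def by (simp add: linear_add[OF linQ] linear_diff[OF linQ] Qid[OF QR])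
      then have 1: "Q (P y (Q z)) = Q u" using Lz by (simp add: Qid[OF QR])
      then have z: "Q z = z" using Lz by (simp add: L_def)
      have "z \<bullet> Q u = z \<bullet> P y z" using 1 z Qsym[of z "P y z"] by simp
      moreover have "z \<bullet> P y z = 0" using skew[OF yU, of z z] by (simp add: inner_commute)
      ultimately show ?thesis by (simp add: W_def z_def)
    qed
    show "W y (P y a) (P y b) = P y a \<bullet> b" for a b
    proof -
      obtain a' where a': "Q a' = a'" "P y a' = P y a" using rng[OF y] by blast
      have "L y a' = Q (P y a)" by (simp add: L_def a')
      then have "C y (Q (P y a)) = a'" using CL[OF y, of a'] by simp
      then have "W y (P y a) (P y b) = - (a' \<bullet> P y b)"
        using Qsym[of a' "P y b"] a' by (simp add: W_def)
      also have "\<dots> = P y a \<bullet> b" using skew[OF yU, of a' b] a' by simp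
      finally show ?thesis .
    qed
  next
    show "smooth_on N (\<lambda>y. W y u v)" for u v
      unfolding W_def by (intro smooth_on_minus smooth_on_inner smC smooth_on_const N)
  qed
qed

lemma smooth_on_derivative_apply:
  fixes f :: "'a::euclidean_space \<Rightarrow> 'b::real_normed_vector"
  assumes S: "open S" and f: "smooth_on S f" and g: "smooth_on S g"
  shows "smooth_on S (\<lambda>x. frechet_derivative f (at x) (g x))"
  by (rule smooth_on_family_apply[OF S _ smooth_on_frechet_derivative[OF f] g])
     (rule has_derivative_linear[OF smooth_on_has_derivative[OF f]])

subsection \<open>Alternating forms of low degree\<close>

lemma scaleR_fun_apply [simp]: "(a *\<^sub>R f) x = a *\<^sub>R f x"
  by (simp add: scaleR_fun_def)

lemma length_2_conv: "length vs = 2 \<longleftrightarrow> (\<exists>x y. vs = [x, y])"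
  by (auto simp: numeral_2_eq_2 length_Suc_conv)

lemma length_3_conv: "length vs = 3 \<longleftrightarrow> (\<exists>x y z. vs = [x, y, z])"
  by (auto simp: numeral_3_eq_3 length_Suc_conv)

lemma alternating_forms_zero:
  "\<omega> \<in> alternating_forms k V \<Longrightarrow> \<not> (length vs = k \<and> set vs \<subseteq> V) \<Longrightarrow> \<omega> vs = 0"
  unfolding alternating_forms_def by blast

lemma alternating_forms_update:
  assumes "\<omega> \<in> alternating_forms k V" "length vs = k" "set vs \<subseteq> V" "i < k" "x \<in> V" "y \<in> V"
  shows "\<omega> (vs[i := a *\<^sub>R x + b *\<^sub>R y]) = a * \<omega> (vs[i := x]) + b * \<omega> (vs[i := y])"
  using assms unfolding alternating_forms_def by blast

lemma alternating_forms_eq: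
  assumes "\<omega> \<in> alternating_forms k V" "length vs = k" "set vs \<subseteq> V" "i < j" "j < k" "vs ! i = vs ! j"
  shows "\<omega> vs = 0"
  using assms unfolding alternating_forms_def by blast

lemma alternating_forms_1D:
  assumes "\<omega> \<in> alternating_forms 1 V" "x \<in> V" "y \<in> V"
  shows "\<omega> [a *\<^sub>R x + b *\<^sub>R y] = a * \<omega> [x] + b * \<omega> [y]"
  using alternating_forms_update[OF assms(1), of "[x]" 0 x y a b] assms by simp

lemma alternating_forms_2D:
  assumes "\<omega> \<in> alternating_forms 2 V" "x \<in> V" "y \<in> V" "z \<in> V"
  shows "\<omega> [a *\<^sub>R x + b *\<^sub>R y, z] = a * \<omega> [x, z] + b * \<omega> [y, z]"
    and "\<omega> [z, a *\<^sub>R x + b *\<^sub>R y] = a * \<omega> [z, x] + b * \<omega> [z, y]"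
    and "\<omega> [z, z] = 0"
  using alternating_forms_update[OF assms(1), of "[x, z]" 0 x y a b]
    alternating_forms_update[OF assms(1), of "[z, x]" 1 x y a b]
    alternating_forms_eq[OF assms(1), of "[z, z]" 0 1] assms by simp_all

text \<open>Polarization of \<open>\<omega> [x + y, x + y] = 0\<close>. Since \<open>V\<close> is an
  arbitrary set here, membership of \<open>x + y\<close> has to be demanded.\<close>

lemma alternating_forms_2_swap:
  assumes \<omega>: "\<omega> \<in> alternating_forms 2 V" and xy: "x \<in> V" "y \<in> V" "x + y \<in> V"
  shows "\<omega> [x, y] = - \<omega> [y, x]"
proof -
  have "\<omega> [x + y, x + y] = \<omega> [x, x + y] + \<omega> [y, x + y]"
    using alternating_forms_2D(1)[OF \<omega> xy(1,2,3), of 1 1] by simp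
  moreover have "\<omega> [x, x + y] = \<omega> [x, y]"
    using alternating_forms_2D(2)[OF \<omega> xy(1,2,1), of 1 1] alternating_forms_2D(3)[OF \<omega> xy(1,2,1)] by simp
  moreover have "\<omega> [y, x + y] = \<omega> [y, x]"
    using alternating_forms_2D(2)[OF \<omega> xy(1,2,2), of 1 1] alternating_forms_2D(3)[OF \<omega> xy(1,2,2)] by simp
  ultimately show ?thesis using alternating_forms_2D(3)[OF \<omega> xy(3,3,3)] by simp
qed

lemma alternating_forms_1I:
  assumes "\<And>x y a b. x \<in> V \<Longrightarrow> y \<in> V \<Longrightarrow> \<omega> [a *\<^sub>R x + b *\<^sub>R y] = a * \<omega> [x] + b * \<omega> [y]"
    and "\<And>vs. \<not> (length vs = 1 \<and> set vs \<subseteq> V) \<Longrightarrow> \<omega> vs = 0"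
  shows "\<omega> \<in> alternating_forms 1 V"
  unfolding alternating_forms_def using assms by (auto simp: length_Suc_conv)

lemma alternating_forms_2I:
  assumes "\<And>x y z a b. x \<in> V \<Longrightarrow> y \<in> V \<Longrightarrow> z \<in> V \<Longrightarrow> \<omega> [a *\<^sub>R x + b *\<^sub>R y, z] = a * \<omega> [x, z] + b * \<omega> [y, z]"
    and "\<And>x y z a b. x \<in> V \<Longrightarrow> y \<in> V \<Longrightarrow> z \<in> V \<Longrightarrow> \<omega> [z, a *\<^sub>R x + b *\<^sub>R y] = a * \<omega> [z, x] + b * \<omega> [z, y]"
    and "\<And>x. x \<in> V \<Longrightarrow> \<omega> [x, x] = 0"
    and "\<And>vs. \<not> (length vs = 2 \<and> set vs \<subseteq> V) \<Longrightarrow> \<omega> vs = 0"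
  shows "\<omega> \<in> alternating_forms 2 V"
  unfolding alternating_forms_def
proof (intro CollectI conjI allI impI; (elim conjE)?)
  fix vs x y and i :: nat and a b :: real
  assume h: "length vs = 2" "set vs \<subseteq> V" "i < 2" "x \<in> V" "y \<in> V"
  from h(1) obtain u w where vs: "vs = [u, w]" by (auto simp: length_2_conv)
  from h(3) have "i = 0 \<or> i = 1" by linarith
  then show "\<omega> (vs[i := a *\<^sub>R x + b *\<^sub>R y]) = a * \<omega> (vs[i := x]) + b * \<omega> (vs[i := y])"
    using h(2,4,5) assms(1,2) by (elim disjE) (simp_all add: vs)
next
  fix vs and i j :: nat
  assume h: "length vs = 2" "set vs \<subseteq> V" "i < j" "j < 2" "vs ! i = vs ! j"
  from h(1) obtain u w where vs: "vs = [u, w]" by (auto simp: length_2_conv)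
  have ij: "i = 0" "j = 1" using h(3,4) by linarith+
  show "\<omega> vs = 0" using h assms(3) by (simp add: vs ij)
qed (rule assms(4))

lemma alternating_forms_3I:
  assumes "\<And>x y z w a b. x \<in> V \<Longrightarrow> y \<in> V \<Longrightarrow> z \<in> V \<Longrightarrow> w \<in> V \<Longrightarrow> \<omega> [a *\<^sub>R x + b *\<^sub>R y, z, w] = a * \<omega> [x, z, w] + b * \<omega> [y, z, w]"
    and "\<And>x y z w a b. x \<in> V \<Longrightarrow> y \<in> V \<Longrightarrow> z \<in> V \<Longrightarrow> w \<in> V \<Longrightarrow> \<omega> [z, a *\<^sub>R x + b *\<^sub>R y, w] = a * \<omega> [z, x, w] + b * \<omega> [z, y, w]"
    and "\<And>x y z w a b. x \<in> V \<Longrightarrow> y \<in> V \<Longrightarrow> z \<in> V \<Longrightarrow> w \<in> V \<Longrightarrow> \<omega> [z, w, a *\<^sub>R x + b *\<^sub>R y] = a * \<omega> [z, w, x] + b * \<omega> [z, w, y]"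
    and "\<And>x y. x \<in> V \<Longrightarrow> y \<in> V \<Longrightarrow> \<omega> [x, x, y] = 0"
    and "\<And>x y. x \<in> V \<Longrightarrow> y \<in> V \<Longrightarrow> \<omega> [x, y, x] = 0"
    and "\<And>x y. x \<in> V \<Longrightarrow> y \<in> V \<Longrightarrow> \<omega> [y, x, x] = 0"
    and "\<And>vs. \<not> (length vs = 3 \<and> set vs \<subseteq> V) \<Longrightarrow> \<omega> vs = 0"
  shows "\<omega> \<in> alternating_forms 3 V"
  unfolding alternating_forms_def
proof (intro CollectI conjI allI impI; (elim conjE)?)
  fix vs x y and i :: nat and a b :: real
  assume h: "length vs = 3" "set vs \<subseteq> V" "i < 3" "x \<in> V" "y \<in> V"
  from h(1) obtain u w z where vs: "vs = [u, w, z]" by (auto simp: length_3_conv)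
  from h(3) have "i = 0 \<or> i = 1 \<or> i = 2" by linarith
  then show "\<omega> (vs[i := a *\<^sub>R x + b *\<^sub>R y]) = a * \<omega> (vs[i := x]) + b * \<omega> (vs[i := y])"
    using h(2,4,5) assms(1,2,3) by (elim disjE) (simp_all add: vs)
next
  fix vs and i j :: nat
  assume h: "length vs = 3" "set vs \<subseteq> V" "i < j" "j < 3" "vs ! i = vs ! j"
  from h(1) obtain u w z where vs: "vs = [u, w, z]" by (auto simp: length_3_conv)
  have "i = 0 \<and> j = 1 \<or> i = 0 \<and> j = 2 \<or> i = 1 \<and> j = 2" using h(3,4) by linarith
  then show "\<omega> vs = 0"
    using h(2,5) assms(4,5,6) by (elim disjE conjE) (simp_all add: vs)
qed (rule assms(7))

subsection \<open>Charts\<close>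

locale smooth_manifold =
  fixes A :: "('p::{t2_space,second_countable_topology}, 'e::euclidean_space) chart set"
  assumes atlas: "smooth_atlas A"
begin

abbreviation overlap where "overlap c d \<equiv> coord c ` (dom_of c \<inter> dom_of d)"
abbreviation trans where "trans c d \<equiv> coord d \<circ> param c"

lemma charts_at_iff: "c \<in> charts_at A p \<longleftrightarrow> c \<in> A \<and> p \<in> dom_of c"
  by (simp add: charts_at_def)

lemma chart_at_in: "chart_at A p \<in> charts_at A p"
proof -
  have "p \<in> (\<Union>c\<in>A. dom_of c)" using atlas by (simp add: smooth_atlas_def)
  then have "\<exists>c. c \<in> charts_at A p" by (auto simp: charts_at_def)
  then show ?thesis unfolding chart_at_def by (rule someI_ex)
qed

lemma chart_props:
  assumes "c \<in> A"
  shows open_dom: "open (dom_of c)" and open_im: "open (im_of c)" and inj_coord: "inj_on (coord c) (dom_of c)"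
    and cont_coord: "continuous_on (dom_of c) (coord c)" and cont_param: "continuous_on (im_of c) (param c)"
  using atlas assms by (auto simp: smooth_atlas_def homeomorphism_def)

lemma param_coord: "c \<in> A \<Longrightarrow> p \<in> dom_of c \<Longrightarrow> param c (coord c p) = p"
  by (rule inv_into_f_f[OF inj_coord])

lemma coord_param: "x \<in> im_of c \<Longrightarrow> coord c (param c x) = x"
  by (rule f_inv_into_f)

lemma param_dom: "x \<in> im_of c \<Longrightarrow> param c x \<in> dom_of c"
  by (rule inv_into_into)

lemma param_charts: "c \<in> A \<Longrightarrow> x \<in> im_of c \<Longrightarrow> c \<in> charts_at A (param c x)"
  by (simp add: charts_at_iff param_dom)

lemma overlap_iff: "c \<in> A \<Longrightarrow> x \<in> overlap c d \<longleftrightarrow> x \<in> im_of c \<and> param c x \<in> dom_of d"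
  using param_coord coord_param[of x c] by (auto simp: image_iff) 

lemma open_param_vimage:
  assumes "c \<in> A" "open U" shows "open {x \<in> im_of c. param c x \<in> U}"
proof -
  have "open (param c -` U \<inter> im_of c)"
    using continuous_on_open_vimage[OF open_im[OF assms(1)]] cont_param[OF assms(1)] assms(2) by blast
  moreover have "param c -` U \<inter> im_of c = {x \<in> im_of c. param c x \<in> U}" by auto
  ultimately show ?thesis by simp
qed

lemma open_overlap:
  assumes "c \<in> A" "d \<in> A" shows "open (overlap c d)"
proof -
  have "overlap c d = {x \<in> im_of c. param c x \<in> dom_of d}" using overlap_iff[OF assms(1)] by blast
  then show ?thesis using open_param_vimage[OF assms(1) open_dom[OF assms(2)]] by simp
qed

lemma smooth_trans: "c \<in> A \<Longrightarrow> d \<in> A \<Longrightarrow> smooth_on (overlap c d) (trans c d)"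
  using atlas by (simp add: smooth_atlas_def)

lemma param_trans: "c \<in> A \<Longrightarrow> d \<in> A \<Longrightarrow> x \<in> overlap c d \<Longrightarrow> param d (trans c d x) = param c x"
  by (auto simp: param_coord)

lemma overlap_im: "x \<in> overlap c d \<Longrightarrow> x \<in> im_of c"
  by auto

lemma trans_im: "c \<in> A \<Longrightarrow> x \<in> overlap c d \<Longrightarrow> trans c d x \<in> im_of d"
  by (auto simp: param_coord)

lemma trans_coord: "c \<in> A \<Longrightarrow> p \<in> dom_of c \<Longrightarrow> trans c d (coord c p) = coord d p"
  by (simp add: param_coord)

lemma trans_has_derivative:
  assumes "c \<in> charts_at A p" "d \<in> charts_at A p"
  shows "(trans c d has_derivative trans_deriv c d p) (at (coord c p))"
  unfolding trans_deriv_def using assms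
  by (intro smooth_on_has_derivative[OF smooth_trans]) (auto simp: charts_at_iff)

lemma linear_trans_deriv:
  "c \<in> charts_at A p \<Longrightarrow> d \<in> charts_at A p \<Longrightarrow> linear (trans_deriv c d p)"
  using trans_has_derivative has_derivative_linear by blast

lemma trans_deriv_param:
  assumes "c \<in> A" "d \<in> A" "x \<in> overlap c d"
  shows "trans_deriv c d (param c x) = frechet_derivative (trans c d) (at x)"
  using coord_param[OF overlap_im[OF assms(3)]] by (simp add: trans_deriv_def)

text \<open>The chain rule, in the role of the cocycle condition: it makes the coordinate vectors
  produced by \<open>tvec_of\<close> compatible.\<close>

lemma trans_deriv_compose:
  assumes c: "c \<in> charts_at A p" and d: "d \<in> charts_at A p" and e: "e \<in> charts_at A p"
  shows "trans_deriv d e p (trans_deriv c d p u) = trans_deriv c e p u"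
proof -
  have A: "c \<in> A" "d \<in> A" "e \<in> A" and p: "p \<in> dom_of c" "p \<in> dom_of d" "p \<in> dom_of e"
    using assms by (auto simp: charts_at_iff)
  have "(trans d e \<circ> trans c d has_derivative trans_deriv d e p \<circ> trans_deriv c d p) (at (coord c p))"
    by (rule diff_chain_at[OF trans_has_derivative[OF c d]])
       (use trans_has_derivative[OF d e] trans_coord[OF A(1) p(1), of d] in simp)
  moreover have "open (overlap c d)" "coord c p \<in> overlap c d" using A p open_overlap by auto
  moreover have "(trans d e \<circ> trans c d) x = trans c e x" if "x \<in> overlap c d" for x
    using param_trans[OF A(1,2) that] by simp
  ultimately have "(trans c e has_derivative trans_deriv d e p \<circ> trans_deriv c d p) (at (coord c p))"
    by (rule has_derivative_transform_within_open)
  from has_derivative_unique[OF this trans_has_derivative[OF c e]] show ?thesis by (metis comp_apply)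
qed

lemma trans_deriv_self:
  assumes c: "c \<in> charts_at A p" shows "trans_deriv c c p u = u"
proof -
  have A: "c \<in> A" and p: "p \<in> dom_of c" using assms by (auto simp: charts_at_iff)
  have "(trans c c has_derivative (\<lambda>u. u)) (at (coord c p))"
    by (rule has_derivative_transform_within_open[OF has_derivative_ident open_im[OF A]])
       (use p in \<open>auto simp: param_coord[OF A]\<close>)
  from has_derivative_unique[OF this trans_has_derivative[OF c c]] show ?thesis by metis
qed

lemma tvec_of_apply: "d \<in> charts_at A p \<Longrightarrow> tvec_of A c p u d = trans_deriv c d p u"
  by (simp add: tvec_of_def)

lemma tvec_of_self: "c \<in> charts_at A p \<Longrightarrow> tvec_of A c p u c = u"
  by (simp add: tvec_of_apply trans_deriv_self)

lemma tvec_of_in: "c \<in> charts_at A p \<Longrightarrow> tvec_of A c p u \<in> tangent_space A p"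
  unfolding tangent_space_def mem_Collect_eq
  by (intro conjI ballI allI impI) (simp_all add: tvec_of_apply trans_deriv_compose, simp add: tvec_of_def)

lemma tangent_apply:
  "v \<in> tangent_space A p \<Longrightarrow> c \<in> charts_at A p \<Longrightarrow> d \<in> charts_at A p \<Longrightarrow> v d = trans_deriv c d p (v c)"
  unfolding tangent_space_def by blast

lemma tvec_of_eta:
  assumes "v \<in> tangent_space A p" "c \<in> charts_at A p" shows "tvec_of A c p (v c) = v"
proof
  fix d show "tvec_of A c p (v c) d = v d"
  proof (cases "d \<in> charts_at A p")
    case True
    show ?thesis unfolding tvec_of_apply[OF True] by (rule tangent_apply[OF assms True, symmetric])
  next
    case False
    then have "v d = 0" using assms(1) unfolding tangent_space_def by blast
    then show ?thesis using False by (simp add: tvec_of_def)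
  qed
qed

lemma tangent_eqI:
  "v \<in> tangent_space A p \<Longrightarrow> w \<in> tangent_space A p \<Longrightarrow> c \<in> charts_at A p \<Longrightarrow> v c = w c \<Longrightarrow> v = w"
  by (metis tvec_of_eta)

lemma tvec_of_trans:
  assumes "c \<in> charts_at A p" "d \<in> charts_at A p"
  shows "tvec_of A d p (trans_deriv c d p u) = tvec_of A c p u"
  by (rule ext) (simp add: tvec_of_def trans_deriv_compose[OF assms])

lemma linear_tvec_of:
  assumes c: "c \<in> charts_at A p" shows "linear (tvec_of A c p)"
  by (rule linearI)
     (auto simp: tvec_of_def fun_eq_iff 
       linear_add[OF linear_trans_deriv[OF c]] linear_cmul[OF linear_trans_deriv[OF c]])

lemma subspace_tangent_space: "subspace (tangent_space A p)"
proof -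
  have "tangent_space A p = range (tvec_of A (chart_at A p) p)"
  proof (intro equalityI subsetI)
    fix v assume "v \<in> tangent_space A p"
    from tvec_of_eta[OF this chart_at_in] show "v \<in> range (tvec_of A (chart_at A p) p)" by (metis rangeI)
  qed (auto intro: tvec_of_in[OF chart_at_in])
  then show ?thesis using linear_subspace_image[OF linear_tvec_of[OF chart_at_in] subspace_UNIV] by simp
qed

lemma tangent_lin_in:
  "v \<in> tangent_space A p \<Longrightarrow> w \<in> tangent_space A p \<Longrightarrow> a *\<^sub>R v + b *\<^sub>R w \<in> tangent_space A p"
  using subspace_tangent_space by (simp add: subspace_add subspace_scale)

lemma map_tvec_of_trans:
  assumes "c \<in> A" "d \<in> A" "x \<in> overlap c d"
  shows "map (tvec_of A d (param d (trans c d x))) (map (frechet_derivative (trans c d) (at x)) us) =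
     map (tvec_of A c (param c x)) us"
proof -
  have "c \<in> charts_at A (param c x)" "d \<in> charts_at A (param c x)"
    using assms by (auto simp: charts_at_iff param_coord)
  then show ?thesis
    unfolding param_trans[OF assms] trans_deriv_param[OF assms, symmetric] by (simp add: tvec_of_trans)
qed

subsection \<open>Covectors and bivectors in a chart\<close>

text \<open>The Riesz vector of a covector in the chart \<open>c\<close>. It puts covectors and
  tangent vectors into the same euclidean space.\<close>

definition covec_coord where
  "covec_coord c p \<alpha> = (\<Sum>b\<in>Basis. \<alpha> [tvec_of A c p b] *\<^sub>R b)"

lemma covec_coord_inner:
  assumes \<alpha>: "\<alpha> \<in> cotangent_space A p" and c: "c \<in> charts_at A p"
  shows "covec_coord c p \<alpha> \<bullet> u = \<alpha> [tvec_of A c p u]"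
proof -
  have "linear (\<lambda>u. \<alpha> [tvec_of A c p u])"
  proof (rule linearI)
    note * = alternating_forms_1D[OF \<alpha>[unfolded cotangent_space_def] tvec_of_in[OF c] tvec_of_in[OF c]]
    show "\<alpha> [tvec_of A c p (u + v)] = \<alpha> [tvec_of A c p u] + \<alpha> [tvec_of A c p v]" for u v
      using *[of 1 u 1 v] by (simp add: linear_add[OF linear_tvec_of[OF c]])
    show "\<alpha> [tvec_of A c p (r *\<^sub>R u)] = r *\<^sub>R \<alpha> [tvec_of A c p u]" for r u
      using *[of r u 0 u] by (simp add: linear_cmul[OF linear_tvec_of[OF c]])
  qed
  from linear_expand_Basis[OF this, of u] show ?thesis
    by (simp add: covec_coord_def inner_sum_left inner_commute[of u] mult.commute)
qed

lemma covec_coord_inner':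
  "\<alpha> \<in> cotangent_space A p \<Longrightarrow> c \<in> charts_at A p \<Longrightarrow> v \<in> tangent_space A p \<Longrightarrow> \<alpha> [v] = covec_coord c p \<alpha> \<bullet> v c"
  by (simp add: covec_coord_inner tvec_of_eta)

lemma covec_of_in:
  assumes c: "c \<in> charts_at A p" shows "covec_of A c p u \<in> cotangent_space A p"
  unfolding cotangent_space_def
  by (rule alternating_forms_1I)
     (auto simp: covec_of_def tangent_lin_in inner_add_left)

lemma covec_of_apply: "v \<in> tangent_space A p \<Longrightarrow> covec_of A c p u [v] = v c \<bullet> u"
  by (simp add: covec_of_def)

lemma covec_of_eta:
  assumes \<alpha>: "\<alpha> \<in> cotangent_space A p" and c: "c \<in> charts_at A p"
  shows "covec_of A c p (covec_coord c p \<alpha>) = \<alpha>"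
proof
  fix vs
  show "covec_of A c p (covec_coord c p \<alpha>) vs = \<alpha> vs"
  proof (cases "length vs = 1 \<and> set vs \<subseteq> tangent_space A p")
    case True
    then obtain v where "vs = [v]" "v \<in> tangent_space A p" by (auto simp: length_Suc_conv)
    then show ?thesis using covec_coord_inner'[OF \<alpha> c] by (simp add: covec_of_apply inner_commute)
  next
    case False
    then show ?thesis
      using alternating_forms_zero[OF \<alpha>[unfolded cotangent_space_def]] by (auto simp: covec_of_def)
  qed
qed

lemma covec_of_lin:
  "covec_of A c p (a *\<^sub>R u + b *\<^sub>R v) = a *\<^sub>R covec_of A c p u + b *\<^sub>R covec_of A c p v"
  by (auto simp: covec_of_def fun_eq_iff inner_add_right)

end

locale bivector_manifold = smooth_manifold A
  for A :: "('p::{t2_space,second_countable_topology}, 'e::euclidean_space) chart set" +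
  fixes \<pi> :: "('p, 'e) bivector"
  assumes bivector: "bivector_field A \<pi>"
begin

text \<open>The map \<open>\<pi>\<^sup>\<sharp>\<close> in the chart \<open>c\<close>, from Riesz
  vectors of covectors to coordinate vectors. In this form the bivector is a skew endomorphism of
  the model space.\<close>

definition bivec_map where
  "bivec_map c p u = (\<Sum>b\<in>Basis. \<pi> p [covec_of A c p u, covec_of A c p b] *\<^sub>R b)"

lemma bivector_alternating: "\<pi> p \<in> alternating_forms 2 (cotangent_space A p)"
  using bivector by (simp add: bivector_field_def)

lemma
  assumes c: "c \<in> charts_at A p"
  shows bivec_map_inner: "bivec_map c p u \<bullet> w = \<pi> p [covec_of A c p u, covec_of A c p w]"
    and linear_bivec_map: "linear (bivec_map c p)"
    and bivec_map_skew: "bivec_map c p u \<bullet> w = - (u \<bullet> bivec_map c p w)"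
proof -
  note lin = alternating_forms_2D[OF bivector_alternating[of p] covec_of_in[OF c] covec_of_in[OF c] covec_of_in[OF c]]
  have lin_w: "linear (\<lambda>w. \<pi> p [covec_of A c p u, covec_of A c p w])" for u
  proof (rule linearI)
    show "\<pi> p [covec_of A c p u, covec_of A c p (v + w)] = \<pi> p [covec_of A c p u, covec_of A c p v] + \<pi> p [covec_of A c p u, covec_of A c p w]" for v w
      using lin(2)[of u 1 v 1 w] covec_of_lin[of c p 1 v 1 w] by simp
    show "\<pi> p [covec_of A c p u, covec_of A c p (r *\<^sub>R v)] = r *\<^sub>R \<pi> p [covec_of A c p u, covec_of A c p v]" for v r
      using lin(2)[of u r v 0 v] covec_of_lin[of c p r v 0 v] by simp
  qed
  show inner: "bivec_map c p u \<bullet> w = \<pi> p [covec_of A c p u, covec_of A c p w]" for u w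
    unfolding linear_expand_Basis[OF lin_w, of u w] bivec_map_def inner_sum_left inner_scaleR_left
    by (intro sum.cong refl) (simp add: inner_commute[of w] mult.commute)
  show "linear (bivec_map c p)"
  proof (rule linearI)
    show "bivec_map c p (v + w) = bivec_map c p v + bivec_map c p w" for v w
    proof (rule euclidean_eqI)
      fix b :: 'e
      show "bivec_map c p (v + w) \<bullet> b = (bivec_map c p v + bivec_map c p w) \<bullet> b"
        using lin(1)[of 1 v 1 w b] covec_of_lin[of c p 1 v 1 w] by (simp add: inner inner_add_left)
    qed
    show "bivec_map c p (r *\<^sub>R v) = r *\<^sub>R bivec_map c p v" for v r
    proof (rule euclidean_eqI)
      fix b :: 'e
      show "bivec_map c p (r *\<^sub>R v) \<bullet> b = (r *\<^sub>R bivec_map c p v) \<bullet> b"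
        using lin(1)[of r v 0 v b] covec_of_lin[of c p r v 0 v] by (simp add: inner)
    qed
  qed
  have "covec_of A c p u + covec_of A c p w \<in> cotangent_space A p"
    using covec_of_lin[of c p 1 u 1 w] covec_of_in[OF c, of "1 *\<^sub>R u + 1 *\<^sub>R w"] by simp
  from alternating_forms_2_swap[OF bivector_alternating covec_of_in[OF c] covec_of_in[OF c] this]
  have "bivec_map c p u \<bullet> w = - (bivec_map c p w \<bullet> u)" unfolding inner .
  then show "bivec_map c p u \<bullet> w = - (u \<bullet> bivec_map c p w)" unfolding inner_commute[of u] .
qed

lemma smooth_bivec_map:
  assumes "c \<in> A" shows "smooth_on (im_of c) (\<lambda>x. bivec_map c (param c x) u)"
  unfolding bivec_map_def
  by (intro smooth_on_sum smooth_on_scaleR smooth_on_const open_im[OF assms])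
     (use bivector[unfolded bivector_field_def] assms in blast)

lemma bivec_eq_inner:
  assumes "\<alpha> \<in> cotangent_space A p" "\<beta> \<in> cotangent_space A p" and c: "c \<in> charts_at A p"
  shows "\<pi> p [\<alpha>, \<beta>] = bivec_map c p (covec_coord c p \<alpha>) \<bullet> covec_coord c p \<beta>"
  unfolding bivec_map_inner[OF c] covec_of_eta[OF assms(1) c] covec_of_eta[OF assms(2) c] ..

text \<open>The coordinate covectors \<open>covec_of A c p u\<close> separate tangent vectors, so
  the definite description in \<open>sharp\<close> has exactly one solution.\<close>

lemma sharp_eq:
  assumes \<alpha>: "\<alpha> \<in> cotangent_space A p" and c: "c \<in> charts_at A p"
  shows "sharp A \<pi> p \<alpha> = tvec_of A c p (bivec_map c p (covec_coord c p \<alpha>))" (is "_ = ?v")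
  unfolding sharp_def
proof (rule the_equality)
  have "\<beta> [?v] = \<pi> p [\<alpha>, \<beta>]" if \<beta>: "\<beta> \<in> cotangent_space A p" for \<beta>
    unfolding covec_coord_inner[OF \<beta> c, symmetric] bivec_eq_inner[OF \<alpha> \<beta> c] by (rule inner_commute)
  then show "?v \<in> tangent_space A p \<and> (\<forall>\<beta>\<in>cotangent_space A p. \<beta> [?v] = \<pi> p [\<alpha>, \<beta>])"
    using tvec_of_in[OF c] by blast
  fix v assume v: "v \<in> tangent_space A p \<and> (\<forall>\<beta>\<in>cotangent_space A p. \<beta> [v] = \<pi> p [\<alpha>, \<beta>])"
  have "v c \<bullet> u = bivec_map c p (covec_coord c p \<alpha>) \<bullet> u" for u
  proof -
    have "v c \<bullet> u = covec_of A c p u [v]" using v by (simp only: covec_of_apply)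
    also have "\<dots> = \<pi> p [\<alpha>, covec_of A c p u]" using v covec_of_in[OF c, of u] by blast
    also have "\<dots> = bivec_map c p (covec_coord c p \<alpha>) \<bullet> u"
      unfolding bivec_map_inner[OF c] covec_of_eta[OF \<alpha> c] ..
    finally show ?thesis .
  qed
  then have "v c = bivec_map c p (covec_coord c p \<alpha>)" by (rule euclidean_eqI)
  then show "v = ?v" using v tvec_of_eta[OF _ c, of v] by simp
qed

lemma sharp_in: "\<alpha> \<in> cotangent_space A p \<Longrightarrow> sharp A \<pi> p \<alpha> \<in> tangent_space A p"
  by (simp only: sharp_eq[OF _ chart_at_in] tvec_of_in[OF chart_at_in])

lemma sharp_apply:
  "\<alpha> \<in> cotangent_space A p \<Longrightarrow> c \<in> charts_at A p \<Longrightarrow> sharp A \<pi> p \<alpha> c = bivec_map c p (covec_coord c p \<alpha>)"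
  by (simp add: sharp_eq tvec_of_self)

lemma covec_coord_covec_of:
  assumes c: "c \<in> charts_at A p" shows "covec_coord c p (covec_of A c p u) = u"
proof (rule euclidean_eqI)
  fix b :: 'e
  show "covec_coord c p (covec_of A c p u) \<bullet> b = u \<bullet> b"
    unfolding covec_coord_inner[OF covec_of_in[OF c] c] covec_of_apply[OF tvec_of_in[OF c]] tvec_of_self[OF c]
    by (rule inner_commute)
qed

lemma characteristic_eq:
  assumes c: "c \<in> charts_at A p"
  shows "characteristic_distribution A \<pi> p = tvec_of A c p ` range (bivec_map c p)"
proof -
  have "tvec_of A c p (bivec_map c p u) \<in> sharp A \<pi> p ` cotangent_space A p" for u
    using imageI[OF covec_of_in[OF c, of u], of "sharp A \<pi> p"]
    unfolding sharp_eq[OF covec_of_in[OF c] c] covec_coord_covec_of[OF c] .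
  then show ?thesis
    unfolding characteristic_distribution_def by (auto simp: sharp_eq[OF _ c])
qed

lemma dim_characteristic:
  assumes c: "c \<in> charts_at A p"
  shows "dim (characteristic_distribution A \<pi> p) = dim (range (bivec_map c p))"
  unfolding characteristic_eq[OF c]
proof (rule dim_image_eq[OF linear_tvec_of[OF c]])
  show "inj_on (tvec_of A c p) (span (range (bivec_map c p)))"
    by (rule inj_on_inverseI[of _ "\<lambda>v. v c"]) (rule tvec_of_self[OF c])
qed

end

lemma diff_form_in: "diff_form A k \<omega> \<Longrightarrow> \<omega> p \<in> alternating_forms k (tangent_space A p)"
  by (simp add: diff_form_def)

context smooth_manifold
begin

subsection \<open>Forms in a chart\<close>

definition rep1 where "rep1 \<alpha> c x u = \<alpha> (param c x) [tvec_of A c (param c x) u]"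
definition rep2 where "rep2 \<omega> c x u v = \<omega> (param c x) [tvec_of A c (param c x) u, tvec_of A c (param c x) v]"
definition repv where "repv X c x = X (param c x) c"

lemma smooth_rep1:
  assumes "diff_form A 1 \<alpha>" "c \<in> A" shows "smooth_on (im_of c) (\<lambda>x. rep1 \<alpha> c x u)"
proof -
  have "length [u] = 1" by simp
  then have "smooth_on (im_of c) (\<lambda>x. \<alpha> (param c x) (map (tvec_of A c (param c x)) [u]))"
    using assms unfolding diff_form_def by blast
  then show ?thesis by (simp add: rep1_def)
qed

lemma smooth_rep2:
  assumes "diff_form A 2 \<omega>" "c \<in> A" shows "smooth_on (im_of c) (\<lambda>x. rep2 \<omega> c x u v)"
proof -
  have "length [u, v] = 2" by simp
  then have "smooth_on (im_of c) (\<lambda>x. \<omega> (param c x) (map (tvec_of A c (param c x)) [u, v]))"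
    using assms unfolding diff_form_def by blast
  then show ?thesis by (simp add: rep2_def)
qed

lemma smooth_repv: "vector_field A X \<Longrightarrow> c \<in> A \<Longrightarrow> smooth_on (im_of c) (repv X c)"
  unfolding repv_def vector_field_def by blast

lemma linear_rep1:
  assumes "diff_form A 1 \<alpha>" "c \<in> A" "x \<in> im_of c" shows "linear (rep1 \<alpha> c x)"
proof (rule linearI)
  note c = param_charts[OF assms(2,3)]
  note lin = alternating_forms_1D[OF diff_form_in[OF assms(1)] tvec_of_in[OF c] tvec_of_in[OF c]]
  show "rep1 \<alpha> c x (u + v) = rep1 \<alpha> c x u + rep1 \<alpha> c x v" for u v
    using lin[of 1 u 1 v] by (simp add: rep1_def linear_add[OF linear_tvec_of[OF c]])
  show "rep1 \<alpha> c x (r *\<^sub>R u) = r *\<^sub>R rep1 \<alpha> c x u" for u r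
    using lin[of r u 0 u] by (simp add: rep1_def linear_cmul[OF linear_tvec_of[OF c]])
qed

lemma
  assumes "diff_form A 2 \<omega>" "c \<in> A" "x \<in> im_of c"
  shows linear_rep2_left: "linear (\<lambda>u. rep2 \<omega> c x u v)" and linear_rep2_right: "linear (rep2 \<omega> c x v)"
    and rep2_self: "rep2 \<omega> c x v v = 0"
proof -
  note c = param_charts[OF assms(2,3)]
  note lin = alternating_forms_2D[OF diff_form_in[OF assms(1)] tvec_of_in[OF c] tvec_of_in[OF c] tvec_of_in[OF c]]
  show "linear (\<lambda>u. rep2 \<omega> c x u v)"
  proof (rule linearI)
    show "rep2 \<omega> c x (u + w) v = rep2 \<omega> c x u v + rep2 \<omega> c x w v" for u w
      using lin(1)[of 1 u 1 w v] by (simp add: rep2_def linear_add[OF linear_tvec_of[OF c]])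
    show "rep2 \<omega> c x (r *\<^sub>R u) v = r *\<^sub>R rep2 \<omega> c x u v" for u r
      using lin(1)[of r u 0 u v] by (simp add: rep2_def linear_cmul[OF linear_tvec_of[OF c]])
  qed
  show "linear (rep2 \<omega> c x v)"
  proof (rule linearI)
    show "rep2 \<omega> c x v (u + w) = rep2 \<omega> c x v u + rep2 \<omega> c x v w" for u w
      using lin(2)[of v 1 u 1 w] by (simp add: rep2_def linear_add[OF linear_tvec_of[OF c]])
    show "rep2 \<omega> c x v (r *\<^sub>R u) = r *\<^sub>R rep2 \<omega> c x v u" for u r
      using lin(2)[of v r u 0 u] by (simp add: rep2_def linear_cmul[OF linear_tvec_of[OF c]])
  qed
  show "rep2 \<omega> c x v v = 0" using lin(3)[of v] by (simp add: rep2_def)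
qed

lemma rep2_swap:
  assumes "diff_form A 2 \<omega>" "c \<in> A" "x \<in> im_of c"
  shows "rep2 \<omega> c x u v = - rep2 \<omega> c x v u"
proof -
  note l = linear_add[OF linear_rep2_left[OF assms]] and r = linear_add[OF linear_rep2_right[OF assms]]
  have "rep2 \<omega> c x (u + v) (u + v) = rep2 \<omega> c x u u + rep2 \<omega> c x v u + (rep2 \<omega> c x u v + rep2 \<omega> c x v v)"
    by (simp only: r l)
  then show ?thesis by (simp add: rep2_self[OF assms])
qed

abbreviation dtrans where "dtrans c d x \<equiv> frechet_derivative (trans c d) (at x)"
abbreviation ddtrans where "ddtrans c d x u v \<equiv> frechet_derivative (\<lambda>y. dtrans c d y u) (at x) v"

lemma ddtrans_symmetric:
  "c \<in> A \<Longrightarrow> d \<in> A \<Longrightarrow> x \<in> overlap c d \<Longrightarrow> ddtrans c d x u v = ddtrans c d x v u"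
  by (rule second_derivative_symmetric[OF open_overlap _ smooth_trans])

lemma dtrans_has_derivative:
  assumes "c \<in> A" "d \<in> A" "x \<in> overlap c d"
  shows "(trans c d has_derivative dtrans c d x) (at x)"
    and "((\<lambda>y. dtrans c d y u) has_derivative ddtrans c d x u) (at x)"
  by (rule smooth_on_has_derivative[OF smooth_trans[OF assms(1,2)] assms(3)])
     (rule smooth_on_has_derivative[OF smooth_on_frechet_derivative[OF smooth_trans[OF assms(1,2)]] assms(3)])

lemma compose_trans_has_derivative:
  assumes "c \<in> A" "d \<in> A" "x \<in> overlap c d" "smooth_on (im_of d) f"
  shows "((\<lambda>y. f (trans c d y)) has_derivative
     (\<lambda>h. frechet_derivative f (at (trans c d x)) (dtrans c d x h))) (at x)"
  using diff_chain_at[OF dtrans_has_derivative(1)[OF assms(1-3)] smooth_on_has_derivative[OF assms(4) trans_im[OF assms(1,3)]]]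
  unfolding o_def .

lemma rep1_trans:
  assumes "c \<in> A" "d \<in> A" "x \<in> overlap c d"
  shows "rep1 \<alpha> d (trans c d x) (dtrans c d x u) = rep1 \<alpha> c x u"
  using map_tvec_of_trans[OF assms, of "[u]"] param_trans[OF assms] unfolding rep1_def by simp

lemma rep2_trans:
  assumes "c \<in> A" "d \<in> A" "x \<in> overlap c d"
  shows "rep2 \<omega> d (trans c d x) (dtrans c d x u) (dtrans c d x v) = rep2 \<omega> c x u v"
  using map_tvec_of_trans[OF assms, of "[u, v]"] param_trans[OF assms] unfolding rep2_def by simp

lemma overlap_charts:
  assumes "c \<in> A" "d \<in> A" "x \<in> overlap c d"
  shows "c \<in> charts_at A (param c x)" "d \<in> charts_at A (param c x)"
  using assms by (auto simp: charts_at_iff param_coord)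

lemma repv_trans:
  assumes "vector_field A X" "c \<in> A" "d \<in> A" "x \<in> overlap c d"
  shows "repv X d (trans c d x) = dtrans c d x (repv X c x)"
proof -
  have "X (param c x) \<in> tangent_space A (param c x)" using assms(1) by (simp add: vector_field_def)
  from tangent_apply[OF this overlap_charts[OF assms(2-4)]]
  show ?thesis unfolding repv_def param_trans[OF assms(2-4)] trans_deriv_param[OF assms(2-4)] .
qed

text \<open>The last summand measures how far the coordinate derivative is from being a tensor. It
  is symmetric in \<open>u\<close> and \<open>h\<close>, so it drops out of \<open>d1\<close>, and
  in \<open>lie1\<close> it cancels against the corresponding term from the derivative of the
  field.\<close>

lemma rep1_deriv_trans:
  assumes \<alpha>: "diff_form A 1 \<alpha>" and x: "c \<in> A" "d \<in> A" "x \<in> overlap c d"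
  shows "frechet_derivative (\<lambda>y. rep1 \<alpha> c y u) (at x) h =
    frechet_derivative (\<lambda>y. rep1 \<alpha> d y (dtrans c d x u)) (at (trans c d x)) (dtrans c d x h) +
    rep1 \<alpha> d (trans c d x) (ddtrans c d x u h)"
proof -
  have "((\<lambda>y. rep1 \<alpha> d (trans c d y) (dtrans c d y u)) has_derivative
     (\<lambda>h. frechet_derivative (\<lambda>y. rep1 \<alpha> d y (dtrans c d x u)) (at (trans c d x)) (dtrans c d x h) +
       rep1 \<alpha> d (trans c d x) (ddtrans c d x u h))) (at x)"
    by (rule has_derivative_family_apply[OF open_overlap[OF x(1,2)] x(3) linear_rep1[OF \<alpha> x(2) trans_im[OF x(1)]]
        compose_trans_has_derivative[OF x smooth_rep1[OF \<alpha> x(2)]] dtrans_has_derivative(2)[OF x]])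
  then have "((\<lambda>y. rep1 \<alpha> c y u) has_derivative
     (\<lambda>h. frechet_derivative (\<lambda>y. rep1 \<alpha> d y (dtrans c d x u)) (at (trans c d x)) (dtrans c d x h) +
       rep1 \<alpha> d (trans c d x) (ddtrans c d x u h))) (at x)"
    by (rule has_derivative_transform_within_open[OF _ open_overlap[OF x(1,2)] x(3)]) (rule rep1_trans[OF x(1,2)])
  then show ?thesis by (rule fun_cong[OF frechet_derivative_at[symmetric]])
qed

lemma rep2_deriv_trans:
  assumes \<omega>: "diff_form A 2 \<omega>" and x: "c \<in> A" "d \<in> A" "x \<in> overlap c d"
  shows "frechet_derivative (\<lambda>y. rep2 \<omega> c y u v) (at x) h =
    frechet_derivative (\<lambda>y. rep2 \<omega> d y (dtrans c d x u) (dtrans c d x v)) (at (trans c d x)) (dtrans c d x h) +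
    rep2 \<omega> d (trans c d x) (dtrans c d x u) (ddtrans c d x v h) +
    rep2 \<omega> d (trans c d x) (ddtrans c d x u h) (dtrans c d x v)"
proof -
  have "((\<lambda>y. rep2 \<omega> d (trans c d y) (dtrans c d y u) (dtrans c d y v)) has_derivative
     (\<lambda>h. frechet_derivative (\<lambda>y. rep2 \<omega> d y (dtrans c d x u) (dtrans c d x v)) (at (trans c d x)) (dtrans c d x h) +
    rep2 \<omega> d (trans c d x) (dtrans c d x u) (ddtrans c d x v h) +
    rep2 \<omega> d (trans c d x) (ddtrans c d x u h) (dtrans c d x v))) (at x)"
    by (rule has_derivative_bilinear_family[OF open_overlap[OF x(1,2)] x(3)
        linear_rep2_left[OF \<omega> x(2) trans_im[OF x(1)]] linear_rep2_right[OF \<omega> x(2) trans_im[OF x(1)]]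
        compose_trans_has_derivative[OF x smooth_rep2[OF \<omega> x(2)]] dtrans_has_derivative(2)[OF x] dtrans_has_derivative(2)[OF x]])
  then have "((\<lambda>y. rep2 \<omega> c y u v) has_derivative
     (\<lambda>h. frechet_derivative (\<lambda>y. rep2 \<omega> d y (dtrans c d x u) (dtrans c d x v)) (at (trans c d x)) (dtrans c d x h) +
    rep2 \<omega> d (trans c d x) (dtrans c d x u) (ddtrans c d x v h) +
    rep2 \<omega> d (trans c d x) (ddtrans c d x u h) (dtrans c d x v))) (at x)"
    by (rule has_derivative_transform_within_open[OF _ open_overlap[OF x(1,2)] x(3)]) (rule rep2_trans[OF x(1,2)])
  then show ?thesis by (rule fun_cong[OF frechet_derivative_at[symmetric]])
qed

lemma repv_deriv_trans:
  assumes X: "vector_field A X" and x: "c \<in> A" "d \<in> A" "x \<in> overlap c d"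
  shows "frechet_derivative (repv X d) (at (trans c d x)) (dtrans c d x h) =
    ddtrans c d x (repv X c x) h + dtrans c d x (frechet_derivative (repv X c) (at x) h)"
proof -
  have lin: "linear (dtrans c d y)" if "y \<in> overlap c d" for y
    by (rule has_derivative_linear[OF dtrans_has_derivative(1)[OF x(1,2) that]])
  have "((\<lambda>y. dtrans c d y (repv X c y)) has_derivative
    (\<lambda>h. ddtrans c d x (repv X c x) h + dtrans c d x (frechet_derivative (repv X c) (at x) h))) (at x)"
    by (rule has_derivative_family_apply[OF open_overlap[OF x(1,2)] x(3) lin dtrans_has_derivative(2)[OF x]
        smooth_on_has_derivative[OF smooth_repv[OF X x(1)] overlap_im[OF x(3)]]])
  then have "((\<lambda>y. repv X d (trans c d y)) has_derivative
    (\<lambda>h. ddtrans c d x (repv X c x) h + dtrans c d x (frechet_derivative (repv X c) (at x) h))) (at x)"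
    by (rule has_derivative_transform_within_open[OF _ open_overlap[OF x(1,2)] x(3)]) (rule repv_trans[OF X x(1,2), symmetric])
  from fun_cong[OF has_derivative_unique[OF compose_trans_has_derivative[OF x smooth_repv[OF X x(2)]] this]]
  show ?thesis .
qed

subsection \<open>Exterior and Lie derivative in an arbitrary chart\<close>

text \<open>\<open>d1\<close>, \<open>d2\<close> and \<open>lie1\<close> are the coordinate formulas
  in a prescribed chart. \<open>ext_deriv\<close> and \<open>lie_deriv\<close> use
  \<open>chart_at A p\<close>, an arbitrary choice with no continuity in \<open>p\<close>; their
  smoothness shows only after passing to a fixed chart.\<close>

definition d1 where
  "d1 \<alpha> c x u v = frechet_derivative (\<lambda>y. rep1 \<alpha> c y v) (at x) u - frechet_derivative (\<lambda>y. rep1 \<alpha> c y u) (at x) v"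

definition d2 where
  "d2 \<omega> c x u v w = frechet_derivative (\<lambda>y. rep2 \<omega> c y v w) (at x) u
     - frechet_derivative (\<lambda>y. rep2 \<omega> c y u w) (at x) v + frechet_derivative (\<lambda>y. rep2 \<omega> c y u v) (at x) w"

definition lie1 where
  "lie1 X \<beta> c x v = frechet_derivative (\<lambda>y. rep1 \<beta> c y v) (at x) (repv X c x)
     + rep1 \<beta> c x (frechet_derivative (repv X c) (at x) v)"

lemma d1_trans:
  assumes \<alpha>: "diff_form A 1 \<alpha>" and x: "c \<in> A" "d \<in> A" "x \<in> overlap c d"
  shows "d1 \<alpha> d (trans c d x) (dtrans c d x u) (dtrans c d x v) = d1 \<alpha> c x u v"
  unfolding d1_def rep1_deriv_trans[OF \<alpha> x] by (simp add: ddtrans_symmetric[OF x, of u v])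

lemma d2_trans:
  assumes \<omega>: "diff_form A 2 \<omega>" and x: "c \<in> A" "d \<in> A" "x \<in> overlap c d"
  shows "d2 \<omega> d (trans c d x) (dtrans c d x u) (dtrans c d x v) (dtrans c d x w) = d2 \<omega> c x u v w"
  unfolding d2_def rep2_deriv_trans[OF \<omega> x]
  \<comment> \<open>Of the six terms with second derivatives of the transition map, two pairs cancel
    by symmetry of these derivatives alone; the third pair also needs the form to be
    alternating.\<close>
  using rep2_swap[OF \<omega> x(2) trans_im[OF x(1,3)], of "dtrans c d x v" "ddtrans c d x w u"]
  by (simp add: ddtrans_symmetric[OF x, of u v] ddtrans_symmetric[OF x, of u w] ddtrans_symmetric[OF x, of v w])

lemma lie1_trans:
  assumes X: "vector_field A X" and \<beta>: "diff_form A 1 \<beta>" and x: "c \<in> A" "d \<in> A" "x \<in> overlap c d"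
  shows "lie1 X \<beta> d (trans c d x) (dtrans c d x v) = lie1 X \<beta> c x v"
  unfolding lie1_def rep1_deriv_trans[OF \<beta> x] repv_deriv_trans[OF X x] repv_trans[OF X x]
    linear_add[OF linear_rep1[OF \<beta> x(2) trans_im[OF x(1,3)]]] rep1_trans[OF x]
  by (simp add: ddtrans_symmetric[OF x, of v "repv X c x"])

lemma charts_overlap:
  assumes "c \<in> charts_at A p" "d \<in> charts_at A p"
  shows "c \<in> A" "d \<in> A" "coord c p \<in> overlap c d" "trans c d (coord c p) = coord d p"
    and "v \<in> tangent_space A p \<Longrightarrow> dtrans c d (coord c p) (v c) = v d"
  using assms tangent_apply[of v p c d] trans_coord[of c p d] by (auto simp: charts_at_iff trans_deriv_def)

lemma param_coord_charts: "c \<in> charts_at A p \<Longrightarrow> param c (coord c p) = p"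
  by (simp add: charts_at_iff param_coord)

lemma ext_deriv_1:
  assumes \<alpha>: "diff_form A 1 \<alpha>" and c: "c \<in> charts_at A p" and v: "u \<in> tangent_space A p" "v \<in> tangent_space A p"
  shows "ext_deriv A \<alpha> p [u, v] = d1 \<alpha> c (coord c p) (u c) (v c)"
proof -
  let ?c = "chart_at A p"
  have "ext_deriv A \<alpha> p [u, v] = d1 \<alpha> ?c (coord ?c p) (u ?c) (v ?c)"
    using v by (simp add: ext_deriv_def Let_def d1_def rep1_def)
  also have "\<dots> = d1 \<alpha> c (coord c p) (u c) (v c)"
    using d1_trans[OF \<alpha> charts_overlap(1-3)[OF chart_at_in c], of "u ?c" "v ?c"]
    unfolding charts_overlap(4,5)[OF chart_at_in c] charts_overlap(5)[OF chart_at_in c v(1)] charts_overlap(5)[OF chart_at_in c v(2)]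
    by simp
  finally show ?thesis .
qed

lemma ext_deriv_2:
  assumes \<omega>: "diff_form A 2 \<omega>" and c: "c \<in> charts_at A p"
    and v: "u \<in> tangent_space A p" "v \<in> tangent_space A p" "w \<in> tangent_space A p"
  shows "ext_deriv A \<omega> p [u, v, w] = d2 \<omega> c (coord c p) (u c) (v c) (w c)"
proof -
  let ?c = "chart_at A p"
  have "ext_deriv A \<omega> p [u, v, w] = d2 \<omega> ?c (coord ?c p) (u ?c) (v ?c) (w ?c)"
    using v by (simp add: ext_deriv_def Let_def d2_def rep2_def)
  also have "\<dots> = d2 \<omega> c (coord c p) (u c) (v c) (w c)"
    using d2_trans[OF \<omega> charts_overlap(1-3)[OF chart_at_in c], of "u ?c" "v ?c" "w ?c"]
    unfolding charts_overlap(4)[OF chart_at_in c] charts_overlap(5)[OF chart_at_in c v(1)]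
      charts_overlap(5)[OF chart_at_in c v(2)] charts_overlap(5)[OF chart_at_in c v(3)]
    by simp
  finally show ?thesis .
qed

lemma lie_deriv_1:
  assumes X: "vector_field A X" and \<beta>: "diff_form A 1 \<beta>" and c: "c \<in> charts_at A p" and v: "v \<in> tangent_space A p"
  shows "lie_deriv A X \<beta> p [v] = lie1 X \<beta> c (coord c p) (v c)"
proof -
  let ?c = "chart_at A p"
  have "lie_deriv A X \<beta> p [v] = lie1 X \<beta> ?c (coord ?c p) (v ?c)"
    using v by (simp add: lie_deriv_def Let_def lie1_def rep1_def repv_def[abs_def] param_coord_charts[OF chart_at_in])
  also have "\<dots> = lie1 X \<beta> c (coord c p) (v c)"
    using lie1_trans[OF X \<beta> charts_overlap(1-3)[OF chart_at_in c], of "v ?c"]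
    unfolding charts_overlap(4)[OF chart_at_in c] charts_overlap(5)[OF chart_at_in c v]
    by simp
  finally show ?thesis .
qed

text \<open>Forms are extended by zero to unsuitable lists, so derivatives of forms have to vanish
  there too. If the length is wrong, the form is only ever evaluated on lists of wrong length, and
  constant zero functions are differentiated.\<close>

lemma ext_deriv_zero:
  assumes \<omega>: "diff_form A k \<omega>" and vs: "\<not> (length vs = Suc k \<and> set vs \<subseteq> tangent_space A p)"
  shows "ext_deriv A \<omega> p vs = 0"
proof (cases "set vs \<subseteq> tangent_space A p")
  case True
  then have len: "length vs \<noteq> Suc k" using vs by simp
  have "\<omega> q (map f (take i vs @ drop (Suc i) vs)) = 0" if "i < length vs" for q f i
    by (rule alternating_forms_zero[OF diff_form_in[OF \<omega>]]) (use len that in auto)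
  then show ?thesis using True by (simp add: ext_deriv_def Let_def frechet_derivative_const)
qed (simp add: ext_deriv_def)

lemma lie_deriv_zero:
  assumes \<omega>: "diff_form A k \<omega>" and vs: "\<not> (length vs = k \<and> set vs \<subseteq> tangent_space A p)"
  shows "lie_deriv A X \<omega> p vs = 0"
proof (cases "set vs \<subseteq> tangent_space A p")
  case True
  then have len: "length vs \<noteq> k" using vs by simp
  have "\<omega> q (map f vs) = 0" for q f
    by (rule alternating_forms_zero[OF diff_form_in[OF \<omega>]]) (use len in auto)
  moreover have "\<omega> q (vs[i := z]) = 0" for q i z
    by (rule alternating_forms_zero[OF diff_form_in[OF \<omega>]]) (use len in auto)
  ultimately show ?thesis using True by (simp add: lie_deriv_def Let_def frechet_derivative_const)
qed (simp add: lie_deriv_def)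

subsection \<open>The exterior derivative of a 2-form\<close>

lemma
  assumes \<omega>: "diff_form A 2 \<omega>" and x: "c \<in> A" "x \<in> im_of c"
  shows linear_rep2_deriv: "linear (frechet_derivative (\<lambda>y. rep2 \<omega> c y u v) (at x))"
    and linear_rep2_deriv_left: "linear (\<lambda>u. frechet_derivative (\<lambda>y. rep2 \<omega> c y u v) (at x) h)"
    and linear_rep2_deriv_right: "linear (\<lambda>v. frechet_derivative (\<lambda>y. rep2 \<omega> c y u v) (at x) h)"
    and rep2_deriv_swap: "frechet_derivative (\<lambda>y. rep2 \<omega> c y u v) (at x) h = - frechet_derivative (\<lambda>y. rep2 \<omega> c y v u) (at x) h"
proof -
  note der = smooth_on_has_derivative[OF smooth_rep2[OF \<omega> x(1)] x(2)]
  show "linear (frechet_derivative (\<lambda>y. rep2 \<omega> c y u v) (at x))"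
    by (rule has_derivative_linear[OF der])
  show "linear (\<lambda>u. frechet_derivative (\<lambda>y. rep2 \<omega> c y u v) (at x) h)"
    by (rule linear_derivative_of_family[OF open_im[OF x(1)] x(2) linear_rep2_left[OF \<omega> x(1)] der])
  show "linear (\<lambda>v. frechet_derivative (\<lambda>y. rep2 \<omega> c y u v) (at x) h)"
    by (rule linear_derivative_of_family[OF open_im[OF x(1)] x(2) linear_rep2_right[OF \<omega> x(1)] der])
  have "((\<lambda>y. rep2 \<omega> c y u v) has_derivative (\<lambda>h. - frechet_derivative (\<lambda>y. rep2 \<omega> c y v u) (at x) h)) (at x)"
    by (rule has_derivative_transform_within_open[OF has_derivative_minus[OF der] open_im[OF x(1)] x(2)])
       (rule rep2_swap[OF \<omega> x(1), symmetric])
  from fun_cong[OF has_derivative_unique[OF der this]]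
  show "frechet_derivative (\<lambda>y. rep2 \<omega> c y u v) (at x) h = - frechet_derivative (\<lambda>y. rep2 \<omega> c y v u) (at x) h" .
qed

lemma ext_deriv_2_coord:
  assumes \<omega>: "diff_form A 2 \<omega>" and x: "c \<in> A" "x \<in> im_of c"
  shows "ext_deriv A \<omega> (param c x) [tvec_of A c (param c x) u, tvec_of A c (param c x) v, tvec_of A c (param c x) w] = d2 \<omega> c x u v w"
proof -
  note c = param_charts[OF x]
  show ?thesis
    unfolding ext_deriv_2[OF \<omega> c tvec_of_in[OF c] tvec_of_in[OF c] tvec_of_in[OF c]] tvec_of_self[OF c] coord_param[OF x(2)] ..
qed

lemma smooth_d2:
  assumes \<omega>: "diff_form A 2 \<omega>" and c: "c \<in> A"
  shows "smooth_on (im_of c) (\<lambda>x. d2 \<omega> c x u v w)"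
  unfolding d2_def
  by (intro smooth_on_add smooth_on_diff smooth_on_frechet_derivative smooth_rep2[OF \<omega> c] open_im[OF c])

lemma diff_form_ext_deriv_2:
  assumes \<omega>: "diff_form A 2 \<omega>" shows "diff_form A 3 (ext_deriv A \<omega>)"
  unfolding diff_form_def
proof (intro conjI allI ballI impI)
  fix p
  let ?c = "chart_at A p"
  have c: "?c \<in> A" "coord ?c p \<in> im_of ?c" using chart_at_in[of p] by (auto simp: charts_at_iff)
  note ext = ext_deriv_2[OF \<omega> chart_at_in]
  note lin = linear_add[OF linear_rep2_deriv[OF \<omega> c]] linear_cmul[OF linear_rep2_deriv[OF \<omega> c]]
    linear_add[OF linear_rep2_deriv_left[OF \<omega> c]] linear_cmul[OF linear_rep2_deriv_left[OF \<omega> c]]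
    linear_add[OF linear_rep2_deriv_right[OF \<omega> c]] linear_cmul[OF linear_rep2_deriv_right[OF \<omega> c]]
  show "ext_deriv A \<omega> p \<in> alternating_forms 3 (tangent_space A p)"
  proof (rule alternating_forms_3I)
    fix x y z w and a b :: real
    assume T: "x \<in> tangent_space A p" "y \<in> tangent_space A p" "z \<in> tangent_space A p" "w \<in> tangent_space A p"
    note T' = tangent_lin_in[OF T(1,2), of a b]
    show "ext_deriv A \<omega> p [a *\<^sub>R x + b *\<^sub>R y, z, w] = a * ext_deriv A \<omega> p [x, z, w] + b * ext_deriv A \<omega> p [y, z, w]"
      unfolding ext[OF T' T(3,4)] ext[OF T(1,3,4)] ext[OF T(2,3,4)] d2_def plus_fun_apply scaleR_fun_apply lin
      by (simp add: algebra_simps)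
    show "ext_deriv A \<omega> p [z, a *\<^sub>R x + b *\<^sub>R y, w] = a * ext_deriv A \<omega> p [z, x, w] + b * ext_deriv A \<omega> p [z, y, w]"
      unfolding ext[OF T(3) T' T(4)] ext[OF T(3,1,4)] ext[OF T(3,2,4)] d2_def plus_fun_apply scaleR_fun_apply lin
      by (simp add: algebra_simps)
    show "ext_deriv A \<omega> p [z, w, a *\<^sub>R x + b *\<^sub>R y] = a * ext_deriv A \<omega> p [z, w, x] + b * ext_deriv A \<omega> p [z, w, y]"
      unfolding ext[OF T(3,4) T'] ext[OF T(3,4,1)] ext[OF T(3,4,2)] d2_def plus_fun_apply scaleR_fun_apply lin
      by (simp add: algebra_simps)
  next
    fix x y
    assume T: "x \<in> tangent_space A p" "y \<in> tangent_space A p"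
    have z: "frechet_derivative (\<lambda>y. rep2 \<omega> ?c y u u) (at (coord ?c p)) h = 0" for u h
      using rep2_deriv_swap[OF \<omega> c, of u u h] by simp
    show "ext_deriv A \<omega> p [x, x, y] = 0" unfolding ext[OF T(1,1,2)] d2_def by (simp add: z)
    show "ext_deriv A \<omega> p [x, y, x] = 0" unfolding ext[OF T(1,2,1)] d2_def
      using rep2_deriv_swap[OF \<omega> c, of "x ?c" "y ?c" "x ?c"] by (simp add: z)
    show "ext_deriv A \<omega> p [y, x, x] = 0" unfolding ext[OF T(2,1,1)] d2_def by (simp add: z)
  next
    fix vs assume "\<not> (length vs = 3 \<and> set vs \<subseteq> tangent_space A p)"
    then show "ext_deriv A \<omega> p vs = 0" by (intro ext_deriv_zero[OF \<omega>]) simp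
  qed
next
  fix c and us :: "'e list" assume c: "c \<in> A" and "length us = 3"
  then obtain u v w where us: "us = [u, v, w]" by (auto simp: length_3_conv)
  show "smooth_on (im_of c) (\<lambda>x. ext_deriv A \<omega> (param c x) (map (tvec_of A c (param c x)) us))"
    by (rule smooth_on_cong[OF open_im[OF c] _ smooth_d2[OF \<omega> c, of u v w]])
       (simp add: us ext_deriv_2_coord[OF \<omega> c])
qed

lemma d2_has_derivative:
  assumes \<omega>: "diff_form A 2 \<omega>" and c: "c \<in> A" "x \<in> im_of c"
  shows "frechet_derivative (\<lambda>y. d2 \<omega> c y u v w) (at x) h =
    frechet_derivative (\<lambda>y. frechet_derivative (\<lambda>y. rep2 \<omega> c y v w) (at y) u) (at x) h
    - frechet_derivative (\<lambda>y. frechet_derivative (\<lambda>y. rep2 \<omega> c y u w) (at y) v) (at x) h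
    + frechet_derivative (\<lambda>y. frechet_derivative (\<lambda>y. rep2 \<omega> c y u v) (at y) w) (at x) h"
proof -
  note der = smooth_on_has_derivative[OF smooth_on_frechet_derivative[OF smooth_rep2[OF \<omega> c(1)]] c(2)]
  show ?thesis
    unfolding d2_def
    by (subst frechet_derivative_at[symmetric, OF has_derivative_add[OF has_derivative_diff[OF der der] der]]) simp
qed

lemma ext_deriv_ext_deriv_2:
  assumes \<omega>: "diff_form A 2 \<omega>" shows "ext_deriv A (ext_deriv A \<omega>) = 0"
proof (intro ext)
  fix p vs
  have "ext_deriv A (ext_deriv A \<omega>) p vs = 0"
  proof (cases "length vs = 4 \<and> set vs \<subseteq> tangent_space A p")
    case False
    then show ?thesis by (intro ext_deriv_zero[OF diff_form_ext_deriv_2[OF \<omega>]]) simp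
  next
    case True
    then obtain a b e f where vs: "vs = [a, b, e, f]"
      by (auto simp: numeral_eq_Suc length_Suc_conv)
    let ?c = "chart_at A p"
    have c: "?c \<in> A" "coord ?c p \<in> im_of ?c" using chart_at_in[of p] by (auto simp: charts_at_iff)
    \<comment> \<open>The inner derivative at the nearby point \<open>param ?c x\<close> refers to
      the chart chosen at that point. It is rewritten in the fixed chart \<open>?c\<close> before
      being differentiated in \<open>x\<close>.\<close>
    have eq: "frechet_derivative (\<lambda>x. ext_deriv A \<omega> (param ?c x)
        [tvec_of A ?c (param ?c x) u, tvec_of A ?c (param ?c x) v, tvec_of A ?c (param ?c x) w]) (at (coord ?c p)) h =
      frechet_derivative (\<lambda>y. d2 \<omega> ?c y u v w) (at (coord ?c p)) h" for u v w h
    proof -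
      have "((\<lambda>x. ext_deriv A \<omega> (param ?c x)
        [tvec_of A ?c (param ?c x) u, tvec_of A ?c (param ?c x) v, tvec_of A ?c (param ?c x) w])
        has_derivative frechet_derivative (\<lambda>y. d2 \<omega> ?c y u v w) (at (coord ?c p))) (at (coord ?c p))"
        by (rule has_derivative_transform_within_open[OF smooth_on_has_derivative[OF smooth_d2[OF \<omega> c(1)] c(2)] open_im[OF c(1)] c(2)])
           (rule ext_deriv_2_coord[OF \<omega> c(1), symmetric])
      then show ?thesis by (rule fun_cong[OF frechet_derivative_at[symmetric]])
    qed
    note sym = second_derivative_symmetric[OF open_im[OF c(1)] c(2) smooth_rep2[OF \<omega> c(1)]]
    have T: "set [a, b, e, f] \<subseteq> tangent_space A p" using True vs by simp
    have "ext_deriv A (ext_deriv A \<omega>) p vs =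
      frechet_derivative (\<lambda>y. d2 \<omega> ?c y (b ?c) (e ?c) (f ?c)) (at (coord ?c p)) (a ?c)
      - frechet_derivative (\<lambda>y. d2 \<omega> ?c y (a ?c) (e ?c) (f ?c)) (at (coord ?c p)) (b ?c)
      + frechet_derivative (\<lambda>y. d2 \<omega> ?c y (a ?c) (b ?c) (f ?c)) (at (coord ?c p)) (e ?c)
      - frechet_derivative (\<lambda>y. d2 \<omega> ?c y (a ?c) (b ?c) (e ?c)) (at (coord ?c p)) (f ?c)"
      unfolding vs ext_deriv_def[of A "ext_deriv A \<omega>"] Let_def if_P[OF T]
      by (simp add: eq)
    also have "\<dots> = 0"
      unfolding d2_has_derivative[OF \<omega> c]
      \<comment> \<open>One instance for each choice of two of the four vectors as arguments of the
        form, the other two being the directions: the twelve second derivatives cancel in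
        pairs.\<close>
      using sym[of "e ?c" "f ?c" "a ?c" "b ?c"] sym[of "b ?c" "f ?c" "a ?c" "e ?c"] sym[of "b ?c" "e ?c" "a ?c" "f ?c"]
        sym[of "a ?c" "f ?c" "b ?c" "e ?c"] sym[of "a ?c" "e ?c" "b ?c" "f ?c"] sym[of "a ?c" "b ?c" "e ?c" "f ?c"]
      by linarith
    finally show ?thesis .
  qed
  then show "ext_deriv A (ext_deriv A \<omega>) p vs = 0 p vs" by simp
qed

end

lemma alternating_forms_sum:
  assumes "\<And>i. i \<in> I \<Longrightarrow> \<eta> i \<in> alternating_forms k V"
  shows "(\<lambda>vs. \<Sum>i\<in>I. r i * \<eta> i vs) \<in> alternating_forms k V"
  unfolding alternating_forms_def
proof (intro CollectI conjI allI impI; (elim conjE)?)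
  fix vs x y and i :: nat and a b :: real
  assume h: "length vs = k" "set vs \<subseteq> V" "i < k" "x \<in> V" "y \<in> V"
  have "(\<Sum>j\<in>I. r j * \<eta> j (vs[i := a *\<^sub>R x + b *\<^sub>R y])) =
    (\<Sum>j\<in>I. a * (r j * \<eta> j (vs[i := x])) + b * (r j * \<eta> j (vs[i := y])))"
    by (intro sum.cong refl) (simp add: alternating_forms_update[OF assms h] algebra_simps)
  then show "(\<Sum>j\<in>I. r j * \<eta> j (vs[i := a *\<^sub>R x + b *\<^sub>R y])) =
    a * (\<Sum>j\<in>I. r j * \<eta> j (vs[i := x])) + b * (\<Sum>j\<in>I. r j * \<eta> j (vs[i := y]))"
    by (simp add: sum.distrib sum_distrib_left)
next
  fix vs and i j :: nat
  assume h: "length vs = k" "set vs \<subseteq> V" "i < j" "j < k" "vs ! i = vs ! j"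
  show "(\<Sum>l\<in>I. r l * \<eta> l vs) = 0"
    by (intro sum.neutral ballI) (simp add: alternating_forms_eq[OF assms h])
next
  fix vs assume h: "\<not> (length vs = k \<and> set vs \<subseteq> V)"
  show "(\<Sum>l\<in>I. r l * \<eta> l vs) = 0"
    by (intro sum.neutral ballI) (simp add: alternating_forms_zero[OF assms h])
qed

context smooth_manifold
begin

subsection \<open>Gluing of forms\<close>

definition smooth_fun where
  "smooth_fun f \<longleftrightarrow> (\<forall>c\<in>A. smooth_on (im_of c) (\<lambda>x. f (param c x) :: real))"

lemma diff_form_weighted_sum:
  assumes f: "\<And>i. i \<in> I \<Longrightarrow> smooth_fun (f i)" and \<eta>: "\<And>i. i \<in> I \<Longrightarrow> diff_form A k (\<eta> i)"
  shows "diff_form A k (\<lambda>p vs. \<Sum>i\<in>I. f i p * \<eta> i p vs)"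
  unfolding diff_form_def
proof (intro conjI allI ballI impI)
  show "(\<lambda>vs. \<Sum>i\<in>I. f i p * \<eta> i p vs) \<in> alternating_forms k (tangent_space A p)" for p
    by (rule alternating_forms_sum[OF diff_form_in[OF \<eta>]])
  fix c and us :: "'e list" assume c: "c \<in> A" and us: "length us = k"
  show "smooth_on (im_of c) (\<lambda>x. \<Sum>i\<in>I. f i (param c x) * \<eta> i (param c x) (map (tvec_of A c (param c x)) us))"
  proof (intro smooth_on_sum smooth_on_mult open_im[OF c])
    fix i assume i: "i \<in> I"
    show "smooth_on (im_of c) (\<lambda>x. f i (param c x))" using f[OF i] c by (simp add: smooth_fun_def)
    show "smooth_on (im_of c) (\<lambda>x. \<eta> i (param c x) (map (tvec_of A c (param c x)) us))"
      using \<eta>[OF i] c us unfolding diff_form_def by blast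
  qed
qed

lemma diff_form_local:
  assumes "\<And>p. \<exists>U \<eta>. open U \<and> p \<in> U \<and> diff_form A k \<eta> \<and> (\<forall>q\<in>U. \<omega> q = \<eta> q)"
  shows "diff_form A k \<omega>"
  unfolding diff_form_def
proof (intro conjI allI ballI impI)
  show "\<omega> p \<in> alternating_forms k (tangent_space A p)" for p
    using assms[of p] diff_form_in by metis
  fix c and us :: "'e list" assume c: "c \<in> A" and us: "length us = k"
  show "smooth_on (im_of c) (\<lambda>x. \<omega> (param c x) (map (tvec_of A c (param c x)) us))"
  proof (rule smooth_on_local)
    fix x assume x: "x \<in> im_of c"
    obtain U \<eta> where U: "open U" "param c x \<in> U" "diff_form A k \<eta>" "\<And>q. q \<in> U \<Longrightarrow> \<omega> q = \<eta> q"
      using assms by metis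
    let ?U = "{y \<in> im_of c. param c y \<in> U}"
    have oU: "open ?U" by (rule open_param_vimage[OF c U(1)])
    have "smooth_on (im_of c) (\<lambda>x. \<eta> (param c x) (map (tvec_of A c (param c x)) us))"
      using U(3) c us unfolding diff_form_def by blast
    then have "smooth_on ?U (\<lambda>x. \<eta> (param c x) (map (tvec_of A c (param c x)) us))"
      by (rule smooth_on_subset) blast
    then have "smooth_on ?U (\<lambda>x. \<omega> (param c x) (map (tvec_of A c (param c x)) us))"
      by (rule smooth_on_cong[OF oU, rotated]) (simp add: U(4))
    then show "\<exists>U. open U \<and> x \<in> U \<and> smooth_on U (\<lambda>x. \<omega> (param c x) (map (tvec_of A c (param c x)) us))"
      using oU x U(2) by blast
  qed
qed

lemma open_coord_vimage:
  assumes "c \<in> A" "open N" shows "open {p \<in> dom_of c. coord c p \<in> N}"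
proof -
  have "open (coord c -` N \<inter> dom_of c)"
    using continuous_on_open_vimage[OF open_dom[OF assms(1)]] cont_coord[OF assms(1)] assms(2) by blast
  moreover have "coord c -` N \<inter> dom_of c = {p \<in> dom_of c. coord c p \<in> N}" by auto
  ultimately show ?thesis by simp
qed

text \<open>The preimages of \<open>O'\<close> and of the complement of \<open>K\<close> are open
  and cover the chart image: on the first, smoothness is assumed; on the second, \<open>g\<close> is
  zero.\<close>

lemma smooth_on_extend_zero:
  fixes g :: "'e \<Rightarrow> real"
  assumes d: "d \<in> A" and "closed K" "open O'" "K \<subseteq> O'"
    and zero: "\<And>y. y \<in> im_of d \<Longrightarrow> param d y \<notin> K \<Longrightarrow> g y = 0"
    and g: "smooth_on {y \<in> im_of d. param d y \<in> O'} g"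
  shows "smooth_on (im_of d) g"
proof (rule smooth_on_local)
  fix x assume x: "x \<in> im_of d"
  let ?U = "{y \<in> im_of d. param d y \<in> O'}" and ?V = "{y \<in> im_of d. param d y \<in> - K}"
  have o: "open ?U" "open ?V" by (rule open_param_vimage[OF d assms(3)], rule open_param_vimage[OF d open_Compl[OF assms(2)]])
  have "smooth_on ?V g"
    by (rule smooth_on_cong[OF o(2) _ smooth_on_const[of _ 0]]) (simp add: zero)
  then show "\<exists>U. open U \<and> x \<in> U \<and> smooth_on U g"
  proof (cases "param d x \<in> K")
    case True
    then show ?thesis using g o(1) x assms(4) by (intro exI[of _ ?U]) auto
  next
    case False
    then show ?thesis using \<open>smooth_on ?V g\<close> o(2) x by (intro exI[of _ ?V]) auto
  qed
qed

end

section \<open>A global 2-form inverting the bivector along the leaves\<close>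

context bivector_manifold
begin

text \<open>The cut-off multiplies the local solution, so the right-hand side of its equation
  acquires the same factor \<open>f\<close>. In this weighted form the equation holds on the whole
  manifold, and solutions can be added with their weights.\<close>

lemma inverse_form_local:
  assumes rank: "\<And>p. dim (characteristic_distribution A \<pi> p) = r"
  obtains V f \<eta> where "open V" "q \<in> V" "\<And>p. p \<in> V \<Longrightarrow> f p = 1" "smooth_fun f" "diff_form A 2 \<eta>"
    "\<And>p \<alpha> \<beta>. \<alpha> \<in> cotangent_space A p \<Longrightarrow> \<beta> \<in> cotangent_space A p \<Longrightarrow>
       \<eta> p [sharp A \<pi> p \<alpha>, sharp A \<pi> p \<beta>] = f p * \<pi> p [\<alpha>, \<beta>]"
proof -
  define c where "c = chart_at A q"
  have cq: "c \<in> charts_at A q" unfolding c_def by (rule chart_at_in)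
  then have c: "c \<in> A" and q: "q \<in> dom_of c" by (auto simp: charts_at_iff)
  define x0 where "x0 = coord c q"
  have x0: "x0 \<in> im_of c" using q by (simp add: x0_def)
  obtain N W where N: "open N" "x0 \<in> N" "N \<subseteq> im_of c"
    and lin1: "\<And>y v. y \<in> N \<Longrightarrow> linear (\<lambda>u. W y u v :: real)" and lin2: "\<And>y u. y \<in> N \<Longrightarrow> linear (W y u)"
    and alt: "\<And>y u. y \<in> N \<Longrightarrow> W y u u = 0" and smW: "\<And>u v. smooth_on N (\<lambda>y. W y u v)"
    and WP: "\<And>y a b. y \<in> N \<Longrightarrow> W y (bivec_map c (param c y) a) (bivec_map c (param c y) b) = bivec_map c (param c y) a \<bullet> b"
  proof (rule regular_bivector_local_inverse[of "im_of c" x0 "\<lambda>y. bivec_map c (param c y)" r])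
    show "dim (range (bivec_map c (param c y))) = r" if "y \<in> im_of c" for y
      using dim_characteristic[OF param_charts[OF c that]] rank by simp
  qed (use open_im[OF c] x0 linear_bivec_map[OF param_charts[OF c]] bivec_map_skew[OF param_charts[OF c]]
        smooth_bivec_map[OF c] in blast)+
  obtain e where e: "e > 0" "ball x0 e \<subseteq> N" using N openE by blast
  \<comment> \<open>The bump vanishes beyond the radius \<open>2 * r\<close>, which is less than
    \<open>e\<close>, so its support stays inside \<open>N\<close>.\<close>
  define r where "r = e / 3"
  have r: "r > 0" and cb: "cball x0 (2 * r) \<subseteq> N" using e by (auto simp: r_def)
  obtain \<rho> :: "'e \<Rightarrow> real" where \<rho>: "smooth_on UNIV \<rho>" "\<And>x. dist x0 x < r \<Longrightarrow> \<rho> x = 1"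
    "\<And>x. 2 * r < dist x0 x \<Longrightarrow> \<rho> x = 0"
    using smooth_bump[OF r, of x0] by blast
  define K where "K = param c ` cball x0 (2 * r)"
  have "compact K" unfolding K_def
    using cont_param[OF c] cb N(3) by (intro compact_continuous_image compact_cball) (auto intro: continuous_on_subset)
  \<comment> \<open>By the Hausdorff property \<open>K\<close> is closed in the whole manifold and
    not just in the chart domain. Otherwise the extension by zero could fail to be smooth at
    boundary points of the domain.\<close>
  then have clK: "closed K" by (rule compact_imp_closed)
  define D where "D = {p \<in> dom_of c. coord c p \<in> N}"
  have oD: "open D" unfolding D_def by (rule open_coord_vimage[OF c N(1)])
  have KD: "K \<subseteq> D"
  proof
    fix p assume "p \<in> K"
    then obtain x where x: "x \<in> cball x0 (2 * r)" "p = param c x" unfolding K_def by blast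
    then have "x \<in> N" "x \<in> im_of c" using cb N(3) by blast+
    then show "p \<in> D" using coord_param[of x c] param_dom[of x c] by (simp add: D_def x(2))
  qed
  have \<rho>0: "\<rho> (coord c p) = 0" if "p \<in> D" "p \<notin> K" for p
  proof (rule \<rho>(3), rule ccontr)
    assume "\<not> 2 * r < dist x0 (coord c p)"
    then have "param c (coord c p) \<in> K" unfolding K_def by (intro imageI) simp
    then show False using that by (simp add: D_def param_coord[OF c])
  qed
  define f where "f p = (if p \<in> D then \<rho> (coord c p) else 0)" for p
  define \<eta> where "\<eta> p vs = (if p \<in> D \<and> length vs = 2 \<and> set vs \<subseteq> tangent_space A p
     then \<rho> (coord c p) * W (coord c p) ((vs ! 0) c) ((vs ! 1) c) else 0)" for p vs
  define V where "V = {p \<in> dom_of c. coord c p \<in> ball x0 r}"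
  have VD: "p \<in> D" if "p \<in> V" for p
    using that r cb unfolding V_def D_def by (auto simp: subset_iff)
  have smdom: "open {y \<in> im_of d. param d y \<in> D}" "{y \<in> im_of d. param d y \<in> D} \<subseteq> overlap d c"
      "trans d c ` {y \<in> im_of d. param d y \<in> D} \<subseteq> N" if "d \<in> A" for d
    using open_param_vimage[OF that oD] overlap_iff[OF that] by (auto simp: D_def)
  have smc: "smooth_on {y \<in> im_of d. param d y \<in> D} (\<lambda>y. \<rho> (trans d c y))" if "d \<in> A" for d
    by (rule smooth_on_compose[OF smdom(1)[OF that] open_UNIV _ smooth_on_subset[OF smooth_trans[OF that c] smdom(2)[OF that]] \<rho>(1)]) simp
  show ?thesis
  proof (rule that[of V f \<eta>])
    show "open V" unfolding V_def by (rule open_coord_vimage[OF c open_ball])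
    show "q \<in> V" using q r by (simp add: V_def x0_def)
    show "f p = 1" if "p \<in> V" for p
      using VD[OF that] that \<rho>(2) by (simp add: f_def V_def)
    show "smooth_fun f" unfolding smooth_fun_def
    proof
      fix d assume d: "d \<in> A"
      show "smooth_on (im_of d) (\<lambda>x. f (param d x))"
      proof (rule smooth_on_extend_zero[OF d clK oD KD])
        show "f (param d y) = 0" if "param d y \<notin> K" for y
          using \<rho>0 that by (simp add: f_def)
        show "smooth_on {y \<in> im_of d. param d y \<in> D} (\<lambda>x. f (param d x))"
          by (rule smooth_on_cong[OF smdom(1)[OF d] _ smc[OF d]]) (simp add: f_def)
      qed
    qed
    show "diff_form A 2 \<eta>" unfolding diff_form_def
    proof (intro conjI allI ballI impI)
      fix p
      show "\<eta> p \<in> alternating_forms 2 (tangent_space A p)"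
      proof (cases "p \<in> D")
        case False
        then show ?thesis unfolding \<eta>_def by (intro alternating_forms_2I) simp_all
      next
        case True
        then have N': "coord c p \<in> N" by (simp add: D_def)
        show ?thesis unfolding \<eta>_def
          by (rule alternating_forms_2I)
             (use True in \<open>auto simp: tangent_lin_in linear_add[OF lin1[OF N']] linear_cmul[OF lin1[OF N']]
               linear_add[OF lin2[OF N']] linear_cmul[OF lin2[OF N']] alt[OF N'] algebra_simps\<close>)
      qed
    next
      fix d and us :: "'e list" assume d: "d \<in> A" and "length us = 2"
      then obtain u v where us: "us = [u, v]" by (auto simp: length_2_conv)
      let ?M = "{y \<in> im_of d. param d y \<in> D}"
      note sub = smooth_on_subset[OF _ smdom(2)[OF d]]
      have smD: "smooth_on ?M (\<lambda>y. dtrans d c y w)" for w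
        by (rule sub[OF smooth_on_frechet_derivative[OF smooth_trans[OF d c]]])
      have MN: "trans d c y \<in> N" if "y \<in> ?M" for y using smdom(3)[OF d] that by blast
      have smW': "smooth_on ?M (\<lambda>y. W (trans d c y) a b)" for a b
        by (rule smooth_on_compose[OF smdom(1)[OF d] N(1) smdom(3)[OF d] sub[OF smooth_trans[OF d c]] smW])
      have smWu: "smooth_on ?M (\<lambda>y. W (trans d c y) (dtrans d c y u) b)" for b
        by (rule smooth_on_family_apply[OF smdom(1)[OF d] lin1[OF MN] smW' smD])
      have "smooth_on ?M (\<lambda>y. W (trans d c y) (dtrans d c y u) (dtrans d c y v))"
        by (rule smooth_on_family_apply[OF smdom(1)[OF d] lin2[OF MN] smWu smD])
      then have sm: "smooth_on ?M (\<lambda>y. \<rho> (trans d c y) * W (trans d c y) (dtrans d c y u) (dtrans d c y v))"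
        by (rule smooth_on_mult[OF smdom(1)[OF d] smc[OF d]])
      show "smooth_on (im_of d) (\<lambda>x. \<eta> (param d x) (map (tvec_of A d (param d x)) us))"
      proof (rule smooth_on_extend_zero[OF d clK oD KD])
        show "\<eta> (param d y) (map (tvec_of A d (param d y)) us) = 0" if "param d y \<notin> K" for y
          using \<rho>0 that by (simp add: \<eta>_def)
        show "smooth_on ?M (\<lambda>x. \<eta> (param d x) (map (tvec_of A d (param d x)) us))"
        proof (rule smooth_on_cong[OF smdom(1)[OF d] _ sm])
          fix y assume y: "y \<in> ?M"
          have yo: "y \<in> overlap d c" using smdom(2)[OF d] y by blast
          note ch = overlap_charts[OF d c yo]
          show "\<rho> (trans d c y) * W (trans d c y) (dtrans d c y u) (dtrans d c y v) =
            \<eta> (param d y) (map (tvec_of A d (param d y)) us)"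
            using y unfolding \<eta>_def us trans_deriv_param[OF d c yo, symmetric]
            by (simp add: tvec_of_in[OF ch(1)] tvec_of_apply[OF ch(2)])
        qed
      qed
    qed
    show "\<eta> p [sharp A \<pi> p \<alpha>, sharp A \<pi> p \<beta>] = f p * \<pi> p [\<alpha>, \<beta>]"
      if ab: "\<alpha> \<in> cotangent_space A p" "\<beta> \<in> cotangent_space A p" for p \<alpha> \<beta>
    proof (cases "p \<in> D")
      case True
      then have cp: "c \<in> charts_at A p" and xN: "coord c p \<in> N" using c by (auto simp: charts_at_iff D_def)
      note p = param_coord_charts[OF cp]
      have "W (coord c p) (sharp A \<pi> p \<alpha> c) (sharp A \<pi> p \<beta> c) = \<pi> p [\<alpha>, \<beta>]"
        using WP[OF xN, of "covec_coord c p \<alpha>" "covec_coord c p \<beta>"]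
        unfolding p sharp_apply[OF ab(1) cp] sharp_apply[OF ab(2) cp] bivec_eq_inner[OF ab cp] .
      then show ?thesis using True ab by (simp add: \<eta>_def f_def sharp_in)
    qed (simp add: \<eta>_def f_def)
  qed
qed

text \<open>Second countability enters through a countable subcover, whose enumeration orders the
  cut-offs so that products over the earlier ones can serve as weights. The weighted equations then
  add up to the original one as soon as the weights have total 1.\<close>

lemma inverse_form_global:
  assumes rank: "\<And>p. dim (characteristic_distribution A \<pi> p) = r"
  obtains \<omega> where "diff_form A 2 \<omega>"
    "\<And>p \<alpha> \<beta>. \<alpha> \<in> cotangent_space A p \<Longrightarrow> \<beta> \<in> cotangent_space A p \<Longrightarrow>
       \<omega> p [sharp A \<pi> p \<alpha>, sharp A \<pi> p \<beta>] = \<pi> p [\<alpha>, \<beta>]"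
proof -
  define good where "good V f \<eta> \<longleftrightarrow> open V \<and> (\<forall>p\<in>V. f p = 1) \<and> smooth_fun f \<and> diff_form A 2 \<eta> \<and>
    (\<forall>p. \<forall>\<alpha>\<in>cotangent_space A p. \<forall>\<beta>\<in>cotangent_space A p.
       \<eta> p [sharp A \<pi> p \<alpha>, sharp A \<pi> p \<beta>] = f p * \<pi> p [\<alpha>, \<beta>])" for V f \<eta>
  have ex: "\<exists>V. q \<in> V \<and> (\<exists>h. good V (fst h) (snd h))" for q
  proof (rule inverse_form_local[OF rank, of q])
    fix V f \<eta>
    assume "open V" and q: "q \<in> V" and "\<And>p. p \<in> V \<Longrightarrow> f p = 1" "smooth_fun f" "diff_form A 2 \<eta>"
      "\<And>p \<alpha> \<beta>. \<alpha> \<in> cotangent_space A p \<Longrightarrow> \<beta> \<in> cotangent_space A p \<Longrightarrow>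
         \<eta> p [sharp A \<pi> p \<alpha>, sharp A \<pi> p \<beta>] = f p * \<pi> p [\<alpha>, \<beta>]"
    then have "good V (fst (f, \<eta>)) (snd (f, \<eta>))" unfolding good_def fst_conv snd_conv by simp
    then have "\<exists>h. good V (fst h) (snd h)" by (rule exI)
    with q have "q \<in> V \<and> (\<exists>h. good V (fst h) (snd h))" by (rule conjI)
    then show "\<exists>V. q \<in> V \<and> (\<exists>h. good V (fst h) (snd h))" by (rule exI)
  qed
  define V0 where "V0 q = (SOME V. q \<in> V \<and> (\<exists>h. good V (fst h) (snd h)))" for q
  have V0: "q \<in> V0 q" "\<exists>h. good (V0 q) (fst h) (snd h)" for q
    by (rule conjunct1[OF someI_ex[OF ex[of q], folded V0_def]])
       (rule conjunct2[OF someI_ex[OF ex[of q], folded V0_def]])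
  have "open (V0 q)" for q using V0(2)[of q] unfolding good_def by (elim exE conjE)
  then have oV0: "open S" if "S \<in> range V0" for S using that by blast
  obtain \<F> where \<F>: "\<F> \<subseteq> range V0" "countable \<F>" "\<Union>\<F> = \<Union>(range V0)"
    by (rule Lindelof[OF oV0])
  have cover: "\<Union>\<F> = UNIV" using \<F>(3) V0(1) by blast
  then have "\<F> \<noteq> {}" by auto
  define V where "V = from_nat_into \<F>"
  have rV: "range V = \<F>" unfolding V_def by (rule range_from_nat_into[OF \<open>\<F> \<noteq> {}\<close> \<F>(2)])
  have ex_h: "\<exists>h. good (V n) (fst h) (snd h)" for n
  proof -
    have "V n \<in> range V0" using rV \<F>(1) by blast
    then obtain q where "V n = V0 q" by blast
    then show ?thesis using V0(2)[of q] by simp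
  qed
  \<comment> \<open>The subcover remembers sets but not the points they came from, so a cut-off and
    a form are chosen anew for each member.\<close>
  define h where "h n = (SOME h. good (V n) (fst h) (snd h))" for n
  define f \<eta> where "f n = fst (h n)" and "\<eta> n = snd (h n)" for n
  have good: "good (V n) (f n) (\<eta> n)" for n
    using someI_ex[OF ex_h[of n]] unfolding f_def \<eta>_def h_def .
  have oV: "open (V n)" and f1: "\<And>p. p \<in> V n \<Longrightarrow> f n p = 1" and smf: "smooth_fun (f n)" and d\<eta>: "diff_form A 2 (\<eta> n)"
    and val: "\<And>p \<alpha> \<beta>. \<alpha> \<in> cotangent_space A p \<Longrightarrow> \<beta> \<in> cotangent_space A p \<Longrightarrow>
       \<eta> n p [sharp A \<pi> p \<alpha>, sharp A \<pi> p \<beta>] = f n p * \<pi> p [\<alpha>, \<beta>]" for n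
    using good[of n] unfolding good_def by simp_all
  \<comment> \<open>As \<open>f k = 1\<close> on \<open>V k\<close>, all weights \<open>g n * f n\<close> with \<open>n > k\<close> vanish there: the partition of unity
    \<open>g n * f n\<close> is locally finite although the \<open>V n\<close> need not be.\<close>
  define g where "g n p = (\<Prod>k<n. 1 - f k p)" for n p
  define \<Omega> where "\<Omega> N p vs = (\<Sum>n<N. g n p * \<eta> n p vs)" for N p vs
  have smg: "smooth_fun (g n)" for n
    using smf unfolding g_def smooth_fun_def
    by (intro ballI smooth_on_prod smooth_on_diff smooth_on_const open_im) blast+
  have d\<Omega>: "diff_form A 2 (\<Omega> N)" for N
    unfolding \<Omega>_def[abs_def] by (intro diff_form_weighted_sum smg d\<eta>)
  \<comment> \<open>The sum telescopes, because
    \<open>g n p * f n p = g n p - g (Suc n) p\<close>.\<close>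
  have sum1: "(\<Sum>n<N. g n p * f n p) = 1 - g N p" for N p
    by (induction N) (simp_all add: g_def algebra_simps)
  have g0: "g N p = 0" if "p \<in> V m" "m < N" for N m p
    unfolding g_def using that f1[OF that(1)] by (intro prod_zero) auto
  have stable: "\<Omega> N p = \<Omega> (Suc m) p" if "p \<in> V m" "Suc m \<le> N" for N m p
  proof
    fix vs
    show "\<Omega> N p vs = \<Omega> (Suc m) p vs"
      unfolding \<Omega>_def by (rule sum.mono_neutral_right) (use that g0[OF that(1)] in auto)
  qed
  have "\<exists>m. p \<in> V m" for p using cover unfolding rV[symmetric] by blast
  note ex_m = this
  define m where "m p = (LEAST m. p \<in> V m)" for p
  have m: "p \<in> V (m p)" for p unfolding m_def by (rule LeastI_ex[OF ex_m])
  define \<omega> where "\<omega> p = \<Omega> (Suc (m p)) p" for p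
  have \<omega>eq: "\<omega> p = \<Omega> (Suc k) p" if "p \<in> V k" for p k
    unfolding \<omega>_def
    by (rule trans[OF stable[OF m[of p] max.cobounded1[of _ "Suc k"], symmetric] stable[OF that max.cobounded2]])
  show ?thesis
  proof (rule that)
    show "diff_form A 2 \<omega>"
    proof (rule diff_form_local)
      fix p
      show "\<exists>U \<eta>. open U \<and> p \<in> U \<and> diff_form A 2 \<eta> \<and> (\<forall>q\<in>U. \<omega> q = \<eta> q)"
        by (intro exI[of _ "V (m p)"] exI[of _ "\<Omega> (Suc (m p))"] conjI ballI oV m d\<Omega> \<omega>eq)
    qed
    show "\<omega> p [sharp A \<pi> p \<alpha>, sharp A \<pi> p \<beta>] = \<pi> p [\<alpha>, \<beta>]"
      if "\<alpha> \<in> cotangent_space A p" "\<beta> \<in> cotangent_space A p" for p \<alpha> \<beta>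
    proof -
      have "\<omega> p [sharp A \<pi> p \<alpha>, sharp A \<pi> p \<beta>] = (\<Sum>n<Suc (m p). g n p * f n p) * \<pi> p [\<alpha>, \<beta>]"
        unfolding \<omega>_def \<Omega>_def val[OF that] by (simp add: sum_distrib_right mult.assoc distrib_right)
      also have "\<dots> = \<pi> p [\<alpha>, \<beta>]" unfolding sum1 using g0[OF m, of p "Suc (m p)"] by simp
      finally show ?thesis .
    qed
  qed
qed

end

context smooth_manifold
begin

text \<open>A bridge between the Riesz vectors used in \<open>twisted_jacobi_coordinates\<close> and
  the components \<open>rep1\<close> used by the Cartan operators.\<close>

lemma covec_coord_has_derivative:
  assumes \<alpha>: "diff_form A 1 \<alpha>" and x: "c \<in> A" "x \<in> im_of c"
  defines "a \<equiv> \<lambda>y. covec_coord c (param c y) (\<alpha> (param c y))"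
  shows "(a has_derivative frechet_derivative a (at x)) (at x)"
    and "frechet_derivative a (at x) h \<bullet> v = frechet_derivative (\<lambda>y. rep1 \<alpha> c y v) (at x) h"
    and "a x \<bullet> v = rep1 \<alpha> c x v"
proof -
  have "smooth_on (im_of c) a"
    unfolding a_def covec_coord_def using smooth_rep1[OF \<alpha> x(1)]
    by (intro smooth_on_sum smooth_on_scaleR smooth_on_const open_im[OF x(1)]) (simp add: rep1_def)
  then show der: "(a has_derivative frechet_derivative a (at x)) (at x)"
    by (rule smooth_on_has_derivative[OF _ x(2)])
  have inner: "a y \<bullet> v = rep1 \<alpha> c y v" if "y \<in> im_of c" for y
    unfolding a_def rep1_def
    by (rule covec_coord_inner[OF _ param_charts[OF x(1) that]])
       (use diff_form_in[OF \<alpha>] in \<open>simp add: cotangent_space_def\<close>)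
  show "a x \<bullet> v = rep1 \<alpha> c x v" by (rule inner[OF x(2)])
  have "((\<lambda>y. rep1 \<alpha> c y v) has_derivative (\<lambda>h. frechet_derivative a (at x) h \<bullet> v)) (at x)"
    by (rule has_derivative_transform_within_open[OF has_derivative_inner_left[OF der] open_im[OF x(1)] x(2) inner])
  from fun_cong[OF frechet_derivative_at[OF this]]
  show "frechet_derivative a (at x) h \<bullet> v = frechet_derivative (\<lambda>y. rep1 \<alpha> c y v) (at x) h" .
qed

subsection \<open>The covector part of the Courant bracket\<close>

definition courant1 where
  "courant1 X \<alpha> Y \<beta> \<omega> c x v = lie1 X \<beta> c x v - d1 \<alpha> c x (repv Y c x) v + d2 \<omega> c x (repv X c x) (repv Y c x) v"

lemma
  assumes X: "vector_field A X" and Y: "vector_field A Y" and \<alpha>: "diff_form A 1 \<alpha>" and \<beta>: "diff_form A 1 \<beta>"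
    and \<omega>: "diff_form A 2 \<omega>" and c: "c \<in> A"
  shows linear_courant1: "x \<in> im_of c \<Longrightarrow> linear (courant1 X \<alpha> Y \<beta> \<omega> c x)"
    and smooth_courant1: "smooth_on (im_of c) (\<lambda>x. courant1 X \<alpha> Y \<beta> \<omega> c x v)"
proof -
  note o = open_im[OF c]
  have l1: "linear (\<lambda>v. frechet_derivative (\<lambda>y. rep1 \<gamma> c y v) (at x) h)" if "diff_form A 1 \<gamma>" "x \<in> im_of c" for x \<gamma> h
    by (rule linear_derivative_of_family[OF o that(2) linear_rep1[OF that(1) c] smooth_on_has_derivative[OF smooth_rep1[OF that(1) c] that(2)]])
  have l2: "linear (frechet_derivative f (at x))" if "smooth_on (im_of c) f" "x \<in> im_of c" for f :: "'e \<Rightarrow> 'v::real_normed_vector" and x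
    by (rule has_derivative_linear[OF smooth_on_has_derivative[OF that]])
  show "linear (courant1 X \<alpha> Y \<beta> \<omega> c x)" if x: "x \<in> im_of c"
    unfolding courant1_def[abs_def] lie1_def d1_def d2_def
    by (rule linear_compose_add[OF linear_compose_sub[OF
          linear_compose_add[OF l1[OF \<beta> x] linear_compose[OF l2[OF smooth_repv[OF X c] x] linear_rep1[OF \<beta> c x], unfolded o_def]]
          linear_compose_sub[OF l1[OF \<alpha> x] l2[OF smooth_rep1[OF \<alpha> c] x]]]
          linear_compose_add[OF linear_compose_sub[OF linear_rep2_deriv_right[OF \<omega> c x] linear_rep2_deriv_right[OF \<omega> c x]]
            l2[OF smooth_rep2[OF \<omega> c] x]]])
  note sv = smooth_repv[OF X c] smooth_repv[OF Y c]
  have s1: "smooth_on (im_of c) (\<lambda>x. lie1 X \<beta> c x v)"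
    unfolding lie1_def
    by (rule smooth_on_add[OF o smooth_on_derivative_apply[OF o smooth_rep1[OF \<beta> c] sv(1)]
        smooth_on_family_apply[OF o linear_rep1[OF \<beta> c] smooth_rep1[OF \<beta> c] smooth_on_frechet_derivative[OF sv(1)]]])
  have s2: "smooth_on (im_of c) (\<lambda>x. d1 \<alpha> c x (repv Y c x) v)"
    unfolding d1_def
    by (rule smooth_on_diff[OF o smooth_on_derivative_apply[OF o smooth_rep1[OF \<alpha> c] sv(2)]
        smooth_on_family_apply[OF o l1[OF \<alpha>] smooth_on_frechet_derivative[OF smooth_rep1[OF \<alpha> c]] sv(2)]])
  \<comment> \<open>An argument of the form and the direction of differentiation both vary with
    \<open>x\<close>. They are freed one after the other, each by linearity in its own slot.\<close>
  have s3: "smooth_on (im_of c) (\<lambda>x. frechet_derivative (\<lambda>y. rep2 \<omega> c y (g x) v) (at x) (h x))"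
    if "smooth_on (im_of c) g" "smooth_on (im_of c) h" for g h v
    by (rule smooth_on_family_apply[OF o linear_rep2_deriv_left[OF \<omega> c] smooth_on_derivative_apply[OF o smooth_rep2[OF \<omega> c] that(2)] that(1)])
  have s4: "smooth_on (im_of c) (\<lambda>x. frechet_derivative (\<lambda>y. rep2 \<omega> c y (repv X c x) (repv Y c x)) (at x) v)"
    by (rule smooth_on_family_apply[OF o linear_rep2_deriv_right[OF \<omega> c] s3[OF sv(1) smooth_on_const] sv(2)])
  have "smooth_on (im_of c) (\<lambda>x. d2 \<omega> c x (repv X c x) (repv Y c x) v)"
    unfolding d2_def by (rule smooth_on_add[OF o smooth_on_diff[OF o s3[OF sv(2,1)] s3[OF sv]] s4])
  then show "smooth_on (im_of c) (\<lambda>x. courant1 X \<alpha> Y \<beta> \<omega> c x v)"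
    unfolding courant1_def by (rule smooth_on_add[OF o smooth_on_diff[OF o s1 s2]])
qed

lemma courant_covector_eq:
  assumes X: "vector_field A X" and Y: "vector_field A Y" and \<alpha>: "diff_form A 1 \<alpha>" and \<beta>: "diff_form A 1 \<beta>"
    and \<omega>: "diff_form A 2 \<omega>" and c: "c \<in> charts_at A p" and v: "v \<in> tangent_space A p"
  shows "snd (courant_bracket A (ext_deriv A \<omega>) (X, \<alpha>) (Y, \<beta>)) p [v] = courant1 X \<alpha> Y \<beta> \<omega> c (coord c p) (v c)"
proof -
  have T: "X p \<in> tangent_space A p" "Y p \<in> tangent_space A p" using X Y by (simp_all add: vector_field_def)
  have "repv X c (coord c p) = X p c" "repv Y c (coord c p) = Y p c"
    by (simp_all add: repv_def param_coord_charts[OF c])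
  then show ?thesis
    by (simp add: courant_bracket_def interior_prod_def courant1_def lie_deriv_1[OF X \<beta> c v]
        ext_deriv_1[OF \<alpha> c T(2) v] ext_deriv_2[OF \<omega> c T v])
qed

lemma diff_form_courant:
  assumes X: "vector_field A X" and Y: "vector_field A Y" and \<alpha>: "diff_form A 1 \<alpha>" and \<beta>: "diff_form A 1 \<beta>"
    and \<omega>: "diff_form A 2 \<omega>"
  shows "diff_form A 1 (snd (courant_bracket A (ext_deriv A \<omega>) (X, \<alpha>) (Y, \<beta>)))" (is "diff_form A 1 ?\<gamma>")
  unfolding diff_form_def
proof (intro conjI allI ballI impI)
  fix p
  note eq = courant_covector_eq[OF assms chart_at_in[of p]]
  have "chart_at A p \<in> A" "coord (chart_at A p) p \<in> im_of (chart_at A p)"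
    using chart_at_in[of p] by (auto simp: charts_at_iff)
  note lin = linear_courant1[OF assms this]
  show "?\<gamma> p \<in> alternating_forms 1 (tangent_space A p)"
  proof (rule alternating_forms_1I)
    fix x y and a b :: real
    assume T: "x \<in> tangent_space A p" "y \<in> tangent_space A p"
    show "?\<gamma> p [a *\<^sub>R x + b *\<^sub>R y] = a * ?\<gamma> p [x] + b * ?\<gamma> p [y]"
      unfolding eq[OF T(1)] eq[OF T(2)] eq[OF tangent_lin_in[OF T]]
      by (simp add: linear_add[OF lin] linear_cmul[OF lin])
  next
    fix vs assume vs: "\<not> (length vs = 1 \<and> set vs \<subseteq> tangent_space A p)"
    have "lie_deriv A X \<beta> p vs = 0" by (rule lie_deriv_zero[OF \<beta> vs])
    moreover have "ext_deriv A \<alpha> p (Y p # vs) = 0" by (rule ext_deriv_zero[OF \<alpha>]) (use vs in auto)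
    moreover have "ext_deriv A \<omega> p (X p # Y p # vs) = 0" by (rule ext_deriv_zero[OF \<omega>]) (use vs in auto)
    ultimately show "?\<gamma> p vs = 0" by (simp add: courant_bracket_def interior_prod_def)
  qed
next
  fix c and us :: "'e list" assume c: "c \<in> A" and "length us = 1"
  then obtain u where us: "us = [u]" by (auto simp: length_Suc_conv)
  show "smooth_on (im_of c) (\<lambda>x. ?\<gamma> (param c x) (map (tvec_of A c (param c x)) us))"
  proof (rule smooth_on_cong[OF open_im[OF c] _ smooth_courant1[OF assms c, of u]])
    fix x assume x: "x \<in> im_of c"
    note ch = param_charts[OF c x]
    show "courant1 X \<alpha> Y \<beta> \<omega> c x u = ?\<gamma> (param c x) (map (tvec_of A c (param c x)) us)"
      using courant_covector_eq[OF assms ch tvec_of_in[OF ch, of u]]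
      unfolding us tvec_of_self[OF ch] coord_param[OF x] by simp
  qed
qed

end

section \<open>Closure of the graph under the twisted bracket\<close>

context bivector_manifold
begin

text \<open>\<open>X\<close> and \<open>Y\<close> are functions on the chart image rather than
  vector fields on the manifold, because one of them will also be the image under
  \<open>bivec_map\<close> of a constant coordinate covector, which exists in this chart
  only.\<close>

lemma involutive_in_chart:
  assumes int: "integrable_distribution A (characteristic_distribution A \<pi>)" and c: "c \<in> charts_at A p"
    and X: "\<And>y. y \<in> im_of c \<Longrightarrow> X y \<in> range (bivec_map c (param c y))"
    and Y: "\<And>y. y \<in> im_of c \<Longrightarrow> Y y \<in> range (bivec_map c (param c y))"
    and X': "(X has_derivative X') (at (coord c p))" and Y': "(Y has_derivative Y') (at (coord c p))"
  shows "Y' (X (coord c p)) - X' (Y (coord c p)) \<in> range (bivec_map c p)"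
proof -
  have cA: "c \<in> A" and p: "p \<in> dom_of c" using c by (auto simp: charts_at_iff)
  obtain S W f where I: "integral_manifold_param A (characteristic_distribution A \<pi>) S W f" and "p \<in> f ` (W \<inter> S)"
    using int[unfolded integrable_distribution_def, THEN spec, of p] by (elim exE conjE)
  then obtain s0 where s0: "s0 \<in> W" "s0 \<in> S" "f s0 = p" by (elim imageE IntE) simp
  have S: "subspace S" and W: "open W" and f: "smooth_map_into A W f"
    and ders: "\<forall>x\<in>W \<inter> S. inj_on (differential A f x) S \<and>
      differential A f x ` S = characteristic_distribution A \<pi> (f x)"
    using I unfolding integral_manifold_param_def by blast+
  have der: "inj_on (differential A f x) S" "differential A f x ` S = characteristic_distribution A \<pi> (f x)"
    if "x \<in> W \<inter> S" for x
    using bspec[OF ders that] by blast+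
  define F where "F = coord c \<circ> f"
  define W' where "W' = {s \<in> W. f s \<in> dom_of c}"
  have "W' = f -` dom_of c \<inter> W" by (auto simp: W'_def)
  then have oW: "open W'"
    using f open_dom[OF cA] continuous_on_open_vimage[OF W, of f] by (simp add: smooth_map_into_def)
  have F: "smooth_on W' F" using f cA unfolding smooth_map_into_def F_def W'_def by blast
  have s0': "s0 \<in> W'" using s0 p by (simp add: W'_def)
  have Fs0: "F s0 = coord c p" by (simp add: F_def s0)
  have app: "differential A f s u c = frechet_derivative F (at s) u" if "s \<in> W'" for s u
    using that cA by (simp add: differential_def F_def W'_def charts_at_iff)
  have rng: "range (bivec_map c (param c (F s))) = frechet_derivative F (at s) ` S" if s: "s \<in> W'" "s \<in> S" for s
  proof -
    have cs: "c \<in> charts_at A (f s)" and fs: "f s \<in> dom_of c" and sW: "s \<in> W \<inter> S"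
      using s cA by (auto simp: charts_at_iff W'_def)
    have "param c (F s) = f s" by (simp add: F_def param_coord[OF cA fs])
    then have "range (bivec_map c (param c (F s))) = (\<lambda>v. v c) ` characteristic_distribution A \<pi> (f s)"
      by (simp add: characteristic_eq[OF cs] image_image tvec_of_self[OF cs])
    also have "\<dots> = frechet_derivative F (at s) ` S"
      unfolding der(2)[OF sW, symmetric] by (simp add: image_image app[OF s(1)])
    finally show ?thesis .
  qed
  \<comment> \<open>The immersion condition concerns \<open>differential\<close>, which records all
    charts at once. Passing to the single chart \<open>c\<close> loses nothing, since a tangent
    vector is determined by its coordinates in one chart.\<close>
  have inj: "z = 0" if z: "z \<in> S" "frechet_derivative F (at s0) z = 0" for z
  proof -
    have sW: "s0 \<in> W \<inter> S" using s0 by simp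
    have S0: "0 \<in> S" by (rule subspace_0[OF S])
    have T: "differential A f s0 u \<in> tangent_space A p" if "u \<in> S" for u
    proof -
      have "differential A f s0 u \<in> characteristic_distribution A \<pi> p"
        using der(2)[OF sW] that s0(3) by blast
      then show ?thesis unfolding characteristic_eq[OF c] by (elim imageE) (simp only: tvec_of_in[OF c])
    qed
    have "frechet_derivative F (at s0) 0 = 0"
      by (rule linear_0[OF has_derivative_linear[OF smooth_on_has_derivative[OF F s0']]])
    then have "differential A f s0 z = differential A f s0 0"
      using z by (intro tangent_eqI[OF T[OF z(1)] T[OF S0] c]) (simp add: app[OF s0'])
    then show ?thesis using der(1)[OF sW] z(1) S0 by (simp add: inj_on_def)
  qed
  have FX: "X (F s) \<in> frechet_derivative F (at s) ` S" and FY: "Y (F s) \<in> frechet_derivative F (at s) ` S"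
    if s: "s \<in> W'" "s \<in> S" for s
  proof -
    have "F s \<in> im_of c" using s by (simp add: F_def W'_def)
    then show "X (F s) \<in> frechet_derivative F (at s) ` S" "Y (F s) \<in> frechet_derivative F (at s) ` S"
      using X[of "F s"] Y[of "F s"] unfolding rng[OF s] by blast+
  qed
  have "Y' (X (F s0)) - X' (Y (F s0)) \<in> frechet_derivative F (at s0) ` S"
    by (rule integral_manifold_involutive[OF oW s0' s0(2) F S inj FX FY]) (simp_all add: Fs0 X' Y')
  then show ?thesis
    unfolding rng[OF s0' s0(2), symmetric] Fs0 param_coord[OF cA p] .
qed

text \<open>The coordinate identity is applied in each chart around \<open>p\<close>, with the
  components of \<omega> as \<open>W\<close>. The assumption on \<omega>, tested on coordinate
  covectors, is exactly the inverse relation required of \<open>W\<close>.\<close>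

lemma courant_bracket_in_graph:
  assumes int: "integrable_distribution A (characteristic_distribution A \<pi>)"
    and \<omega>: "diff_form A 2 \<omega>"
    and \<omega>\<pi>: "\<And>p \<alpha> \<beta>. \<alpha> \<in> cotangent_space A p \<Longrightarrow> \<beta> \<in> cotangent_space A p \<Longrightarrow>
       \<omega> p [sharp A \<pi> p \<alpha>, sharp A \<pi> p \<beta>] = \<pi> p [\<alpha>, \<beta>]"
    and s: "s \<in> graph_sections A \<pi>" and t: "t \<in> graph_sections A \<pi>"
  shows "courant_bracket A (ext_deriv A \<omega>) s t \<in> graph_sections A \<pi>"
proof -
  obtain X \<alpha> Y \<beta> where st: "s = (X, \<alpha>)" "t = (Y, \<beta>)" by (metis surj_pair)
  have X: "vector_field A X" and Y: "vector_field A Y" and \<alpha>: "diff_form A 1 \<alpha>" and \<beta>: "diff_form A 1 \<beta>"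
    and X\<alpha>: "\<And>p. X p = sharp A \<pi> p (\<alpha> p)" and Y\<beta>: "\<And>p. Y p = sharp A \<pi> p (\<beta> p)"
    using s t by (auto simp: st graph_sections_def)
  have cot: "\<alpha> p \<in> cotangent_space A p" "\<beta> p \<in> cotangent_space A p" for p
    using diff_form_in[OF \<alpha>] diff_form_in[OF \<beta>] by (simp_all add: cotangent_space_def)
  define \<gamma> where "\<gamma> = snd (courant_bracket A (ext_deriv A \<omega>) (X, \<alpha>) (Y, \<beta>))"
  have \<gamma>: "diff_form A 1 \<gamma>" unfolding \<gamma>_def by (rule diff_form_courant[OF X Y \<alpha> \<beta> \<omega>])
  then have cot\<gamma>: "\<gamma> p \<in> cotangent_space A p" for p using diff_form_in by (simp add: cotangent_space_def)
  have key: "lie_bracket A X Y p c = bivec_map c p (covec_coord c p (\<gamma> p))" if c: "c \<in> charts_at A p" for c p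
  proof -
    have cA: "c \<in> A" and p: "p \<in> dom_of c" using c by (auto simp: charts_at_iff)
    define x where "x = coord c p"
    have x: "x \<in> im_of c" using p by (simp add: x_def)
    have px: "param c x = p" unfolding x_def by (rule param_coord_charts[OF c])
    define P where "P y = bivec_map c (param c y)" for y
    note ch = param_charts[OF cA]
    note derP = smooth_on_has_derivative[OF smooth_bivec_map[OF cA] x, folded P_def]
    note derX = smooth_on_has_derivative[OF smooth_repv[OF X cA] x]
      and derY = smooth_on_has_derivative[OF smooth_repv[OF Y cA] x]
    have XP: "repv X c y = P y (covec_coord c (param c y) (\<alpha> (param c y)))"
      and YP: "repv Y c y = P y (covec_coord c (param c y) (\<beta> (param c y)))" if "y \<in> im_of c" for y
      unfolding repv_def X\<alpha> Y\<beta> P_def by (rule sharp_apply[OF cot(1) ch[OF that]], rule sharp_apply[OF cot(2) ch[OF that]])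
    have XR: "repv X c y \<in> range (bivec_map c (param c y))" and YR: "repv Y c y \<in> range (bivec_map c (param c y))"
      if "y \<in> im_of c" for y
      using XP[OF that] YP[OF that] by (simp_all add: P_def)
    have PR: "P y w \<in> range (bivec_map c (param c y))" for y w by (simp add: P_def)
    note inv = involutive_in_chart[OF int c, folded x_def]
    have "P x (covec_coord c p (\<gamma> p)) =
      frechet_derivative (repv Y c) (at x) (repv X c x) - frechet_derivative (repv X c) (at x) (repv Y c x)"
    proof (rule twisted_jacobi_coordinates[OF open_im[OF cA] x _ derP
          linear_rep2_left[OF \<omega> cA] linear_rep2_right[OF \<omega> cA] rep2_swap[OF \<omega> cA]
          smooth_on_has_derivative[OF smooth_rep2[OF \<omega> cA] x] _ XP YP derX derY
          covec_coord_has_derivative(1)[OF \<alpha> cA x] covec_coord_has_derivative(1)[OF \<beta> cA x]])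
      show "P y u \<bullet> v = - (u \<bullet> P y v)" if "y \<in> im_of c" for y u v unfolding P_def by (rule bivec_map_skew[OF ch[OF that]])
      show "rep2 \<omega> c y (P y a) (P y b) = P y a \<bullet> b" if y: "y \<in> im_of c" for y a b
      proof -
        note cv = covec_of_in[OF ch[OF y]] and cc = covec_coord_covec_of[OF ch[OF y]]
        show ?thesis
          using \<omega>\<pi>[OF cv[of a] cv[of b]]
          unfolding sharp_eq[OF cv ch[OF y]] cc bivec_map_inner[OF ch[OF y], symmetric] rep2_def P_def .
      qed
      show "frechet_derivative (repv Y c) (at x) (repv X c x) - frechet_derivative (repv X c) (at x) (repv Y c x) \<in> range (P x)"
        unfolding P_def px by (rule inv[OF XR YR derX derY])
      show "frechet_derivative (\<lambda>y. P y w) (at x) (repv X c x) - frechet_derivative (repv X c) (at x) (P x w) \<in> range (P x)" for w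
        using inv[OF XR PR derX derP] by (simp add: P_def px)
      show "frechet_derivative (\<lambda>y. P y w) (at x) (repv Y c x) - frechet_derivative (repv Y c) (at x) (P x w) \<in> range (P x)" for w
        using inv[OF YR PR derY derP] by (simp add: P_def px)
      fix v
      have "covec_coord c p (\<gamma> p) \<bullet> v = \<gamma> p [tvec_of A c p v]" by (rule covec_coord_inner[OF cot\<gamma> c])
      also have "\<dots> = courant1 X \<alpha> Y \<beta> \<omega> c x v"
        using courant_covector_eq[OF X Y \<alpha> \<beta> \<omega> c tvec_of_in[OF c, of v]]
        unfolding tvec_of_self[OF c] \<gamma>_def x_def .
      finally show "covec_coord c p (\<gamma> p) \<bullet> v =
        frechet_derivative (\<lambda>y. covec_coord c (param c y) (\<beta> (param c y))) (at x) (repv X c x) \<bullet> v +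
        covec_coord c (param c x) (\<beta> (param c x)) \<bullet> frechet_derivative (repv X c) (at x) v -
        (frechet_derivative (\<lambda>y. covec_coord c (param c y) (\<alpha> (param c y))) (at x) (repv Y c x) \<bullet> v -
         frechet_derivative (\<lambda>y. covec_coord c (param c y) (\<alpha> (param c y))) (at x) v \<bullet> repv Y c x) +
        (frechet_derivative (\<lambda>y. rep2 \<omega> c y (repv Y c x) v) (at x) (repv X c x) -
         frechet_derivative (\<lambda>y. rep2 \<omega> c y (repv X c x) v) (at x) (repv Y c x) +
         frechet_derivative (\<lambda>y. rep2 \<omega> c y (repv X c x) (repv Y c x)) (at x) v)"
        unfolding covec_coord_has_derivative(2,3)[OF \<alpha> cA x] covec_coord_has_derivative(2,3)[OF \<beta> cA x]
          courant1_def lie1_def d1_def d2_def .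
    qed
    then show ?thesis
      using c px by (simp add: lie_bracket_def P_def repv_def[abs_def] x_def[symmetric])
  qed
  have Z: "lie_bracket A X Y p = sharp A \<pi> p (\<gamma> p)" for p
  proof
    fix c show "lie_bracket A X Y p c = sharp A \<pi> p (\<gamma> p) c"
    proof (cases "c \<in> charts_at A p")
      case True
      then show ?thesis using key sharp_apply[OF cot\<gamma>] by simp
    next
      case False
      then have "sharp A \<pi> p (\<gamma> p) c = 0" using sharp_in[OF cot\<gamma>, of p] unfolding tangent_space_def by blast
      then show ?thesis using False by (simp add: lie_bracket_def)
    qed
  qed
  \<comment> \<open>That the coordinate brackets in different charts form one tangent vector is
    inherited from \<open>sharp\<close>, with which the bracket agrees by \<open>Z\<close>; only
    smoothness is left to be read in a chart.\<close>
  have "vector_field A (lie_bracket A X Y)"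
    unfolding vector_field_def
  proof (intro conjI allI ballI)
    show "lie_bracket A X Y p \<in> tangent_space A p" for p unfolding Z by (rule sharp_in[OF cot\<gamma>])
    fix c assume c: "c \<in> A"
    have "smooth_on (im_of c) (\<lambda>x. frechet_derivative (repv Y c) (at x) (repv X c x) - frechet_derivative (repv X c) (at x) (repv Y c x))"
      by (intro smooth_on_diff smooth_on_derivative_apply open_im[OF c] smooth_repv[OF X c] smooth_repv[OF Y c])
    then show "smooth_on (im_of c) (\<lambda>x. lie_bracket A X Y (param c x) c)"
      by (rule smooth_on_cong[OF open_im[OF c], rotated])
         (simp add: lie_bracket_def param_charts[OF c] coord_param repv_def[abs_def])
  qed
  moreover have "courant_bracket A (ext_deriv A \<omega>) s t = (lie_bracket A X Y, \<gamma>)"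
    by (simp add: st \<gamma>_def courant_bracket_def)
  ultimately show ?thesis using \<gamma> Z by (simp add: graph_sections_def)
qed

end

theorem corollary3p7:
  fixes A :: "('p::{t2_space,second_countable_topology}, 'e::euclidean_space) chart set"
    and \<pi> :: "('p, 'e) bivector"
  assumes "smooth_atlas A"
    and "bivector_field A \<pi>"
    and "regular_distribution (characteristic_distribution A \<pi>)"
    and "integrable_distribution A (characteristic_distribution A \<pi>)"
  shows "\<exists>\<phi>. exact_form A 3 \<phi> \<and> twisted_poisson A \<phi> \<pi>"
proof -
  interpret bivector_manifold A \<pi> by unfold_locales (rule assms(1,2))+
  obtain r where r: "\<And>p. dim (characteristic_distribution A \<pi> p) = r"
    using assms(3) unfolding regular_distribution_def by blast
  obtain \<omega> where \<omega>: "diff_form A 2 \<omega>"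
    and \<omega>\<pi>: "\<And>p \<alpha> \<beta>. \<alpha> \<in> cotangent_space A p \<Longrightarrow> \<beta> \<in> cotangent_space A p \<Longrightarrow>
       \<omega> p [sharp A \<pi> p \<alpha>, sharp A \<pi> p \<beta>] = \<pi> p [\<alpha>, \<beta>]"
    using inverse_form_global[OF r] by blast
  have d\<omega>: "diff_form A 3 (ext_deriv A \<omega>)" by (rule diff_form_ext_deriv_2[OF \<omega>])
  have "(3::nat) = Suc 2" by simp
  then have "exact_form A 3 (ext_deriv A \<omega>)"
    unfolding exact_form_def using d\<omega> \<omega> by blast
  moreover have "twisted_poisson A (ext_deriv A \<omega>) \<pi>"
    unfolding twisted_poisson_def closed_form_def
    using assms(2) d\<omega> ext_deriv_ext_deriv_2[OF \<omega>] courant_bracket_in_graph[OF assms(4) \<omega> \<omega>\<pi>] by blast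
  ultimately show ?thesis by blast
qed

end
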